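(* Let $\Lambda$ be a lattice in $\mathbb{R}^d\times\widehat{\mathbb{R}}^d$ and let $\mathcal{A}=C^*(\Lambda,\beta)$. For $f,g\in S_0(\mathbb{R}^d)$ put $$\langle f,g\rangle_{\mathcal{A}}=\sum_{\lambda\in\Lambda}V_gf(\lambda)\,\pi(\lambda).$$ Then Feichtinger's algebra $S_0(\mathbb{R}^d)$ is a left Hilbert $C^*(\Lambda,\beta)$-module with respect to $\langle\cdot,\cdot\rangle_{\mathcal{A}}$, in the following sense: $\langle\cdot,\cdot\rangle_{\mathcal{A}}$ is a well-defined $\mathcal{A}$-valued inner product on the left $\ell^1(\Lambda)$-module $S_0(\mathbb{R}^d)$, and the completion of $S_0(\mathbb{R}^d)$ in the norm $\|f\|_{\mathcal A}:=\|\langle f,f\rangle_{\mathcal{A}}\|^{1/2}$, with the continuously extended action and inner product, is a left Hilbert $\mathcal{A}$-module.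
   Context: The inner product of $L^2(\mathbb{R}^d)$ is linear in the first argument. Time-frequency shifts: $T_xf(t)=f(t-x)$, $M_\omega f(t)=e^{2\pi i\omega\cdot t}f(t)$, $\pi(x,\omega)=M_\omega T_x$ for $(x,\omega)\in\mathbb{R}^d\times\widehat{\mathbb{R}}^d$. The cocycle $\beta$ (with values in the unit circle) is defined by $\pi(X)\pi(Y)=\beta(X,Y)\pi(X+Y)$. A lattice is a discrete cocompact subgroup of $\mathbb{R}^d\times\widehat{\mathbb{R}}^d$. $C^*(\Lambda,\beta)$ is the $C^*$-algebra of operators on $L^2(\mathbb{R}^d)$ generated by $\{\pi(\lambda):\lambda\in\Lambda\}$. The short-time Fourier transform is $V_gf(X)=\langle f,\pi(X)g\rangle$. With the Gaussian $\varphi(x)=2^{-d/4}e^{-\pi x\cdot x}$, Feichtinger's algebra is $S_0(\mathbb{R}^d)=\{f\in L^2(\mathbb{R}^d): \|f\|_{S_0}=\iint|V_\varphi f(x,\omega)|\,dx\,d\omega<\infty\}$. A sequence $\mathbf a=(a(\lambda))\in\ell^1(\Lambda)$ (identified with the operator $\sum_\lambda a(\lambda)\pi(\lambda)\in\mathcal{A}$; such operators form a dense $*$-subalgebra of $\mathcal{A}$) acts on $g\in S_0(\mathbb{R}^d)$ by $\mathbf a g=\sum_{\lambda\in\Lambda}a(\lambda)\pi(\lambda)g$. An $\mathcal{A}$-valued inner product on a left module $V$ is a sesquilinear map $V\times V\to\mathcal{A}$, linear in the first argument, with $\langle f,g\rangle_{\mathcal A}=\langle g,f\rangle_{\mathcal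 A}^*$, $\langle Tf,g\rangle_{\mathcal A}=T\langle f,g\rangle_{\mathcal A}$ for $T$ in the algebra acting on $V$, and $\langle f,f\rangle_{\mathcal A}>0$ (positive and nonzero) for $f\ne0$. A left Hilbert $\mathcal{A}$-module is a left $\mathcal{A}$-module with an $\mathcal{A}$-valued inner product, complete in the norm $\|\langle f,f\rangle_{\mathcal A}\|^{1/2}$. *)

theory Defs
  imports "HOL-Probability.Distributions"
begin

section \<open>The Hilbert space \<open>L\<^sup>2\<close>\<close>

definition square_integrable :: "('a::euclidean_space \<Rightarrow> complex) \<Rightarrow> bool" where
  "square_integrable f \<longleftrightarrow>
     f \<in> borel_measurable lborel \<and> integrable lborel (\<lambda>x. (norm (f x))\<^sup>2)"

definition L2_rel :: "('a::euclidean_space \<Rightarrow> complex) \<Rightarrow> ('a \<Rightarrow> complex) \<Rightarrow> bool" where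
  "L2_rel f g \<longleftrightarrow> square_integrable f \<and> square_integrable g \<and> (AE x in lborel. f x = g x)"

lemma L2_relI:
  "square_integrable f \<Longrightarrow> square_integrable g \<Longrightarrow> (\<And>x. f x = g x) \<Longrightarrow> L2_rel f g"
  by (simp add: L2_rel_def)

lemma L2_rel_reflD: "L2_rel f f \<Longrightarrow> square_integrable f"
  by (simp add: L2_rel_def)

lemma square_integrable_0: "square_integrable (\<lambda>_. 0)"
  by (simp add: square_integrable_def)

lemma square_integrable_add:
  assumes "square_integrable f" "square_integrable g"
  shows "square_integrable (\<lambda>x. f x + g x)"
proof -
  have [measurable]: "f \<in> borel_measurable lborel" "g \<in> borel_measurable lborel"
    using assms by (auto simp: square_integrable_def)
  have "integrable lborel (\<lambda>x. 2 * (norm (f x))\<^sup>2 + 2 * (norm (g x))\<^sup>2)"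
    using assms by (auto simp: square_integrable_def)
  then have "integrable lborel (\<lambda>x. (norm (f x + g x))\<^sup>2)"
  proof (rule Bochner_Integration.integrable_bound)
    have "(norm (f x + g x))\<^sup>2 \<le> 2 * (norm (f x))\<^sup>2 + 2 * (norm (g x))\<^sup>2" for x
    proof -
      have "(norm (f x + g x))\<^sup>2 \<le> (norm (f x) + norm (g x))\<^sup>2"
        by (intro power_mono norm_triangle_ineq) simp
      also have "\<dots> \<le> 2 * (norm (f x))\<^sup>2 + 2 * (norm (g x))\<^sup>2"
        using sum_squares_bound[of "norm (f x)" "norm (g x)"] by (simp add: power2_sum)
      finally show ?thesis .
    qed
    then show "AE x in lborel. norm ((norm (f x + g x))\<^sup>2)
        \<le> norm (2 * (norm (f x))\<^sup>2 + 2 * (norm (g x))\<^sup>2)"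
      by (intro AE_I2) (simp add: abs_of_nonneg)
  qed simp
  then show ?thesis by (simp add: square_integrable_def)
qed

lemma square_integrable_cmult:
  assumes "square_integrable f"
  shows "square_integrable (\<lambda>x. c * f x)"
  using assms by (auto simp: square_integrable_def norm_mult power_mult_distrib)

lemma square_integrable_modulate:
  assumes "square_integrable f"
  shows "square_integrable (\<lambda>t. exp (2 * of_real pi * \<i> * of_real (\<omega> \<bullet> t)) * f t)"
proof -
  have "(\<lambda>t. exp (2 * of_real pi * \<i> * of_real (\<omega> \<bullet> t))) \<in> borel_measurable borel"
    by (intro borel_measurable_continuous_onI continuous_intros)
  then show ?thesis
    using assms by (auto simp: square_integrable_def norm_mult norm_exp_eq_Re)
qed

lemma square_integrable_translate:
  assumes "square_integrable f"
  shows "square_integrable (\<lambda>t. f (t - x))"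
proof -
  have m: "f \<in> borel_measurable borel" using assms by (auto simp: square_integrable_def)
  have i: "integrable (distr lborel borel ((+) (-x))) (\<lambda>t. (norm (f t))\<^sup>2)"
    using assms by (simp add: lborel_distr_plus square_integrable_def)
  have "integrable lborel (\<lambda>t. (norm (f (-x + t)))\<^sup>2)"
    by (rule integrable_distr[OF _ i]) simp
  moreover have "(\<lambda>t. f (t - x)) \<in> borel_measurable borel"
    using m by measurable
  ultimately show ?thesis by (simp add: square_integrable_def)
qed

lemmas square_integrable_intros =
  square_integrable_0 square_integrable_add square_integrable_cmult
  square_integrable_modulate

lemma AE_lborel_translate:
  fixes x :: "'a::euclidean_space"
  assumes "AE t in lborel. P t"
  shows "AE t in lborel. P (t - x)"
proof -
  have "AE t in distr lborel borel ((+) (-x)). P t"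
    unfolding lborel_distr_plus by (rule assms)
  then have "AE t in lborel. P (-x + t)"
    by (rule AE_distrD[rotated]) simp
  then show ?thesis by simp
qed

lemma integrable_inner_L2:
  assumes "square_integrable f" "square_integrable g"
  shows "integrable lborel (\<lambda>x. f x * cnj (g x))"
proof -
  have [measurable]: "f \<in> borel_measurable lborel" "g \<in> borel_measurable lborel"
    using assms by (auto simp: square_integrable_def)
  have "integrable lborel (\<lambda>x. (norm (f x))\<^sup>2 + (norm (g x))\<^sup>2)"
    using assms by (auto simp: square_integrable_def)
  then show ?thesis
  proof (rule Bochner_Integration.integrable_bound)
    have "norm (f x * cnj (g x)) \<le> (norm (f x))\<^sup>2 + (norm (g x))\<^sup>2" for x
    proof -
      have "0 \<le> (norm (f x))\<^sup>2" "0 \<le> (norm (g x))\<^sup>2" by simp_all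
      with sum_squares_bound[of "norm (f x)" "norm (g x)"]
      have "norm (f x) * norm (g x) \<le> (norm (f x))\<^sup>2 + (norm (g x))\<^sup>2"
        by linarith
      then show ?thesis by (simp add: norm_mult)
    qed
    then show "AE x in lborel. norm (f x * cnj (g x)) \<le> norm ((norm (f x))\<^sup>2 + (norm (g x))\<^sup>2)"
      by (intro AE_I2) (simp add: abs_of_nonneg)
    show "(\<lambda>x. f x * cnj (g x)) \<in> borel_measurable lborel"
      by (intro borel_measurable_times borel_measurable_continuous_on[where f=cnj])
         (auto intro: continuous_intros)
  qed
qed

quotient_type (overloaded) 'a L2 = "'a::euclidean_space \<Rightarrow> complex" / partial: L2_rel
proof (rule part_equivpI)
  show "\<exists>f. L2_rel f f" using square_integrable_0 by (auto simp: L2_rel_def)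
  show "symp L2_rel" by (auto intro!: sympI simp: L2_rel_def elim: eventually_mono)
  show "transp L2_rel"
    by (rule transpI) (auto simp: L2_rel_def elim: eventually_elim2)
qed

lift_definition scaleC :: "complex \<Rightarrow> 'a::euclidean_space L2 \<Rightarrow> 'a L2" (infixr \<open>*\<^sub>C\<close> 75)
  is "\<lambda>c f x. c * f x"
  by (auto simp: L2_rel_def intro!: square_integrable_cmult elim: eventually_mono)

lift_definition cinner :: "'a::euclidean_space L2 \<Rightarrow> 'a L2 \<Rightarrow> complex"
  is "\<lambda>f g. \<integral>x. f x * cnj (g x) \<partial>lborel"
proof -
  fix f f' g g' :: "'a \<Rightarrow> complex"
  assume a: "L2_rel f f'" "L2_rel g g'"
  then have "AE x in lborel. f x = f' x" "AE x in lborel. g x = g' x"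
    by (auto simp: L2_rel_def)
  then have "AE x in lborel. f x * cnj (g x) = f' x * cnj (g' x)"
    by eventually_elim simp
  moreover have "integrable lborel (\<lambda>x. f x * cnj (g x))" "integrable lborel (\<lambda>x. f' x * cnj (g' x))"
    using a by (auto simp: L2_rel_def intro!: integrable_inner_L2)
  ultimately show "(\<integral>x. f x * cnj (g x) \<partial>lborel) = (\<integral>x. f' x * cnj (g' x) \<partial>lborel)"
    by (intro integral_cong_AE) auto
qed

instantiation L2 :: (euclidean_space) real_inner
begin

lift_definition zero_L2 :: "'a L2" is "\<lambda>_. 0"
  by (simp add: L2_rel_def square_integrable_0)

lift_definition plus_L2 :: "'a L2 \<Rightarrow> 'a L2 \<Rightarrow> 'a L2" is "\<lambda>f g x. f x + g x"
  by (auto simp: L2_rel_def intro!: square_integrable_add elim: eventually_elim2)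

definition uminus_L2 :: "'a L2 \<Rightarrow> 'a L2" where "uminus_L2 f = (-1) *\<^sub>C f"
definition minus_L2 :: "'a L2 \<Rightarrow> 'a L2 \<Rightarrow> 'a L2" where "minus_L2 f g = f + (- g)"
definition scaleR_L2 :: "real \<Rightarrow> 'a L2 \<Rightarrow> 'a L2" where "scaleR_L2 r f = of_real r *\<^sub>C f"
definition inner_L2 :: "'a L2 \<Rightarrow> 'a L2 \<Rightarrow> real" where "inner_L2 f g = Re (cinner f g)"
definition norm_L2 :: "'a L2 \<Rightarrow> real" where "norm_L2 f = sqrt (inner f f)"
definition sgn_L2 :: "'a L2 \<Rightarrow> 'a L2" where "sgn_L2 f = inverse (norm f) *\<^sub>R f"
definition dist_L2 :: "'a L2 \<Rightarrow> 'a L2 \<Rightarrow> real" where "dist_L2 f g = norm (f - g)"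
definition uniformity_L2 :: "('a L2 \<times> 'a L2) filter" where
  "uniformity_L2 = (INF e\<in>{0 <..}. principal {(x, y). dist x y < e})"
definition open_L2 :: "'a L2 set \<Rightarrow> bool" where
  "open_L2 U \<longleftrightarrow> (\<forall>x\<in>U. eventually (\<lambda>(x', y). x' = x \<longrightarrow> y \<in> U) uniformity)"

instance
proof
  fix f g h :: "'a L2" and r s :: real
  show "f + g + h = f + (g + h)"
    by transfer (rule L2_relI; (intro square_integrable_intros)?; simp add: L2_rel_def algebra_simps)
  show "f + g = g + f"
    by transfer (rule L2_relI; (intro square_integrable_intros)?; simp add: L2_rel_def algebra_simps)
  show "0 + f = f"
    by transfer (rule L2_relI; (intro square_integrable_intros)?; simp add: L2_rel_def algebra_simps)
  show "- f + f = 0"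
    unfolding uminus_L2_def
    by transfer (rule L2_relI; (intro square_integrable_intros)?; simp add: L2_rel_def algebra_simps)
  show "f - g = f + - g"
    by (simp add: minus_L2_def)
  show "r *\<^sub>R (f + g) = r *\<^sub>R f + r *\<^sub>R g"
    unfolding scaleR_L2_def
    by transfer (rule L2_relI; (intro square_integrable_intros)?; simp add: L2_rel_def algebra_simps)
  show "(r + s) *\<^sub>R f = r *\<^sub>R f + s *\<^sub>R f"
    unfolding scaleR_L2_def
    by transfer (rule L2_relI; (intro square_integrable_intros)?; simp add: L2_rel_def algebra_simps)
  show "r *\<^sub>R s *\<^sub>R f = (r * s) *\<^sub>R f"
    unfolding scaleR_L2_def
    by transfer (rule L2_relI; (intro square_integrable_intros)?; simp add: L2_rel_def algebra_simps)
  show "1 *\<^sub>R f = f"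
    unfolding scaleR_L2_def by transfer (auto simp: L2_rel_def)
  show "dist f g = norm (f - g)" by (simp add: dist_L2_def)
  show "sgn f = inverse (norm f) *\<^sub>R f" by (simp add: sgn_L2_def)
  show "(uniformity :: ('a L2 \<times> 'a L2) filter) = (INF e\<in>{0 <..}. principal {(x, y). dist x y < e})"
    by (rule uniformity_L2_def)
  show "open U \<longleftrightarrow> (\<forall>x\<in>U. eventually (\<lambda>(x', y). x' = x \<longrightarrow> y \<in> U) uniformity)" for U :: "'a L2 set"
    by (rule open_L2_def)
  have cinner_cnj: "cinner g f = cnj (cinner f g)" for f g :: "'a L2"
  proof transfer
    fix f g :: "'a \<Rightarrow> complex"
    have "(\<integral>x. g x * cnj (f x) \<partial>lborel) = (\<integral>x. cnj (f x * cnj (g x)) \<partial>lborel)"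
      by (simp add: mult.commute)
    also have "\<dots> = cnj (\<integral>x. f x * cnj (g x) \<partial>lborel)"
      by (rule Bochner_Integration.integral_cnj)
    finally show "(\<integral>x. g x * cnj (f x) \<partial>lborel) = cnj (\<integral>x. f x * cnj (g x) \<partial>lborel)" .
  qed
  show "inner f g = inner g f"
    unfolding inner_L2_def by (subst cinner_cnj) simp
  have "cinner (f + g) h = cinner f h + cinner g h"
  proof transfer
    fix f g h :: "'a \<Rightarrow> complex"
    assume "L2_rel f f" "L2_rel g g" "L2_rel h h"
    then show "(\<integral>x. (f x + g x) * cnj (h x) \<partial>lborel)
        = (\<integral>x. f x * cnj (h x) \<partial>lborel) + (\<integral>x. g x * cnj (h x) \<partial>lborel)"
      by (simp add: L2_rel_def integrable_inner_L2 distrib_right)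
  qed
  then show "inner (f + g) h = inner f h + inner g h"
    by (simp add: inner_L2_def)
  have "cinner (c *\<^sub>C f) g = c * cinner f g" for c
    by transfer (simp add: mult.assoc)
  then show "inner (r *\<^sub>R f) g = r * inner f g"
    by (simp add: inner_L2_def scaleR_L2_def)
  have ff: "cinner f f = of_real (\<integral>x. (norm (F x))\<^sup>2 \<partial>lborel)"
    if "f = abs_L2 F" "square_integrable F" for F and f :: "'a L2"
  proof -
    have "cinner f f = (\<integral>x. F x * cnj (F x) \<partial>lborel)"
      using that by (simp add: cinner.abs_eq L2_rel_def)
    also have "\<dots> = (\<integral>x. of_real ((norm (F x))\<^sup>2) \<partial>lborel)"
      by (intro Bochner_Integration.integral_cong)
        (simp_all add: complex_norm_square[symmetric] del: of_real_power)
    also have "\<dots> = of_real (\<integral>x. (norm (F x))\<^sup>2 \<partial>lborel)"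
      by (rule integral_complex_of_real)
    finally show ?thesis .
  qed
  obtain F where F: "f = abs_L2 F" "square_integrable F"
    using Quotient3_abs_rep[OF Quotient3_L2, of f] Quotient3_rep_reflp[OF Quotient3_L2, of f]
    by (metis L2_rel_reflD)
  have i: "inner f f = (\<integral>x. (norm (F x))\<^sup>2 \<partial>lborel)"
    using ff[OF F] by (simp add: inner_L2_def)
  show "0 \<le> inner f f" unfolding i by simp
  have "inner f f = 0 \<longleftrightarrow> (AE x in lborel. (norm (F x))\<^sup>2 = 0)"
    unfolding i using F(2)
    by (intro integral_nonneg_eq_0_iff_AE) (auto simp: square_integrable_def)
  also have "\<dots> \<longleftrightarrow> L2_rel F (\<lambda>_. 0)"
    using F(2) by (simp add: L2_rel_def square_integrable_0)
  also have "\<dots> \<longleftrightarrow> f = 0"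
    unfolding F(1) zero_L2_def
    using Quotient3_rel[OF Quotient3_L2, of F "\<lambda>_. 0"] F(2)
    by (auto simp: L2_rel_def square_integrable_0)
  finally show "inner f f = 0 \<longleftrightarrow> f = 0" .
  show "norm f = sqrt (inner f f)" by (simp add: norm_L2_def)
qed

end

lemma norm_eq_of_cinner:
  fixes f g :: "'a::euclidean_space L2"
  assumes "cinner f f = cinner g g"
  shows "norm f = norm g"
  using assms by (simp add: norm_L2_def inner_L2_def)

lemma bounded_linear_scaleC: "bounded_linear (\<lambda>f::'a::euclidean_space L2. c *\<^sub>C f)"
proof (rule bounded_linear_intro[where K="norm c"])
  fix f g :: "'a L2" and r :: real
  show "c *\<^sub>C (f + g) = c *\<^sub>C f + c *\<^sub>C g"
    by transfer (rule L2_relI; (intro square_integrable_intros)?; simp add: L2_rel_def algebra_simps)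
  show "c *\<^sub>C (r *\<^sub>R f) = r *\<^sub>R (c *\<^sub>C f)"
    unfolding scaleR_L2_def
    by transfer (rule L2_relI; (intro square_integrable_intros)?; simp add: L2_rel_def algebra_simps)
  have "cinner (c *\<^sub>C f) (c *\<^sub>C f) = of_real ((norm c)\<^sup>2) * cinner f f"
  proof transfer
    fix c :: complex and f :: "'a \<Rightarrow> complex"
    have "c * f x * cnj (c * f x) = of_real ((norm c)\<^sup>2) * (f x * cnj (f x))" for x
      by (simp only: complex_norm_square complex_cnj_mult mult_ac)
    then have "(\<integral>x. c * f x * cnj (c * f x) \<partial>lborel)
        = (\<integral>x. of_real ((norm c)\<^sup>2) * (f x * cnj (f x)) \<partial>lborel)"
      by (intro Bochner_Integration.integral_cong refl)
    also have "\<dots> = of_real ((norm c)\<^sup>2) * (\<integral>x. f x * cnj (f x) \<partial>lborel)"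
      by (rule integral_mult_right_zero)
    finally show "(\<integral>x. c * f x * cnj (c * f x) \<partial>lborel)
        = of_real ((norm c)\<^sup>2) * (\<integral>x. f x * cnj (f x) \<partial>lborel)" .
  qed
  then have "norm (c *\<^sub>C f) = norm c * norm f"
    by (simp add: norm_L2_def inner_L2_def real_sqrt_mult del: of_real_power)
  then show "norm (c *\<^sub>C f) \<le> norm f * norm c"
    by simp
qed

section \<open>Time-frequency shifts\<close>

lift_definition translation :: "'a::euclidean_space \<Rightarrow> 'a L2 \<Rightarrow> 'a L2"
  is "\<lambda>x f t. f (t - x)"
proof -
  fix x :: 'a and f g :: "'a \<Rightarrow> complex"
  assume "L2_rel f g"
  then show "L2_rel (\<lambda>t. f (t - x)) (\<lambda>t. g (t - x))"
    using AE_lborel_translate[of "\<lambda>t. f t = g t" x]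
    by (simp add: L2_rel_def square_integrable_translate)
qed

lift_definition modulation :: "'a::euclidean_space \<Rightarrow> 'a L2 \<Rightarrow> 'a L2"
  is "\<lambda>\<omega> f t. exp (2 * of_real pi * \<i> * of_real (\<omega> \<bullet> t)) * f t"
  by (auto simp: L2_rel_def intro!: square_integrable_modulate elim: eventually_mono)

lemma bounded_linear_translation: "bounded_linear (translation x)"
proof (rule bounded_linear_intro[where K=1])
  fix f g :: "'a L2" and r :: real
  show "translation x (f + g) = translation x f + translation x g"
    by transfer
      (rule L2_relI; simp add: L2_rel_def square_integrable_add square_integrable_translate)
  show "translation x (r *\<^sub>R f) = r *\<^sub>R translation x f"
    unfolding scaleR_L2_def
    by transfer
      (rule L2_relI; simp add: L2_rel_def square_integrable_cmult square_integrable_translate)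
  have "cinner (translation x f) (translation x f) = cinner f f"
  proof transfer
    fix x :: 'a and f :: "'a \<Rightarrow> complex"
    assume f: "L2_rel f f"
    then have m: "(\<lambda>t. f t * cnj (f t)) \<in> borel_measurable borel"
      using borel_measurable_integrable[OF integrable_inner_L2[of f f]] by (simp add: L2_rel_def)
    have "(\<integral>t. f t * cnj (f t) \<partial>lborel) = (\<integral>t. f t * cnj (f t) \<partial>distr lborel borel ((+) (-x)))"
      by (simp add: lborel_distr_plus)
    also have "\<dots> = (\<integral>t. f (-x + t) * cnj (f (-x + t)) \<partial>lborel)"
      by (rule integral_distr[OF _ m]) simp
    finally show "(\<integral>t. f (t - x) * cnj (f (t - x)) \<partial>lborel) = (\<integral>t. f t * cnj (f t) \<partial>lborel)"
      by simp
  qed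
  then have "norm (translation x f) = norm f" by (rule norm_eq_of_cinner)
  then show "norm (translation x f) \<le> norm f * 1" by simp
qed

lemma bounded_linear_modulation: "bounded_linear (modulation \<omega>)"
proof (rule bounded_linear_intro[where K=1])
  fix f g :: "'a L2" and r :: real
  show "modulation \<omega> (f + g) = modulation \<omega> f + modulation \<omega> g"
    by transfer (rule L2_relI; (intro square_integrable_intros)?; simp add: L2_rel_def algebra_simps)
  show "modulation \<omega> (r *\<^sub>R f) = r *\<^sub>R modulation \<omega> f"
    unfolding scaleR_L2_def
    by transfer (rule L2_relI; (intro square_integrable_intros)?; simp add: L2_rel_def algebra_simps)
  have "cinner (modulation \<omega> f) (modulation \<omega> f) = cinner f f"
  proof transfer
    fix \<omega> :: 'a and f :: "'a \<Rightarrow> complex"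
    have u: "e * z * cnj (e * z) = z * cnj z" if "norm e = 1" for e z :: complex
    proof -
      have "e * z * cnj (e * z) = of_real ((norm (e * z))\<^sup>2)"
        by (simp only: complex_norm_square)
      also have "\<dots> = z * cnj z"
        using that by (simp only: norm_mult complex_norm_square mult_1)
      finally show ?thesis .
    qed
    show "(\<integral>t. exp (2 * of_real pi * \<i> * of_real (\<omega> \<bullet> t)) * f t
          * cnj (exp (2 * of_real pi * \<i> * of_real (\<omega> \<bullet> t)) * f t) \<partial>lborel)
        = (\<integral>t. f t * cnj (f t) \<partial>lborel)"
      by (intro Bochner_Integration.integral_cong refl u) (simp add: norm_exp_eq_Re)
  qed
  then have "norm (modulation \<omega> f) = norm f" by (rule norm_eq_of_cinner)
  then show "norm (modulation \<omega> f) \<le> norm f * 1" by simp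
qed

type_synonym 'a op = "'a L2 \<Rightarrow>\<^sub>L 'a L2"

definition tf_shift :: "'a \<times> 'a \<Rightarrow> 'a::euclidean_space op" where
  "tf_shift X = Blinfun (\<lambda>f. modulation (snd X) (translation (fst X) f))"

definition scale_op :: "complex \<Rightarrow> 'a::euclidean_space op \<Rightarrow> 'a op" where
  "scale_op c T = Blinfun (\<lambda>f. c *\<^sub>C blinfun_apply T f)"

lemma tf_shift_apply: "blinfun_apply (tf_shift (x, \<omega>)) f = modulation \<omega> (translation x f)"
  unfolding tf_shift_def
  by (simp add: bounded_linear_Blinfun_apply
      bounded_linear_compose[OF bounded_linear_modulation bounded_linear_translation])

lemma scale_op_apply: "blinfun_apply (scale_op c T) f = c *\<^sub>C blinfun_apply T f"
  unfolding scale_op_def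
  by (simp add: bounded_linear_Blinfun_apply
      bounded_linear_compose[OF bounded_linear_scaleC blinfun.bounded_linear_right])

definition stft :: "'a::euclidean_space L2 \<Rightarrow> 'a L2 \<Rightarrow> 'a \<times> 'a \<Rightarrow> complex" where
  "stft g f X = cinner f (blinfun_apply (tf_shift X) g)"

section \<open>Feichtinger's algebra\<close>

lemma square_integrable_gaussian:
  "square_integrable (\<lambda>x::'a::euclidean_space. complex_of_real (c * exp (- pi * (x \<bullet> x))))"
proof -
  define s where "s = 1 / (2 * sqrt pi)"
  have s: "s > 0" "2 * s\<^sup>2 = 1 / (2 * pi)" by (simp_all add: s_def power_divide power_mult_distrib)
  have "exp (- (2 * pi * y\<^sup>2)) = sqrt (2 * pi * s\<^sup>2) * normal_density 0 s y" for y :: real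
    using s by (simp add: normal_density_def field_simps)
  then have "integrable lborel (\<lambda>y::real. exp (- (2 * pi * y\<^sup>2)))"
    using s by simp
  then have fin: "(\<integral>\<^sup>+y. ennreal (exp (- (2 * pi * y\<^sup>2))) \<partial>(lborel::real measure)) < \<infinity>"
    by (simp add: integrable_iff_bounded)
  have eq: "exp (- (2 * pi * (x \<bullet> x))) = (\<Prod>b\<in>Basis. exp (- (2 * pi * (x \<bullet> b)\<^sup>2)))" for x :: 'a
    by (subst euclidean_inner) (simp add: exp_sum[symmetric] sum_distrib_left sum_negf power2_eq_square)
  have "(\<integral>\<^sup>+x. ennreal (exp (- (2 * pi * (x \<bullet> x)))) \<partial>(lborel::'a measure))
      = (\<integral>\<^sup>+x. (\<Prod>b\<in>Basis. ennreal (exp (- (2 * pi * (x \<bullet> b)\<^sup>2)))) \<partial>(lborel::'a measure))"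
    by (simp add: eq prod_ennreal)
  also have "\<dots> = (\<Prod>b\<in>(Basis::'a set). \<integral>\<^sup>+y. ennreal (exp (- (2 * pi * y\<^sup>2))) \<partial>(lborel::real measure))"
    by (rule nn_integral_lborel_prod) auto
  also have "\<dots> < \<infinity>"
    using fin by (simp add: power_less_top_ennreal)
  finally have "integrable lborel (\<lambda>x::'a. exp (- (2 * pi * (x \<bullet> x))))"
    by (simp add: integrable_iff_bounded)
  then have "integrable lborel (\<lambda>x::'a. c\<^sup>2 * exp (- (2 * pi * (x \<bullet> x))))" by simp
  moreover have "(norm (complex_of_real (c * exp (- pi * (x \<bullet> x)))))\<^sup>2
      = c\<^sup>2 * exp (- (2 * pi * (x \<bullet> x)))" for x :: 'a
    by (simp add: norm_mult power_mult_distrib exp_double[symmetric])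
  ultimately show ?thesis
    by (simp add: square_integrable_def del: of_real_mult)
qed

lift_definition gaussian :: "'a::euclidean_space L2"
  is "\<lambda>x. complex_of_real (2 powr (- real DIM('a) / 4) * exp (- pi * (x \<bullet> x)))"
  using square_integrable_gaussian by (simp add: L2_rel_def)

definition feichtinger :: "'a::euclidean_space L2 set" where
  "feichtinger = {f. (\<integral>\<^sup>+x. \<integral>\<^sup>+\<omega>. ennreal (norm (stft gaussian f (x, \<omega>))) \<partial>lborel \<partial>lborel) < \<infinity>}"

section \<open>Lattices and \<open>C\<^sup>*(\<Lambda>, \<beta>)\<close>\<close>

text \<open>Cocompactness is compactness of the quotient group \<open>(\<real>\<^sup>d \<times> \<real>\<^sup>d) / \<Lambda>\<close> in the quotient
  topology, which is the unique topology \<open>Y\<close> making the coset projection a quotient map.\<close>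

definition tf_lattice :: "('a::euclidean_space \<times> 'a) set \<Rightarrow> bool" where
  "tf_lattice \<Lambda> \<longleftrightarrow>
     0 \<in> \<Lambda> \<and> (\<forall>X\<in>\<Lambda>. \<forall>Y\<in>\<Lambda>. X - Y \<in> \<Lambda>) \<and>
     discrete \<Lambda> \<and>
     (\<exists>Y. quotient_map euclidean Y (\<lambda>X. (+) X ` \<Lambda>) \<and> compact_space Y)"

text \<open>Elements of \<^typ>\<open>'a op\<close> are only real-linear by type; their norm is the operator norm.\<close>

definition cadj :: "'a::euclidean_space op \<Rightarrow> 'a op" where
  "cadj T = (THE S. \<forall>f g. cinner (blinfun_apply T f) g = cinner f (blinfun_apply S g))"

locale star_algebra =
  fixes B :: "'a::euclidean_space op set"
  assumes complex_linear: "T \<in> B \<Longrightarrow> blinfun_apply T (c *\<^sub>C f) = c *\<^sub>C blinfun_apply T f"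
    and one_mem: "id_blinfun \<in> B"
    and add_mem: "S \<in> B \<Longrightarrow> T \<in> B \<Longrightarrow> S + T \<in> B"
    and scale_mem: "T \<in> B \<Longrightarrow> scale_op c T \<in> B"
    and compose_mem: "S \<in> B \<Longrightarrow> T \<in> B \<Longrightarrow> S o\<^sub>L T \<in> B"
    and adj_ex: "T \<in> B \<Longrightarrow> \<exists>S. \<forall>f g. cinner (blinfun_apply T f) g = cinner f (blinfun_apply S g)"
    and cadj_mem: "T \<in> B \<Longrightarrow> cadj T \<in> B"

text \<open>The unit belongs to the generated algebra anyway, since \<open>\<pi>(0) = 1\<close>.\<close>

definition Cstar :: "('a::euclidean_space \<times> 'a) set \<Rightarrow> 'a op set" where
  "Cstar \<Lambda> = \<Inter> {B. star_algebra B \<and> closed B \<and> tf_shift ` \<Lambda> \<subseteq> B}"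

definition l1_op :: "('a::euclidean_space \<times> 'a) set \<Rightarrow> ('a \<times> 'a \<Rightarrow> complex) \<Rightarrow> 'a op" where
  "l1_op \<Lambda> a = (\<Sum>\<^sub>\<infinity>X\<in>\<Lambda>. scale_op (a X) (tf_shift X))"

definition l1 :: "('a::euclidean_space \<times> 'a) set \<Rightarrow> ('a \<times> 'a \<Rightarrow> complex) set" where
  "l1 \<Lambda> = {a. (\<lambda>X. norm (a X)) summable_on \<Lambda>}"

definition l1_algebra :: "('a::euclidean_space \<times> 'a) set \<Rightarrow> 'a op set" where
  "l1_algebra \<Lambda> = l1_op \<Lambda> ` l1 \<Lambda>"

definition spectrum_in :: "'a::euclidean_space op set \<Rightarrow> 'a op \<Rightarrow> complex set" where
  "spectrum_in A T = {z. \<not> (\<exists>S\<in>A. S o\<^sub>L (T - scale_op z id_blinfun) = id_blinfun \<and>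
                                (T - scale_op z id_blinfun) o\<^sub>L S = id_blinfun)}"

definition positive_in :: "'a::euclidean_space op set \<Rightarrow> 'a op \<Rightarrow> bool" where
  "positive_in A T \<longleftrightarrow> T \<in> A \<and> cadj T = T \<and> spectrum_in A T \<subseteq> \<real>\<^sub>\<ge>\<^sub>0"

section \<open>Left modules with operator-valued inner products\<close>

record 'm complex_space =
  vcarrier :: "'m set"
  vzero :: "'m"
  vadd :: "'m \<Rightarrow> 'm \<Rightarrow> 'm"
  vscale :: "complex \<Rightarrow> 'm \<Rightarrow> 'm"

locale complex_vector_space =
  fixes V :: "('m, 'z) complex_space_scheme"
  assumes zero_closed: "vzero V \<in> vcarrier V"
    and add_closed: "x \<in> vcarrier V \<Longrightarrow> y \<in> vcarrier V \<Longrightarrow> vadd V x y \<in> vcarrier V"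
    and scale_closed: "x \<in> vcarrier V \<Longrightarrow> vscale V c x \<in> vcarrier V"
    and add_assoc: "x \<in> vcarrier V \<Longrightarrow> y \<in> vcarrier V \<Longrightarrow> z \<in> vcarrier V \<Longrightarrow>
          vadd V (vadd V x y) z = vadd V x (vadd V y z)"
    and add_commute: "x \<in> vcarrier V \<Longrightarrow> y \<in> vcarrier V \<Longrightarrow> vadd V x y = vadd V y x"
    and add_zero: "x \<in> vcarrier V \<Longrightarrow> vadd V x (vzero V) = x"
    and add_neg: "x \<in> vcarrier V \<Longrightarrow> vadd V x (vscale V (-1) x) = vzero V"
    and scale_add: "x \<in> vcarrier V \<Longrightarrow> y \<in> vcarrier V \<Longrightarrow>
          vscale V c (vadd V x y) = vadd V (vscale V c x) (vscale V c y)"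
    and add_scale: "x \<in> vcarrier V \<Longrightarrow>
          vscale V (c + d) x = vadd V (vscale V c x) (vscale V d x)"
    and scale_scale: "x \<in> vcarrier V \<Longrightarrow> vscale V c (vscale V d x) = vscale V (c * d) x"
    and scale_one: "x \<in> vcarrier V \<Longrightarrow> vscale V 1 x = x"

locale left_module = star_algebra B + complex_vector_space V
  for B :: "'a::euclidean_space op set"
    and V :: "('m, 'z) complex_space_scheme" +
  fixes act :: "'a op \<Rightarrow> 'm \<Rightarrow> 'm"
  assumes act_closed: "T \<in> B \<Longrightarrow> x \<in> vcarrier V \<Longrightarrow> act T x \<in> vcarrier V"
    and act_add: "T \<in> B \<Longrightarrow> x \<in> vcarrier V \<Longrightarrow> y \<in> vcarrier V \<Longrightarrow>
          act T (vadd V x y) = vadd V (act T x) (act T y)"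
    and act_scale: "T \<in> B \<Longrightarrow> x \<in> vcarrier V \<Longrightarrow> act T (vscale V c x) = vscale V c (act T x)"
    and add_act: "S \<in> B \<Longrightarrow> T \<in> B \<Longrightarrow> x \<in> vcarrier V \<Longrightarrow>
          act (S + T) x = vadd V (act S x) (act T x)"
    and scale_act: "T \<in> B \<Longrightarrow> x \<in> vcarrier V \<Longrightarrow> act (scale_op c T) x = vscale V c (act T x)"
    and compose_act: "S \<in> B \<Longrightarrow> T \<in> B \<Longrightarrow> x \<in> vcarrier V \<Longrightarrow>
          act (S o\<^sub>L T) x = act S (act T x)"
    and one_act: "x \<in> vcarrier V \<Longrightarrow> act id_blinfun x = x"

text \<open>\<open>V\<close> is a left module over the subalgebra \<open>B\<close> of \<open>A\<close>; the inner product takes values in \<open>A\<close>.\<close>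

locale inner_product_module = left_module B V act
  for A B :: "'a::euclidean_space op set"
    and V :: "('m, 'z) complex_space_scheme"
    and act :: "'a op \<Rightarrow> 'm \<Rightarrow> 'm"
    and ip :: "'m \<Rightarrow> 'm \<Rightarrow> 'a op" +
  assumes subalgebra: "B \<subseteq> A"
    and ip_closed: "x \<in> vcarrier V \<Longrightarrow> y \<in> vcarrier V \<Longrightarrow> ip x y \<in> A"
    and ip_add_left: "x \<in> vcarrier V \<Longrightarrow> y \<in> vcarrier V \<Longrightarrow> z \<in> vcarrier V \<Longrightarrow>
          ip (vadd V x y) z = ip x z + ip y z"
    and ip_scale_left: "x \<in> vcarrier V \<Longrightarrow> y \<in> vcarrier V \<Longrightarrow>
          ip (vscale V c x) y = scale_op c (ip x y)"
    and ip_add_right: "x \<in> vcarrier V \<Longrightarrow> y \<in> vcarrier V \<Longrightarrow> z \<in> vcarrier V \<Longrightarrow>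
          ip x (vadd V y z) = ip x y + ip x z"
    and ip_scale_right: "x \<in> vcarrier V \<Longrightarrow> y \<in> vcarrier V \<Longrightarrow>
          ip x (vscale V c y) = scale_op (cnj c) (ip x y)"
    and ip_adj: "x \<in> vcarrier V \<Longrightarrow> y \<in> vcarrier V \<Longrightarrow> ip x y = cadj (ip y x)"
    and ip_act: "T \<in> B \<Longrightarrow> x \<in> vcarrier V \<Longrightarrow> y \<in> vcarrier V \<Longrightarrow>
          ip (act T x) y = T o\<^sub>L ip x y"
    and ip_pos: "x \<in> vcarrier V \<Longrightarrow> x \<noteq> vzero V \<Longrightarrow> positive_in A (ip x x) \<and> ip x x \<noteq> 0"

definition ip_norm :: "('m \<Rightarrow> 'm \<Rightarrow> 'a::euclidean_space op) \<Rightarrow> 'm \<Rightarrow> real" where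
  "ip_norm ip x = sqrt (norm (ip x x))"

definition ip_dist ::
  "('m, 'z) complex_space_scheme \<Rightarrow> ('m \<Rightarrow> 'm \<Rightarrow> 'a::euclidean_space op) \<Rightarrow> 'm \<Rightarrow> 'm \<Rightarrow> real" where
  "ip_dist V ip x y = ip_norm ip (vadd V x (vscale V (-1) y))"

definition ip_Cauchy ::
  "('m, 'z) complex_space_scheme \<Rightarrow> ('m \<Rightarrow> 'm \<Rightarrow> 'a::euclidean_space op) \<Rightarrow> (nat \<Rightarrow> 'm) \<Rightarrow> bool" where
  "ip_Cauchy V ip u \<longleftrightarrow> range u \<subseteq> vcarrier V \<and>
     (\<forall>e>0. \<exists>N. \<forall>m\<ge>N. \<forall>n\<ge>N. ip_dist V ip (u m) (u n) < e)"

locale left_hilbert_module = inner_product_module A A V act ip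
  for A :: "'a::euclidean_space op set"
    and V :: "('m, 'z) complex_space_scheme"
    and act :: "'a op \<Rightarrow> 'm \<Rightarrow> 'm"
    and ip :: "'m \<Rightarrow> 'm \<Rightarrow> 'a op" +
  assumes complete: "ip_Cauchy V ip u \<Longrightarrow>
    \<exists>x\<in>vcarrier V. (\<lambda>n. ip_dist V ip (u n) x) \<longlonglongrightarrow> 0"

section \<open>Completion of an inner product module\<close>

text \<open>Elements of the completion are Cauchy sequences modulo null sequences. The operations are
  given on representatives in the usual quotient style, as unions of classes over all choices.
  The action of \<open>T\<close> extends that of \<open>B\<close> by continuity in both arguments: \<open>T\<close> is approximated in
  norm from \<open>B\<close>. The union is empty if \<open>T\<close> is not in the closure of \<open>B\<close>.\<close>

context
  fixes B :: "'a::euclidean_space op set"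
    and V :: "('m, 'z) complex_space_scheme"
    and act :: "'a op \<Rightarrow> 'm \<Rightarrow> 'm"
    and ip :: "'m \<Rightarrow> 'm \<Rightarrow> 'a op"
begin

definition null_rel :: "((nat \<Rightarrow> 'm) \<times> (nat \<Rightarrow> 'm)) set" where
  "null_rel = {(u, v). ip_Cauchy V ip u \<and> ip_Cauchy V ip v \<and>
                       (\<lambda>n. ip_dist V ip (u n) (v n)) \<longlonglongrightarrow> 0}"

definition ip_completion :: "(nat \<Rightarrow> 'm) set complex_space" where
  "ip_completion = \<lparr>
     vcarrier = Collect (ip_Cauchy V ip) // null_rel,
     vzero = null_rel `` {\<lambda>_. vzero V},
     vadd = (\<lambda>F G. \<Union>u\<in>F. \<Union>v\<in>G. null_rel `` {\<lambda>n. vadd V (u n) (v n)}),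
     vscale = (\<lambda>c F. \<Union>u\<in>F. null_rel `` {\<lambda>n. vscale V c (u n)}) \<rparr>"

definition completion_embed :: "'m \<Rightarrow> (nat \<Rightarrow> 'm) set" where
  "completion_embed x = null_rel `` {\<lambda>_. x}"

definition completion_act :: "'a op \<Rightarrow> (nat \<Rightarrow> 'm) set \<Rightarrow> (nat \<Rightarrow> 'm) set" where
  "completion_act T F =
     (\<Union>S\<in>{S. range S \<subseteq> B \<and> S \<longlonglongrightarrow> T}. \<Union>u\<in>F. null_rel `` {\<lambda>n. act (S n) (u n)})"

definition completion_ip :: "(nat \<Rightarrow> 'm) set \<Rightarrow> (nat \<Rightarrow> 'm) set \<Rightarrow> 'a op" where
  "completion_ip F G = (THE L. \<forall>u\<in>F. \<forall>v\<in>G. (\<lambda>n. ip (u n) (v n)) \<longlonglongrightarrow> L)"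

end

section \<open>Feichtinger's algebra as a module\<close>

definition S0_space :: "'a::euclidean_space L2 complex_space" where
  "S0_space = \<lparr> vcarrier = feichtinger, vzero = 0, vadd = (+), vscale = scaleC \<rparr>"

definition S0_inner ::
  "('a::euclidean_space \<times> 'a) set \<Rightarrow> 'a L2 \<Rightarrow> 'a L2 \<Rightarrow> 'a op" where
  "S0_inner \<Lambda> f g = (\<Sum>\<^sub>\<infinity>X\<in>\<Lambda>. scale_op (stft g f X) (tf_shift X))"

end

theory Submission
  imports Defs "HOL-Probability.Characteristic_Functions"
begin

text \<open>
  The theorem rests on three facts about \<open>\<pi>(\<lambda>)\<close>, \<open>\<lambda> \<in> \<Lambda>\<close>, and \<open>V\<^sub>g f(X) = \<langle>f, \<pi>(X) g\<rangle>\<close>; everything else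
  is the algebra of twisted convolutions and the general theory of completions.

  \<^emph>\<open>Summability.\<close> For the Gaussian window \<open>\<phi>\<close> Moyal's identity
  \<open>\<integral> V\<^sub>\<phi> f cnj(V\<^sub>\<phi> g) = \<parallel>\<phi>\<parallel>\<^sup>2 \<langle>f, g\<rangle>\<close> holds whenever \<open>V\<^sub>\<phi> f\<close> is integrable (\<open>moyal\<close>). It is Parseval's
  identity in the frequency variable, and so comes down to the Fourier inversion theorem for
  integrable functions (\<open>fourier_inversion\<close>). Moyal's identity bounds \<open>\<bar>V\<^sub>\<phi> f\<bar>\<close> by its convolution
  with a Gaussian, whose samples on \<open>\<Lambda>\<close> have a sum that is bounded uniformly in translations of \<open>\<Lambda>\<close>;
  hence the same holds for the samples of \<open>V\<^sub>\<phi> f\<close>. Expanding a second window \<open>g\<close> in shifts of \<open>\<phi>\<close> carries the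
  bound over to \<open>V\<^sub>g f\<close> (\<open>stft_summable\<close>).

  \<^emph>\<open>Positivity.\<close> The function \<open>b(\<lambda>) = V\<^sub>f f(\<lambda>) \<langle>\<pi>(\<lambda>) h, h\<rangle>\<close> satisfies
  \<open>b(\<nu> - \<mu>) = \<langle>\<pi>(\<mu>) f, \<pi>(\<nu>) f\<rangle> \<langle>\<pi>(\<nu>) h, \<pi>(\<mu>) h\<rangle>\<close>, because the cocycle phases of the two
  factors are conjugate. These are the entries of a product of two Gram matrices, so their sum over
  \<open>\<mu>\<close> and \<open>\<nu>\<close> in a finite set is nonnegative by Schur's theorem. Averaging over large balls, which are
  Folner sets because \<open>\<Lambda>\<close> has polynomial growth, gives \<open>\<langle>\<langle>f, f\<rangle> h, h\<rangle> = \<Sum> b \<ge> 0\<close>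
  (\<open>S0_inner_nonneg\<close>). A self-adjoint operator with nonnegative numerical range has its spectrum in
  \<open>[0, \<infinity>)\<close>, and the inverses that this requires already lie in the closed algebra
  (\<open>positive_in_if_numerically_positive\<close>).

  \<^emph>\<open>Definiteness.\<close> If \<open>\<Sum> a(\<lambda>) \<pi>(\<lambda>) = 0\<close> with \<open>a \<in> \<ell>\<^sup>1(\<Lambda>)\<close>, then \<open>a(0) = 0\<close>: conjugating by a shift that
  anticommutes with \<open>\<pi>(\<lambda>)\<close> and averaging removes the coefficient at \<open>\<lambda>\<close> and enlarges no other one, so
  that \<open>a(0)\<close> is bounded by every tail of \<open>\<Sum> \<bar>a\<bar>\<close> (\<open>l1_op_zero_coefficient\<close>). For \<open>\<langle>f, f\<rangle>\<close> the
  coefficient at \<open>0\<close> is \<open>\<parallel>f\<parallel>\<^sup>2\<close>.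

  The completion is treated for an arbitrary module over a dense subalgebra whose inner product takes
  values in that subalgebra and is positive in the numerical sense (locale \<open>pre_hilbert_module\<close>). The
  operator-valued Cauchy--Schwarz inequality (\<open>cauchy_schwarz\<close>) makes addition, action and inner product
  continuous, and they pass to classes of Cauchy sequences.
\<close>

section \<open>The inner product space \<open>L\<^sup>2\<close>\<close>

lemma scaleC_add_right: "c *\<^sub>C (f + g) = c *\<^sub>C f + c *\<^sub>C g"
  using bounded_linear_scaleC[of c] by (rule linear_simps)

lemma scaleC_add_left: "(c + d) *\<^sub>C f = c *\<^sub>C f + d *\<^sub>C f"
  by transfer (rule L2_relI; (intro square_integrable_intros)?; simp add: L2_rel_def algebra_simps)

lemma scaleC_scaleC: "c *\<^sub>C (d *\<^sub>C f) = (c * d) *\<^sub>C f"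
  by transfer (rule L2_relI; (intro square_integrable_intros)?; simp add: L2_rel_def algebra_simps)

lemma scaleC_one [simp]: "1 *\<^sub>C f = f"
  by transfer (auto simp: L2_rel_def)

lemma scaleC_of_real: "of_real r *\<^sub>C f = r *\<^sub>R f"
  by (simp add: scaleR_L2_def)

lemma scaleC_minus1: "(-1) *\<^sub>C f = - f"
  by (simp add: uminus_L2_def)

lemma scaleC_zero_left [simp]: "0 *\<^sub>C f = 0"
  using scaleC_of_real[of 0 f] by simp

lemma scaleC_zero_right [simp]: "c *\<^sub>C 0 = 0"
  using bounded_linear_scaleC[of c] by (rule linear_simps)

lemma cinner_commute: "cinner g f = cnj (cinner f g)"
proof transfer
  fix f g :: "'a \<Rightarrow> complex"
  show "(\<integral>x. g x * cnj (f x) \<partial>lborel) = cnj (\<integral>x. f x * cnj (g x) \<partial>lborel)"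
    by (subst Bochner_Integration.integral_cnj[symmetric]) (simp add: mult.commute)
qed

lemma cinner_add_left: "cinner (f + g) h = cinner f h + cinner g h"
  by transfer (simp add: L2_rel_def integrable_inner_L2 distrib_right)

lemma cinner_scaleC_left: "cinner (c *\<^sub>C f) g = c * cinner f g"
  by transfer (simp add: mult.assoc)

lemma cinner_add_right: "cinner f (g + h) = cinner f g + cinner f h"
  by (subst (1 2 3) cinner_commute) (simp add: cinner_add_left)

lemma cinner_scaleC_right: "cinner f (c *\<^sub>C g) = cnj c * cinner f g"
  by (subst (1 2) cinner_commute) (simp add: cinner_scaleC_left)

lemma Re_cinner: "Re (cinner f g) = inner f g"
  by (simp add: inner_L2_def)

lemma cinner_self: "cinner f f = of_real ((norm f)\<^sup>2)"
proof -
  have "Im (cinner f f) = 0"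
    using cinner_commute[of f f] by (simp add: complex_eq_iff)
  then show ?thesis
    by (simp add: complex_eq_iff Re_cinner power2_norm_eq_inner)
qed

lemma cinner_scaleR_left: "cinner (r *\<^sub>R f) g = of_real r * cinner f g"
  by (simp add: scaleC_of_real[symmetric] cinner_scaleC_left)

text \<open>Rotating \<open>f\<close> by the phase of \<open>\<langle>f, g\<rangle>\<close> makes the complex inner product real, which reduces the
  estimate to the Cauchy--Schwarz inequality of the underlying real inner product space.\<close>

lemma norm_cinner_le: "norm (cinner f g) \<le> norm f * norm g"
proof (cases "cinner f g = 0")
  case False
  define c where "c = cnj (cinner f g) / of_real (norm (cinner f g))"
  have n: "norm c = 1" using False by (simp add: c_def norm_divide)
  have "c * cinner f g = of_real (norm (cinner f g))"
    using False by (simp add: c_def complex_norm_square[symmetric] mult.commute power2_eq_square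
        flip: of_real_power)
  then have "norm (cinner f g) = inner (c *\<^sub>C f) g"
    by (simp add: Re_cinner[symmetric] cinner_scaleC_left)
  also have "\<dots> \<le> norm (c *\<^sub>C f) * norm g" by (rule norm_cauchy_schwarz)
  also have "norm (c *\<^sub>C f) = norm f"
  proof -
    have "cinner (c *\<^sub>C f) (c *\<^sub>C f) = (c * cnj c) * cinner f f"
      by (simp add: cinner_scaleC_left cinner_scaleC_right mult.assoc)
    also have "c * cnj c = 1" using n by (simp add: complex_norm_square[symmetric])
    finally show ?thesis by (intro norm_eq_of_cinner) simp
  qed
  finally show ?thesis .
qed simp

lemma norm_scaleC: "norm (c *\<^sub>C f) = norm c * norm f"
proof -
  have "cinner (c *\<^sub>C f) (c *\<^sub>C f) = (c * cnj c) * cinner f f"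
    by (simp add: cinner_scaleC_left cinner_scaleC_right mult.assoc)
  also have "\<dots> = of_real ((norm c * norm f)\<^sup>2)"
    by (simp only: complex_norm_square[symmetric] cinner_self power_mult_distrib of_real_mult)
  finally have "cinner (c *\<^sub>C f) (c *\<^sub>C f) = of_real ((norm c * norm f)\<^sup>2)" .
  then have "(norm (c *\<^sub>C f))\<^sup>2 = (norm c * norm f)\<^sup>2"
    unfolding cinner_self of_real_eq_iff .
  then show ?thesis by (simp only: power2_eq_iff_nonneg norm_ge_zero mult_nonneg_nonneg)
qed

lemma bounded_linear_cinner_left: "bounded_linear (\<lambda>f. cinner f g)"
  by (rule bounded_linear_intro[where K="norm g"])
    (auto simp: cinner_add_left cinner_scaleR_left norm_cinner_le scaleR_conv_of_real)

lemma bounded_linear_cinner_right: "bounded_linear (\<lambda>g. cinner f g)"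
  by (rule bounded_linear_intro[where K="norm f"])
    (auto simp: cinner_add_right cinner_scaleC_right norm_cinner_le scaleC_of_real[symmetric]
      scaleR_conv_of_real mult.commute intro: order_trans[OF norm_cinner_le])

lemmas cinner_diff_left = linear_simps(2)[OF bounded_linear_cinner_left]
lemmas cinner_diff_right = linear_simps(2)[OF bounded_linear_cinner_right]

lemma cinner_extI:
  assumes "\<And>g. cinner f g = cinner f' g"
  shows "f = f'"
proof -
  have "cinner (f - f') (f - f') = 0"
    using assms[of "f - f'"] by (simp add: cinner_diff_left)
  then show ?thesis by (simp add: cinner_self)
qed

lemma abs_L2_cases:
  obtains F where "f = abs_L2 F" "square_integrable F"
  using Quotient3_abs_rep[OF Quotient3_L2, of f] Quotient3_rep_reflp[OF Quotient3_L2, of f]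
  by (metis L2_rel_reflD)

lemma cinner_abs_L2:
  assumes "square_integrable F" "square_integrable G"
  shows "cinner (abs_L2 F) (abs_L2 G) = (\<integral>x. F x * cnj (G x) \<partial>lborel)"
  using assms by (simp add: cinner.abs_eq L2_rel_def)

lemma norm_abs_L2:
  assumes "square_integrable F"
  shows "(norm (abs_L2 F))\<^sup>2 = (\<integral>x. (norm (F x))\<^sup>2 \<partial>lborel)"
proof -
  have "complex_of_real ((norm (abs_L2 F))\<^sup>2) = (\<integral>x. F x * cnj (F x) \<partial>lborel)"
    using assms by (simp only: cinner_self[symmetric] cinner_abs_L2)
  also have "\<dots> = (\<integral>x. of_real ((norm (F x))\<^sup>2) \<partial>lborel)"
    by (simp only: complex_norm_square)
  also have "\<dots> = of_real (\<integral>x. (norm (F x))\<^sup>2 \<partial>lborel)"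
    by (rule integral_complex_of_real)
  finally show ?thesis by (simp only: of_real_eq_iff)
qed

lemma nn_integral_norm_abs_L2:
  assumes "square_integrable F"
  shows "(\<integral>\<^sup>+x. ennreal ((norm (F x))\<^sup>2) \<partial>lborel) = ennreal ((norm (abs_L2 F))\<^sup>2)"
  unfolding norm_abs_L2[OF assms] using assms
  by (intro nn_integral_eq_integral) (auto simp: square_integrable_def)

lemma abs_L2_diff:
  assumes "square_integrable F" "square_integrable G"
  shows "abs_L2 F - abs_L2 G = abs_L2 (\<lambda>x. F x - G x)" "square_integrable (\<lambda>x. F x - G x)"
proof -
  have m: "square_integrable (\<lambda>x. (-1) * G x)" using assms(2) by (rule square_integrable_cmult)
  show "abs_L2 F - abs_L2 G = abs_L2 (\<lambda>x. F x - G x)"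
    unfolding minus_L2_def uminus_L2_def
    using assms m by (simp add: scaleC.abs_eq plus_L2.abs_eq L2_rel_def)
  show "square_integrable (\<lambda>x. F x - G x)"
    using square_integrable_add[OF assms(1) m] by simp
qed

text \<open>Riesz--Fischer. Along a subsequence whose consecutive distances shrink geometrically, the
  weighted sum \<open>\<Sum>\<^sub>n 4\<^sup>n \<bar>F\<^sub>n\<^sub>+\<^sub>1 - F\<^sub>n\<bar>\<^sup>2\<close> is integrable, so almost everywhere the increments are
  \<open>O(2\<^sup>-\<^sup>n)\<close> and the representatives converge pointwise; Fatou's lemma turns this into
  convergence in norm.\<close>

instance L2 :: (euclidean_space) banach
proof
  fix X :: "nat \<Rightarrow> 'a L2"
  assume X: "Cauchy X"
  \<comment> \<open>The rate \<open>4\<^sup>-\<^sup>k\<close> leaves room for the weight \<open>4\<^sup>k\<close>: the squared distances \<open>16\<^sup>-\<^sup>k\<close> times \<open>4\<^sup>k\<close> still sum.\<close>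
  have "\<exists>N. \<forall>m\<ge>N. \<forall>n\<ge>N. dist (X m) (X n) < (1/4)^k" for k
    using X unfolding Cauchy_def by (auto simp: dest: spec[of _ "(1/4)^k"])
  then obtain N where N: "\<And>k m n. m \<ge> N k \<Longrightarrow> n \<ge> N k \<Longrightarrow> dist (X m) (X n) < (1/4)^k"
    by metis
  define r where "r k = Max (N ` {..k}) + k" for k
  have rN: "N j \<le> r k" if "j \<le> k" for j k
    unfolding r_def using that by (intro trans_le_add1 Max_ge) auto
  have "\<exists>F. X (r k) = abs_L2 F \<and> square_integrable F" for k
    by (meson abs_L2_cases)
  then obtain F where F: "\<And>k. X (r k) = abs_L2 (F k)" "\<And>k. square_integrable (F k)" by metis
  have [measurable]: "F k \<in> borel_measurable borel" for k
    using F(2)[of k] by (simp add: square_integrable_def)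
  have close: "norm (X (r m) - X (r n)) < (1/4)^k" if "m \<ge> k" "n \<ge> k" for k m n
    using N[of k "r m" "r n"] rN that by (simp add: dist_norm)
  have nnF: "(\<integral>\<^sup>+x. ennreal ((norm (F m x - F n x))\<^sup>2) \<partial>lborel) = ennreal ((norm (X (r m) - X (r n)))\<^sup>2)" for m n
    using abs_L2_diff[OF F(2)[of m] F(2)[of n]] by (simp add: F(1) nn_integral_norm_abs_L2)
  have "(\<integral>\<^sup>+x. (\<Sum>n. ennreal (4^n * (norm (F (Suc n) x - F n x))\<^sup>2)) \<partial>lborel)
      = (\<Sum>n. \<integral>\<^sup>+x. ennreal (4^n * (norm (F (Suc n) x - F n x))\<^sup>2) \<partial>lborel)"
    by (rule nn_integral_suminf) measurable
  also have "\<dots> \<le> (\<Sum>n. ennreal ((1/4)^n))"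
  proof (intro suminf_le allI)
    fix n
    have "(\<integral>\<^sup>+x. ennreal (4^n * (norm (F (Suc n) x - F n x))\<^sup>2) \<partial>lborel)
      = ennreal (4^n) * (\<integral>\<^sup>+x. ennreal ((norm (F (Suc n) x - F n x))\<^sup>2) \<partial>lborel)"
      by (subst nn_integral_cmult[symmetric]) (auto simp: ennreal_mult)
    also have "\<dots> = ennreal (4^n * (norm (X (r (Suc n)) - X (r n)))\<^sup>2)"
      by (simp add: nnF ennreal_mult)
    also have "\<dots> \<le> ennreal ((1/4)^n)"
    proof (rule ennreal_leI)
      have "(norm (X (r (Suc n)) - X (r n)))\<^sup>2 \<le> ((1/4)^n)\<^sup>2"
        using close[of n "Suc n" n] by (intro power_mono) auto
      then have "4^n * (norm (X (r (Suc n)) - X (r n)))\<^sup>2 \<le> 4^n * ((1/4)^n)\<^sup>2"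
        by (intro mult_left_mono) auto
      also have "\<dots> = (1/4)^n"
        by (simp add: power2_eq_square power_divide)
      finally show "4^n * (norm (X (r (Suc n)) - X (r n)))\<^sup>2 \<le> (1/4)^n" .
    qed
    finally show "(\<integral>\<^sup>+x. ennreal (4^n * (norm (F (Suc n) x - F n x))\<^sup>2) \<partial>lborel) \<le> ennreal ((1/4)^n)" .
  qed auto
  also have "\<dots> = ennreal (\<Sum>n. (1/4)^n)"
    by (intro suminf_ennreal_eq summable_sums summable_geometric) auto
  also have "\<dots> < \<infinity>" by simp
  finally have "AE x in lborel. (\<Sum>n. ennreal (4^n * (norm (F (Suc n) x - F n x))\<^sup>2)) \<noteq> \<infinity>"
    by (intro nn_integral_PInf_AE) auto
  then have conv: "AE x in lborel. convergent (\<lambda>n. F n x)"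
  proof eventually_elim
    fix x assume fin: "(\<Sum>n. ennreal (4^n * (norm (F (Suc n) x - F n x))\<^sup>2)) \<noteq> \<infinity>"
    define K where "K = enn2real (\<Sum>n. ennreal (4^n * (norm (F (Suc n) x - F n x))\<^sup>2))"
    have K: "4^n * (norm (F (Suc n) x - F n x))\<^sup>2 \<le> K" for n
    proof -
      have "ennreal (4^n * (norm (F (Suc n) x - F n x))\<^sup>2)
          \<le> (\<Sum>n. ennreal (4^n * (norm (F (Suc n) x - F n x))\<^sup>2))"
        by (rule order_trans[OF _ sum_le_suminf[where I="{n}"]]) (simp_all only: sum.insert sum.empty
            finite.intros empty_iff not_False_eq_True add_0_right order_refl summableI zero_le)
      then have "enn2real (ennreal (4^n * (norm (F (Suc n) x - F n x))\<^sup>2)) \<le> K"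
        unfolding K_def using fin by (intro enn2real_mono) (auto simp: top.not_eq_extremum)
      then show ?thesis by simp
    qed
    have b: "norm (F (Suc n) x - F n x) \<le> sqrt K * (1/2)^n" for n
    proof -
      have "(2^n * norm (F (Suc n) x - F n x))\<^sup>2 \<le> K"
        using K[of n] power_mult[of "2::real" 2 n] power_mult[of "2::real" n 2]
        by (simp add: power_mult_distrib mult.commute)
      then have "2^n * norm (F (Suc n) x - F n x) \<le> sqrt K"
        by (rule real_le_rsqrt)
      then show ?thesis by (simp add: field_simps)
    qed
    have "summable (\<lambda>n. F (Suc n) x - F n x)"
      by (rule summable_comparison_test'[of "\<lambda>n. sqrt K * (1/2)^n" 0, OF _ b])
         (intro summable_mult summable_geometric, simp)
    then have "convergent (\<lambda>n. \<Sum>i<n. F (Suc i) x - F i x)"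
      by (simp add: summable_iff_convergent)
    then have "convergent (\<lambda>n. F n x - F 0 x)" by (simp only: sum_lessThan_telescope[of "\<lambda>n. F n x"])
    then have "convergent (\<lambda>n. (F n x - F 0 x) + F 0 x)" by (intro convergent_add convergent_const)
    then show "convergent (\<lambda>n. F n x)" by simp
  qed
  define L where "L x = lim (\<lambda>n. F n x)" for x
  have [measurable]: "L \<in> borel_measurable borel" unfolding L_def
    by (rule borel_measurable_lim_metric) measurable
  have lim: "AE x in lborel. (\<lambda>n. F n x) \<longlonglongrightarrow> L x"
    using conv by eventually_elim (simp add: L_def convergent_LIMSEQ_iff)
  have fatou: "(\<integral>\<^sup>+x. ennreal ((norm (L x - F k x))\<^sup>2) \<partial>lborel) \<le> ennreal (((1/4)^k)\<^sup>2)" for k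
  proof -
    have "(\<integral>\<^sup>+x. ennreal ((norm (L x - F k x))\<^sup>2) \<partial>lborel)
        = (\<integral>\<^sup>+x. liminf (\<lambda>m. ennreal ((norm (F m x - F k x))\<^sup>2)) \<partial>lborel)"
    proof (rule nn_integral_cong_AE, use lim in eventually_elim)
      fix x assume "(\<lambda>m. F m x) \<longlonglongrightarrow> L x"
      then have "(\<lambda>m. ennreal ((norm (F m x - F k x))\<^sup>2)) \<longlonglongrightarrow> ennreal ((norm (L x - F k x))\<^sup>2)"
        by (intro tendsto_intros)
      then show "ennreal ((norm (L x - F k x))\<^sup>2) = liminf (\<lambda>m. ennreal ((norm (F m x - F k x))\<^sup>2))"
        by (intro lim_imp_Liminf[symmetric]) auto
    qed
    also have "\<dots> \<le> liminf (\<lambda>m. \<integral>\<^sup>+x. ennreal ((norm (F m x - F k x))\<^sup>2) \<partial>lborel)"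
      by (rule nn_integral_liminf) measurable
    also have "\<dots> \<le> liminf (\<lambda>m. ennreal (((1/4)^k)\<^sup>2))"
    proof (rule Liminf_mono, rule eventually_sequentiallyI[of k])
      fix m assume "k \<le> m"
      then have "(norm (X (r m) - X (r k)))\<^sup>2 \<le> ((1/4)^k)\<^sup>2"
        using close[of k m k] by (intro power_mono) auto
      then show "(\<integral>\<^sup>+x. ennreal ((norm (F m x - F k x))\<^sup>2) \<partial>lborel) \<le> ennreal (((1/4)^k)\<^sup>2)"
        by (simp only: nnF ennreal_leI)
    qed
    also have "\<dots> = ennreal (((1/4)^k)\<^sup>2)" by (simp add: Liminf_const)
    finally show ?thesis .
  qed
  have LF: "square_integrable (\<lambda>x. L x - F k x)" for k
    using fatou[of k] by (auto simp: square_integrable_def integrable_iff_bounded intro: le_less_trans)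
  have sqL: "square_integrable L"
    using square_integrable_add[OF LF[of 0] F(2)[of 0]] by simp
  have bound: "norm (abs_L2 L - X (r k)) \<le> (1/4)^k" for k
  proof -
    have "ennreal ((norm (abs_L2 L - X (r k)))\<^sup>2) \<le> ennreal (((1/4)^k)\<^sup>2)"
      using fatou[of k] by (simp add: F(1) abs_L2_diff[OF sqL F(2)] nn_integral_norm_abs_L2[OF LF])
    then have "(norm (abs_L2 L - X (r k)))\<^sup>2 \<le> ((1/4)^k)\<^sup>2"
      by (subst (asm) ennreal_le_iff) auto
    then show ?thesis by (rule power2_le_imp_le) simp
  qed
  have "X \<longlonglongrightarrow> abs_L2 L"
  proof (rule metric_LIMSEQ_I)
    fix e :: real assume "e > 0"
    then obtain k where k: "(1/4)^k < e / 2"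
      using real_arch_pow_inv[of "e/2" "1/4"] by auto
    show "\<exists>no. \<forall>n\<ge>no. dist (X n) (abs_L2 L) < e"
    proof (intro exI allI impI)
      fix n assume n: "r k \<le> n"
      have "dist (X n) (abs_L2 L) \<le> dist (X n) (X (r k)) + dist (X (r k)) (abs_L2 L)"
        by (rule dist_triangle)
      also have "\<dots> < (1/4)^k + (1/4)^k"
        using N[of k n "r k"] rN[of k k] n bound[of k]
        by (intro add_less_le_mono) (auto simp: dist_norm norm_minus_commute)
      finally show "dist (X n) (abs_L2 L) < e" using k by simp
    qed
  qed
  then show "convergent X" by (auto simp: convergent_def)
qed

section \<open>Bounded operators and time-frequency shifts\<close>

lemma blinfun_scale_op [simp]: "blinfun_apply (scale_op c T) f = c *\<^sub>C blinfun_apply T f"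
  by (rule scale_op_apply)

lemma scale_op_add_right: "scale_op c (S + T) = scale_op c S + scale_op c T"
  by (rule blinfun_eqI) (simp add: blinfun.add_left scaleC_add_right)

lemma scale_op_add_left: "scale_op (c + d) T = scale_op c T + scale_op d T"
  by (rule blinfun_eqI) (simp add: blinfun.add_left scaleC_add_left)

lemma scale_op_scale_op: "scale_op c (scale_op d T) = scale_op (c * d) T"
  by (rule blinfun_eqI) (simp add: scaleC_scaleC)

lemma scale_op_one [simp]: "scale_op 1 T = T"
  by (rule blinfun_eqI) simp

lemma scale_op_of_real: "scale_op (of_real r) T = r *\<^sub>R T"
  by (rule blinfun_eqI) (simp add: scaleC_of_real blinfun.scaleR_left)

lemma scale_op_zero_left [simp]: "scale_op 0 T = 0"
  by (rule blinfun_eqI) simp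

lemma scale_op_zero_right [simp]: "scale_op c 0 = 0"
  by (rule blinfun_eqI) simp

lemma scale_op_minus1: "scale_op (-1) T = - T"
  by (rule blinfun_eqI) (simp add: scaleC_minus1 blinfun.minus_left)

lemma norm_scale_op: "norm (scale_op c T) = norm c * norm T"
proof (rule antisym)
  show *: "norm (scale_op c T) \<le> norm c * norm T" for c and T :: "'a op"
    by (rule norm_blinfun_bound)
      (auto simp: norm_scaleC mult.assoc intro: mult_left_mono norm_blinfun)
  show "norm c * norm T \<le> norm (scale_op c T)"
  proof (cases "c = 0")
    case False
    have "norm T = norm (scale_op (inverse c) (scale_op c T))"
      using False by (simp add: scale_op_scale_op)
    also have "\<dots> \<le> norm (inverse c) * norm (scale_op c T)" by (rule *)
    finally show ?thesis using False by (simp add: norm_divide field_simps)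
  qed simp
qed

lemma bounded_linear_scale_op_left: "bounded_linear (\<lambda>c. scale_op c T)"
  by (rule bounded_linear_intro[where K="norm T"])
    (auto simp: scale_op_add_left norm_scale_op scaleR_conv_of_real scale_op_of_real[symmetric]
      scale_op_scale_op)

lemma bounded_linear_scale_op_right: "bounded_linear (\<lambda>T. scale_op c T)"
  by (rule bounded_linear_intro[where K="norm c"])
    (auto simp: scale_op_add_right norm_scale_op scale_op_of_real[symmetric]
      scale_op_scale_op mult.commute)

lemma scale_op_compose_left: "scale_op c S o\<^sub>L T = scale_op c (S o\<^sub>L T)"
  by (rule blinfun_eqI) simp

definition character :: "real \<Rightarrow> complex" where
  "character r = exp (2 * of_real pi * \<i> * of_real r)"

lemma character_add: "character (r + s) = character r * character s"
  by (simp add: character_def distrib_left exp_add)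

lemma character_0 [simp]: "character 0 = 1"
  by (simp add: character_def)

lemma norm_character [simp]: "norm (character r) = 1"
  by (simp add: character_def norm_exp_eq_Re)

lemma cnj_character: "cnj (character r) = character (- r)"
  by (simp add: character_def exp_cnj)

lemma character_mult_minus [simp]: "character r * character (- r) = 1" "character (- r) * character r = 1"
  by (simp_all add: character_add[symmetric])

lemma character_half [simp]: "character (1/2) = -1"
  using exp_pi_i by (simp add: character_def mult.commute)

lemma scaleC_abs_L2:
  assumes "square_integrable F"
  shows "c *\<^sub>C abs_L2 F = abs_L2 (\<lambda>t. c * F t)"
  using assms by (simp add: scaleC.abs_eq L2_rel_def)

lemma modulation_abs_L2:
  assumes "square_integrable F"
  shows "modulation \<omega> (abs_L2 F) = abs_L2 (\<lambda>t. character (\<omega> \<bullet> t) * F t)"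
  using assms unfolding character_def by (simp add: modulation.abs_eq L2_rel_def)

lemma tf_shift_abs_L2:
  assumes "square_integrable F"
  shows "blinfun_apply (tf_shift (x, \<omega>)) (abs_L2 F) = abs_L2 (\<lambda>t. character (\<omega> \<bullet> t) * F (t - x))"
proof -
  have "translation x (abs_L2 F) = abs_L2 (\<lambda>t. F (t - x))"
    using assms by (simp add: translation.abs_eq L2_rel_def)
  then show ?thesis
    by (simp add: tf_shift_apply modulation_abs_L2 square_integrable_translate[OF assms])
qed

lemma square_integrable_tf_shift:
  assumes "square_integrable F"
  shows "square_integrable (\<lambda>t. character (\<omega> \<bullet> t) * F (t - x))"
  unfolding character_def by (intro square_integrable_modulate square_integrable_translate assms)

lemma tf_shift_scaleC: "blinfun_apply (tf_shift X) (c *\<^sub>C f) = c *\<^sub>C blinfun_apply (tf_shift X) f"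
proof (cases X, rule abs_L2_cases[of f])
  fix x \<omega> F assume X: "X = (x, \<omega>)" and F: "f = abs_L2 F" "square_integrable F"
  show ?thesis
    using F by (simp add: X tf_shift_abs_L2 square_integrable_tf_shift square_integrable_cmult
       scaleC_abs_L2) (simp add: mult.left_commute)
qed

text \<open>This is \<open>\<beta>\<close> in \<open>\<pi>(X) \<pi>(Y) = \<beta>(X, Y) \<pi>(X + Y)\<close>: moving the translation of \<open>X\<close> past the modulation of
  \<open>Y\<close> costs \<open>e\<^sup>-\<^sup>2\<^sup>\<pi>\<^sup>i\<^sup>\<eta>\<^sup>x\<close>, where \<open>x\<close> is the time of \<open>X\<close> and \<open>\<eta>\<close> the frequency of \<open>Y\<close>.\<close>

definition cocycle :: "'a::euclidean_space \<times> 'a \<Rightarrow> 'a \<times> 'a \<Rightarrow> complex" where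
  "cocycle X Y = character (- (snd Y \<bullet> fst X))"

lemma norm_cocycle [simp]: "norm (cocycle X Y) = 1"
  by (simp add: cocycle_def)

lemma cocycle_cnj [simp]: "cocycle X Y * cnj (cocycle X Y) = 1" "cnj (cocycle X Y) * cocycle X Y = 1"
  by (simp_all add: cocycle_def cnj_character)

lemma tf_shift_compose:
  "tf_shift X o\<^sub>L tf_shift Y = scale_op (cocycle X Y) (tf_shift (X + Y))"
proof (rule blinfun_eqI)
  fix f :: "'a L2"
  obtain F where F: "f = abs_L2 F" "square_integrable F" by (rule abs_L2_cases)
  obtain x \<omega> y \<eta> where XY: "X = (x, \<omega>)" "Y = (y, \<eta>)" by (cases X, cases Y) auto
  have "character (\<omega> \<bullet> t) * (character (\<eta> \<bullet> (t - x)) * F (t - x - y))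
      = cocycle X Y * (character ((\<omega> + \<eta>) \<bullet> t) * F (t - (x + y)))" for t
  proof -
    have "character (\<eta> \<bullet> (t - x)) = character (\<eta> \<bullet> t) * character (- (\<eta> \<bullet> x))"
      by (simp add: character_add[symmetric] inner_diff_right)
    then show ?thesis
      by (simp add: XY cocycle_def inner_add_left character_add diff_diff_eq mult_ac)
  qed
  then show "blinfun_apply (tf_shift X o\<^sub>L tf_shift Y) f
      = blinfun_apply (scale_op (cocycle X Y) (tf_shift (X + Y))) f"
    using F by (simp add: XY tf_shift_abs_L2 square_integrable_tf_shift scaleC_abs_L2)
qed

lemma tf_shift_0 [simp]: "tf_shift 0 = id_blinfun"
proof (rule blinfun_eqI)
  fix f :: "'a L2"
  obtain F where F: "f = abs_L2 F" "square_integrable F" by (rule abs_L2_cases)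
  show "blinfun_apply (tf_shift 0) f = blinfun_apply id_blinfun f"
    using F by (simp add: zero_prod_def tf_shift_abs_L2)
qed

lemma cinner_tf_shift [simp]:
  "cinner (blinfun_apply (tf_shift X) f) (blinfun_apply (tf_shift X) g) = cinner f g"
proof -
  obtain F where F: "f = abs_L2 F" "square_integrable F" by (rule abs_L2_cases)
  obtain G where G: "g = abs_L2 G" "square_integrable G" by (rule abs_L2_cases)
  obtain x \<omega> where X: "X = (x, \<omega>)" by (cases X)
  have [measurable]: "F \<in> borel_measurable borel" "G \<in> borel_measurable borel"
    using F G by (simp_all add: square_integrable_def)
  have m: "(\<lambda>t. F t * cnj (G t)) \<in> borel_measurable borel"
    using borel_measurable_integrable[OF integrable_inner_L2[of F G]] F G by simp
  have "character (\<omega> \<bullet> t) * F (t - x) * cnj (character (\<omega> \<bullet> t) * G (t - x))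
      = F (t - x) * cnj (G (t - x))" for t
  proof -
    have "character (\<omega> \<bullet> t) * F (t - x) * cnj (character (\<omega> \<bullet> t) * G (t - x))
        = (character (\<omega> \<bullet> t) * cnj (character (\<omega> \<bullet> t))) * (F (t - x) * cnj (G (t - x)))"
      by (simp add: mult_ac)
    then show ?thesis by (simp add: cnj_character)
  qed
  then have "cinner (blinfun_apply (tf_shift X) f) (blinfun_apply (tf_shift X) g)
      = (\<integral>t. F (t - x) * cnj (G (t - x)) \<partial>lborel)"
    by (simp only: X F G tf_shift_abs_L2 cinner_abs_L2 square_integrable_tf_shift)
  also have "\<dots> = (\<integral>t. F t * cnj (G t) \<partial>distr lborel borel ((+) (-x)))"
    by (subst integral_distr[OF _ m]) auto
  also have "\<dots> = cinner f g"
    using F G by (simp add: lborel_distr_plus cinner_abs_L2)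
  finally show ?thesis .
qed

lemma norm_tf_shift_apply [simp]: "norm (blinfun_apply (tf_shift X) f) = norm f"
  by (rule norm_eq_of_cinner) simp

lemma norm_tf_shift_le: "norm (tf_shift X) \<le> 1"
  by (rule norm_blinfun_bound) auto

lemma tf_shift_add:
  "tf_shift (X + Y) = scale_op (cnj (cocycle X Y)) (tf_shift X o\<^sub>L tf_shift Y)"
  by (simp add: tf_shift_compose scale_op_scale_op)

text \<open>The adjoint of \<open>\<pi>(X)\<close> is its inverse, a multiple of \<open>\<pi>(-X)\<close>.\<close>

lemma cinner_tf_shift_left:
  "cinner (blinfun_apply (tf_shift X) f) g
    = cinner f (cnj (cocycle X (-X)) *\<^sub>C blinfun_apply (tf_shift (-X)) g)"
proof -
  have "blinfun_apply (tf_shift X) (blinfun_apply (tf_shift (-X)) g) = cocycle X (-X) *\<^sub>C g"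
    using arg_cong[OF tf_shift_compose[of X "-X"], of "\<lambda>T. blinfun_apply T g"] by simp
  then have "g = blinfun_apply (tf_shift X) (cnj (cocycle X (-X)) *\<^sub>C blinfun_apply (tf_shift (-X)) g)"
    by (simp add: tf_shift_scaleC scaleC_scaleC)
  then show ?thesis by (metis cinner_tf_shift)
qed

text \<open>Covariance. The phase on the right is the one in \<open>\<pi>(X) \<pi>(Y)\<close>, so it cancels whenever \<open>V\<^sub>g(\<pi>(X) f)(X + Y)\<close>
  multiplies \<open>\<pi>(X + Y)\<close>.\<close>

lemma stft_tf_shift:
  "stft g (blinfun_apply (tf_shift X) f) (X + Y) = cocycle X Y * stft g f Y"
  by (simp add: stft_def tf_shift_add cinner_scaleC_right)

section \<open>Fourier inversion for integrable functions\<close>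

text \<open>Lebesgue measure is the image of the product measure over the basis, so Fubini for finite products
  applies coordinatewise.\<close>

lemma integral_lborel_prod:
  fixes f :: "'a::euclidean_space \<Rightarrow> real \<Rightarrow> complex"
  assumes "\<And>b. b \<in> Basis \<Longrightarrow> integrable lborel (f b)"
  shows "integrable lborel (\<lambda>x. \<Prod>b\<in>Basis. f b (x \<bullet> b))"
    and "(\<integral>x. (\<Prod>b\<in>Basis. f b (x \<bullet> b)) \<partial>lborel) = (\<Prod>b\<in>Basis. (\<integral>y. f b y \<partial>lborel))"
proof -
  interpret product_sigma_finite "\<lambda>_::'a. lborel::real measure" by standard
  have m: "(\<lambda>f. \<Sum>b\<in>Basis. f b *\<^sub>R b) \<in> measurable (\<Pi>\<^sub>M b\<in>(Basis::'a set). lborel) borel"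
    by measurable
  have c: "(\<Prod>b\<in>Basis. f b ((\<Sum>b'\<in>Basis. y b' *\<^sub>R b') \<bullet> b)) = (\<Prod>b\<in>Basis. f b (y b))" for y
    by (intro prod.cong refl) simp
  have [measurable]: "f b \<in> borel_measurable borel" if "b \<in> Basis" for b
    using assms[OF that] by auto
  have bm: "(\<lambda>x. \<Prod>b\<in>Basis. f b (x \<bullet> b)) \<in> borel_measurable borel"
    by measurable
  have "integrable (\<Pi>\<^sub>M b\<in>(Basis::'a set). lborel) (\<lambda>y. \<Prod>b\<in>Basis. f b (y b))"
    by (rule product_integrable_prod) (use assms in auto)
  then show "integrable lborel (\<lambda>x. \<Prod>b\<in>Basis. f b (x \<bullet> b))"
    by (subst lborel_eq) (simp add: integrable_distr_eq[OF m bm] c)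
  have "(\<integral>x. (\<Prod>b\<in>Basis. f b (x \<bullet> b)) \<partial>lborel)
      = (\<integral>y. (\<Prod>b\<in>Basis. f b (y b)) \<partial>(\<Pi>\<^sub>M b\<in>(Basis::'a set). lborel))"
    by (subst lborel_eq) (simp add: integral_distr[OF m bm] c)
  also have "\<dots> = (\<Prod>b\<in>Basis. (\<integral>y. f b y \<partial>lborel))"
    by (rule product_integral_prod) (use assms in auto)
  finally show "(\<integral>x. (\<Prod>b\<in>Basis. f b (x \<bullet> b)) \<partial>lborel) = (\<Prod>b\<in>Basis. (\<integral>y. f b y \<partial>lborel))" .
qed

text \<open>Rescaled, this is the characteristic function of the standard normal distribution.\<close>

lemma gaussian_fourier_1d:
  fixes c s :: real
  assumes c: "c > 0"
  shows "integrable lborel (\<lambda>y. of_real (exp (- (pi * c\<^sup>2 * y\<^sup>2))) * character (s * y))"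
    and "(\<integral>y. of_real (exp (- (pi * c\<^sup>2 * y\<^sup>2))) * character (s * y) \<partial>lborel)
       = of_real (exp (- (pi * s\<^sup>2 / c\<^sup>2)) / c)"
proof -
  \<comment> \<open>\<open>y = z / a\<close> turns \<open>\<pi> c\<^sup>2 y\<^sup>2\<close> into the exponent \<open>z\<^sup>2 / 2\<close> of the normal density.\<close>
  define a where "a = c * sqrt (2 * pi)"
  have a: "a > 0" using c by (simp add: a_def)
  define g where "g y = of_real (exp (- (pi * c\<^sup>2 * y\<^sup>2))) * character (s * y)" for y
  have g: "g (0 + inverse a * z) = of_real (sqrt (2 * pi)) * (std_normal_density z *\<^sub>R iexp ((2 * pi * s / a) * z))" for z
  proof -
    have "pi * c\<^sup>2 * (inverse a * z)\<^sup>2 = z\<^sup>2 / 2"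
      using c by (simp add: a_def power_mult_distrib power_divide field_simps)
    moreover have "character (s * (inverse a * z)) = iexp ((2 * pi * s / a) * z)"
    proof -
      have "2 * complex_of_real pi * \<i> * of_real (s * (inverse a * z)) = \<i> * of_real ((2 * pi * s / a) * z)"
        by (simp add: divide_inverse of_real_mult)
      then show ?thesis by (simp only: character_def)
    qed
    ultimately show ?thesis
      by (simp add: g_def std_normal_density_def scaleR_conv_of_real del: of_real_mult)
  qed
  have int: "integrable lborel (\<lambda>z. std_normal_density z *\<^sub>R iexp ((2 * pi * s / a) * z))"
  proof (rule Bochner_Integration.integrable_bound[where f=std_normal_density])
    show "(\<lambda>z. std_normal_density z *\<^sub>R iexp ((2 * pi * s / a) * z)) \<in> borel_measurable lborel"
      by measurable
  qed (simp_all add: norm_exp_eq_Re)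
  have "(\<integral>z. std_normal_density z *\<^sub>R iexp ((2 * pi * s / a) * z) \<partial>lborel)
      = char std_normal_distribution (2 * pi * s / a)"
    unfolding char_def by (subst integral_density) auto
  also have "\<dots> = of_real (exp (- (pi * s\<^sup>2 / c\<^sup>2)))"
  proof -
    have "(2 * pi * s / a)\<^sup>2 / 2 = pi * s\<^sup>2 / c\<^sup>2"
      using c by (simp add: a_def power_mult_distrib power_divide field_simps power2_eq_square)
    then show ?thesis by (simp add: char_std_normal_distribution)
  qed
  finally have I: "(\<integral>z. std_normal_density z *\<^sub>R iexp ((2 * pi * s / a) * z) \<partial>lborel)
      = of_real (exp (- (pi * s\<^sup>2 / c\<^sup>2)))" .
  have "integrable lborel (\<lambda>z. g (0 + inverse a * z))"
    unfolding g by (rule integrable_mult_right[OF int])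
  then show "integrable lborel (\<lambda>y. of_real (exp (- (pi * c\<^sup>2 * y\<^sup>2))) * character (s * y))"
    unfolding g_def[symmetric]
    by (subst (asm) lborel_integrable_real_affine_iff) (use a in auto)
  have "(\<integral>y. g y \<partial>lborel) = \<bar>inverse a\<bar> *\<^sub>R (\<integral>z. g (0 + inverse a * z) \<partial>lborel)"
    by (rule lborel_integral_real_affine) (use a in auto)
  also have "(\<integral>z. g (0 + inverse a * z) \<partial>lborel)
      = of_real (sqrt (2 * pi)) * of_real (exp (- (pi * s\<^sup>2 / c\<^sup>2)))"
    unfolding g integral_mult_right_zero I ..
  also have "\<bar>inverse a\<bar> *\<^sub>R \<dots> = of_real (exp (- (pi * s\<^sup>2 / c\<^sup>2)) / c)"
    using c by (simp add: a_def scaleR_conv_of_real field_simps)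
  finally show "(\<integral>y. of_real (exp (- (pi * c\<^sup>2 * y\<^sup>2))) * character (s * y) \<partial>lborel)
       = of_real (exp (- (pi * s\<^sup>2 / c\<^sup>2)) / c)" by (simp only: g_def)
qed

lemma character_sum: "character (sum f A) = (\<Prod>x\<in>A. character (f x))"
  by (induction A rule: infinite_finite_induct) (auto simp: character_add)

lemma gaussian_fourier:
  fixes \<omega> :: "'a::euclidean_space" and c :: real
  assumes c: "c > 0"
  shows "integrable lborel (\<lambda>x. of_real (exp (- (pi * c\<^sup>2 * (x \<bullet> x)))) * character (\<omega> \<bullet> x))"
    and "(\<integral>x. of_real (exp (- (pi * c\<^sup>2 * (x \<bullet> x)))) * character (\<omega> \<bullet> x) \<partial>lborel)
       = of_real (exp (- (pi * (\<omega> \<bullet> \<omega>) / c\<^sup>2)) / c ^ DIM('a))"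
proof -
  define f where "f b y = of_real (exp (- (pi * c\<^sup>2 * y\<^sup>2))) * character ((\<omega> \<bullet> b) * y)" for b y
  have f: "integrable lborel (f b)" for b
    unfolding f_def by (rule gaussian_fourier_1d[OF c])
  have p: "of_real (exp (- (pi * c\<^sup>2 * (x \<bullet> x)))) * character (\<omega> \<bullet> x) = (\<Prod>b\<in>Basis. f b (x \<bullet> b))"
    for x
  proof -
    have "\<omega> \<bullet> x = (\<Sum>b\<in>Basis. (\<omega> \<bullet> b) * (x \<bullet> b))" by (rule euclidean_inner)
    moreover have "x \<bullet> x = (\<Sum>b\<in>Basis. (x \<bullet> b)\<^sup>2)"
      by (subst euclidean_inner) (simp add: power2_eq_square)
    ultimately show ?thesis
      by (simp add: f_def prod.distrib character_sum sum_distrib_left exp_sum flip: of_real_prod sum_negf)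
  qed
  show "integrable lborel (\<lambda>x. of_real (exp (- (pi * c\<^sup>2 * (x \<bullet> x)))) * character (\<omega> \<bullet> x))"
    unfolding p by (rule integral_lborel_prod(1)[OF f])
  have "(\<integral>x. of_real (exp (- (pi * c\<^sup>2 * (x \<bullet> x)))) * character (\<omega> \<bullet> x) \<partial>lborel)
      = (\<Prod>b\<in>Basis. of_real (exp (- (pi * (\<omega> \<bullet> b)\<^sup>2 / c\<^sup>2)) / c))"
  proof -
    have "(\<integral>y. f b y \<partial>lborel) = of_real (exp (- (pi * (\<omega> \<bullet> b)\<^sup>2 / c\<^sup>2)) / c)" for b
      unfolding f_def by (rule gaussian_fourier_1d(2)[OF c])
    then show ?thesis unfolding p by (subst integral_lborel_prod(2)[OF f]) simp
  qed
  also have "\<dots> = of_real (\<Prod>b\<in>(Basis::'a set). exp (- (pi * (\<omega> \<bullet> b)\<^sup>2 / c\<^sup>2)) / c)"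
    by simp
  also have "(\<Prod>b\<in>(Basis::'a set). exp (- (pi * (\<omega> \<bullet> b)\<^sup>2 / c\<^sup>2)) / c)
      = exp (- (pi * (\<omega> \<bullet> \<omega>) / c\<^sup>2)) / c ^ DIM('a)"
  proof -
    have "\<omega> \<bullet> \<omega> = (\<Sum>b\<in>Basis. (\<omega> \<bullet> b)\<^sup>2)"
      by (subst euclidean_inner) (simp add: power2_eq_square)
    then show ?thesis
      by (simp add: prod_dividef exp_sum sum_distrib_left sum_divide_distrib flip: sum_negf)
  qed
  finally show "(\<integral>x. of_real (exp (- (pi * c\<^sup>2 * (x \<bullet> x)))) * character (\<omega> \<bullet> x) \<partial>lborel)
       = of_real (exp (- (pi * (\<omega> \<bullet> \<omega>) / c\<^sup>2)) / c ^ DIM('a))" .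
qed

lemma gaussian_integrable:
  fixes c :: real
  assumes "c > 0"
  shows "integrable lborel (\<lambda>x::'a::euclidean_space. exp (- (pi * c\<^sup>2 * (x \<bullet> x))))"
proof -
  have "integrable lborel (\<lambda>x::'a. norm (complex_of_real (exp (- (pi * c\<^sup>2 * (x \<bullet> x)))) * character (0 \<bullet> x)))"
    by (rule integrable_norm, rule gaussian_fourier, fact)
  then show ?thesis by (simp add: norm_mult)
qed

lemma lborel_integral_affine:
  fixes f :: "'a::euclidean_space \<Rightarrow> complex"
  assumes f: "f \<in> borel_measurable borel" and c: "c \<noteq> 0"
  shows "(\<integral>x. f x \<partial>lborel) = of_real (\<bar>c\<bar> ^ DIM('a)) * (\<integral>x. f (t + c *\<^sub>R x) \<partial>lborel)"
proof -
  have "(\<integral>x. f x \<partial>lborel)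
      = (\<integral>x. f x \<partial>density (distr lborel borel (\<lambda>x. t + c *\<^sub>R x)) (\<lambda>_. ennreal (\<bar>c\<bar>^DIM('a))))"
    using lborel_affine[OF c, of t] by (simp add: ennreal_power)
  also have "\<dots> = (\<integral>x. (\<bar>c\<bar>^DIM('a)) *\<^sub>R f x \<partial>distr lborel borel (\<lambda>x. t + c *\<^sub>R x))"
    by (rule integral_density) (use f in auto)
  also have "\<dots> = (\<integral>x. (\<bar>c\<bar>^DIM('a)) *\<^sub>R f (t + c *\<^sub>R x) \<partial>lborel)"
    by (rule integral_distr) (use f in measurable)
  finally show ?thesis by (simp add: scaleR_conv_of_real)
qed

lemma lborel_integrable_affine:
  fixes f :: "'a::euclidean_space \<Rightarrow> 'b::{banach,second_countable_topology}"
  assumes f: "integrable lborel f" and c: "c \<noteq> 0"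
  shows "integrable lborel (\<lambda>x. f (t + c *\<^sub>R x))"
proof -
  have m: "f \<in> borel_measurable borel" using f by auto
  have "integrable (density (distr lborel borel (\<lambda>x. t + c *\<^sub>R x)) (\<lambda>_. ennreal (\<bar>c\<bar>^DIM('a)))) f"
    using lborel_affine[OF c, of t] f by (simp add: ennreal_power)
  then have "integrable (distr lborel borel (\<lambda>x. t + c *\<^sub>R x)) (\<lambda>x. (\<bar>c\<bar>^DIM('a)) *\<^sub>R f x)"
    by (subst (asm) integrable_density) (use m in auto)
  from integrable_scaleR_right[OF this, of "inverse (\<bar>c\<bar>^DIM('a))"]
  have "integrable (distr lborel borel (\<lambda>x. t + c *\<^sub>R x)) f"
    using c by simp
  then show ?thesis by (subst (asm) integrable_distr_eq) (use m in auto)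
qed

text \<open>The sets on which \<open>f\<close> has integral zero form a Dynkin system, and boxes generate the Borel
  sets.\<close>

lemma AE_zero_if_box_integrals_zero:
  fixes f :: "'a::euclidean_space \<Rightarrow> complex"
  assumes f: "integrable lborel f"
    and box: "\<And>a b. (\<integral>x. indicator (box a b) x *\<^sub>R f x \<partial>lborel) = 0"
  shows "AE x in lborel. f x = 0"
proof -
  have [measurable]: "f \<in> borel_measurable borel" using f by auto
  have total: "(\<integral>x. f x \<partial>lborel) = 0"
  proof -
    have "(\<lambda>n. \<integral>x. indicator (box (- real n *\<^sub>R One) (real n *\<^sub>R One)) x *\<^sub>R f x \<partial>lborel)
        \<longlonglongrightarrow> (\<integral>x. f x \<partial>lborel)"
    proof (rule integral_dominated_convergence[where w="\<lambda>x. norm (f x)"])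
      show "AE x in lborel. (\<lambda>n. indicator (box (- real n *\<^sub>R One) (real n *\<^sub>R One)) x *\<^sub>R f x) \<longlonglongrightarrow> f x"
      proof (rule AE_I2)
        fix x :: 'a
        obtain N where N: "norm x < real N" using reals_Archimedean2 by blast
        have "\<forall>\<^sub>F n in sequentially. indicator (box (- real n *\<^sub>R One) (real n *\<^sub>R One)) x *\<^sub>R f x = f x"
        proof (rule eventually_sequentiallyI[of N])
          fix n assume n: "N \<le> n"
          have "\<bar>x \<bullet> b\<bar> < real n" if "b \<in> Basis" for b
            using Basis_le_norm[OF that, of x] N n by linarith
          then have "x \<in> box (- real n *\<^sub>R One) (real n *\<^sub>R One)"
            by (force simp: mem_box inner_sum_left_Basis abs_less_iff)
          then show "indicator (box (- real n *\<^sub>R One) (real n *\<^sub>R One)) x *\<^sub>R f x = f x" by simp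
        qed
        then show "(\<lambda>n. indicator (box (- real n *\<^sub>R One) (real n *\<^sub>R One)) x *\<^sub>R f x) \<longlonglongrightarrow> f x"
          by (rule tendsto_eventually)
      qed
    qed (use f in \<open>auto split: split_indicator\<close>)
    then have "(\<lambda>n. 0) \<longlonglongrightarrow> (\<integral>x. f x \<partial>lborel)" by (simp only: box)
    then show ?thesis by (simp add: LIMSEQ_const_iff)
  qed
  have all: "(\<integral>x. indicator A x *\<^sub>R f x \<partial>lborel) = 0" if "A \<in> sets borel" for A
  proof -
    have "A \<in> sigma_sets UNIV (range (\<lambda>(a, b). box a b))"
      using that borel_eq_box[where 'a='a] by (metis sets_measure_of top_greatest Pow_UNIV)
    then show ?thesis
    proof (rule sigma_sets_induct_disjoint[rotated 2, of A UNIV "range (\<lambda>(a, b). box a b)"])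
      show "(\<integral>x. indicator A x *\<^sub>R f x \<partial>lborel) = 0" if "A \<in> range (\<lambda>(a, b). box a b)" for A
        using that box by auto
      show "(\<integral>x. indicator {} x *\<^sub>R f x \<partial>lborel) = 0" by simp
      show "(\<integral>x. indicator (UNIV - A) x *\<^sub>R f x \<partial>lborel) = 0"
        if "A \<in> sigma_sets UNIV (range (\<lambda>(a, b). box a b))" "(\<integral>x. indicator A x *\<^sub>R f x \<partial>lborel) = 0" for A
      proof -
        have A: "A \<in> sets lborel"
          using that(1) borel_eq_box[where 'a='a] by (metis sets_lborel sets_measure_of top_greatest Pow_UNIV)
        have "(\<integral>x. indicator (UNIV - A) x *\<^sub>R f x \<partial>lborel) = (\<integral>x. f x - indicator A x *\<^sub>R f x \<partial>lborel)"
          by (intro Bochner_Integration.integral_cong) (auto split: split_indicator)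
        also have "\<dots> = 0"
          using that(2) total f integrable_mult_indicator[OF A f] by simp
        finally show ?thesis .
      qed
      show "(\<integral>x. indicator (\<Union>i. A i) x *\<^sub>R f x \<partial>lborel) = 0"
        if "disjoint_family A" "range A \<subseteq> sigma_sets UNIV (range (\<lambda>(a, b). box a b))"
          "\<And>i. (\<integral>x. indicator (A i) x *\<^sub>R f x \<partial>lborel) = 0" for A :: "nat \<Rightarrow> 'a set"
      proof -
        have A: "A i \<in> sets lborel" for i
          using that(2) borel_eq_box[where 'a='a]
          by (metis range_subsetD sets_lborel sets_measure_of top_greatest Pow_UNIV)
        have "set_lebesgue_integral lborel (\<Union>i. A i) f = (\<Sum>i. set_lebesgue_integral lborel (A i) f)"
          using that(1) f A
          by (intro lebesgue_integral_countable_add)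
            (auto simp: disjoint_family_on_def set_integrable_def intro!: integrable_mult_indicator)
        then show ?thesis using that(3) by (simp add: set_lebesgue_integral_def)
      qed
      show "Int_stable (range (\<lambda>(a, b). box a b :: 'a set))"
        by (auto simp: Int_stable_def box_Int_box)
    qed auto
  qed
  show ?thesis
    using sigma_finite_measure.density_zero[OF sigma_finite_lborel f] all by (simp add: set_lebesgue_integral_def)
qed

lemma borel_measurable_character [measurable]: "character \<in> borel_measurable borel"
  unfolding character_def by (intro borel_measurable_continuous_onI continuous_intros)

definition fourier :: "('a::euclidean_space \<Rightarrow> complex) \<Rightarrow> 'a \<Rightarrow> complex" where
  "fourier u \<omega> = (\<integral>s. u s * character (- (\<omega> \<bullet> s)) \<partial>lborel)"

lemma integrable_pair_bound:
  fixes f :: "'a::euclidean_space \<times> 'b::euclidean_space \<Rightarrow> complex"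
  assumes u: "integrable lborel u" and v: "integrable lborel v"
    and f: "f \<in> borel_measurable (lborel \<Otimes>\<^sub>M lborel)"
    and b: "\<And>x y. norm (f (x, y)) \<le> u x * (v y :: real)"
  shows "integrable (lborel \<Otimes>\<^sub>M lborel) f"
proof (rule Bochner_Integration.integrable_bound[OF _ f])
  show "integrable (lborel \<Otimes>\<^sub>M lborel) (\<lambda>(x, y). u x * v y)"
  proof (rule lborel_pair.Fubini_integrable)
    show "(\<lambda>(x, y). u x * v y) \<in> borel_measurable (lborel \<Otimes>\<^sub>M lborel)"
      using u v by measurable
  qed (use u v in \<open>auto simp: abs_mult\<close>)
  show "AE x in lborel \<Otimes>\<^sub>M lborel. norm (f x) \<le> norm (case x of (x, y) \<Rightarrow> u x * v y)"
    using b by (auto intro!: AE_I2 intro: order_trans[OF _ abs_ge_self])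
qed

text \<open>Damping \<open>fourier u\<close> by a Gaussian of width \<open>1/\<epsilon>\<close> before inverting amounts to smoothing \<open>u\<close> by a Gaussian of
  width \<open>\<epsilon>\<close>: this is Fubini together with the Fourier transform of the Gaussian.\<close>

lemma damped_inversion:
  fixes u :: "'a::euclidean_space \<Rightarrow> complex"
  assumes u: "integrable lborel u" and e: "e > 0"
  shows "(\<integral>\<omega>. fourier u \<omega> * character (\<omega> \<bullet> t) * of_real (exp (- (pi * e\<^sup>2 * (\<omega> \<bullet> \<omega>)))) \<partial>lborel)
    = (\<integral>r. of_real (exp (- (pi * (r \<bullet> r)))) * u (t + (- e) *\<^sub>R r) \<partial>lborel)"
proof -
  have [measurable]: "u \<in> borel_measurable borel" using u by auto
  define w where "w \<omega> = complex_of_real (exp (- (pi * e\<^sup>2 * (\<omega> \<bullet> \<omega>))))" for \<omega> :: 'a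
  have [measurable]: "w \<in> borel_measurable borel" unfolding w_def by measurable
  have "(\<integral>\<omega>. fourier u \<omega> * character (\<omega> \<bullet> t) * w \<omega> \<partial>lborel)
      = (\<integral>\<omega>. (\<integral>s. u s * (w \<omega> * character ((t - s) \<bullet> \<omega>)) \<partial>lborel) \<partial>lborel)"
  proof (rule Bochner_Integration.integral_cong[OF refl])
    fix \<omega> :: 'a
    have "fourier u \<omega> * character (\<omega> \<bullet> t) * w \<omega>
        = (\<integral>s. u s * character (- (\<omega> \<bullet> s)) * (character (\<omega> \<bullet> t) * w \<omega>) \<partial>lborel)"
      unfolding fourier_def integral_mult_left_zero by (simp only: mult.assoc)
    also have "\<dots> = (\<integral>s. u s * (w \<omega> * character ((t - s) \<bullet> \<omega>)) \<partial>lborel)"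
    proof (rule Bochner_Integration.integral_cong[OF refl])
      fix s
      have "character ((t - s) \<bullet> \<omega>) = character (- (\<omega> \<bullet> s)) * character (\<omega> \<bullet> t)"
        by (simp add: character_add[symmetric] inner_diff_left inner_commute[of \<omega>])
      then show "u s * character (- (\<omega> \<bullet> s)) * (character (\<omega> \<bullet> t) * w \<omega>)
          = u s * (w \<omega> * character ((t - s) \<bullet> \<omega>))" by (simp add: mult_ac)
    qed
    finally show "fourier u \<omega> * character (\<omega> \<bullet> t) * w \<omega>
        = (\<integral>s. u s * (w \<omega> * character ((t - s) \<bullet> \<omega>)) \<partial>lborel)" .
  qed
  also have "\<dots> = (\<integral>s. (\<integral>\<omega>. u s * (w \<omega> * character ((t - s) \<bullet> \<omega>)) \<partial>lborel) \<partial>lborel)"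
  proof (rule lborel_pair.Fubini_integral[where f="\<lambda>s \<omega>. u s * (w \<omega> * character ((t - s) \<bullet> \<omega>))"],
      rule integrable_pair_bound)
    show "integrable lborel (\<lambda>s. norm (u s))" using u by simp
    show "integrable lborel (\<lambda>\<omega>::'a. exp (- (pi * e\<^sup>2 * (\<omega> \<bullet> \<omega>))))" by (rule gaussian_integrable[OF e])
    show "(\<lambda>(s, \<omega>). u s * (w \<omega> * character ((t - s) \<bullet> \<omega>))) \<in> borel_measurable (lborel \<Otimes>\<^sub>M lborel)"
      by measurable
  qed (simp add: w_def norm_mult)
  also have "\<dots> = (\<integral>s. u s * of_real (exp (- (pi * ((t - s) \<bullet> (t - s)) / e\<^sup>2)) / e ^ DIM('a)) \<partial>lborel)"
    by (simp add: w_def gaussian_fourier(2)[OF e])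
  also have "\<dots> = of_real (\<bar>- e\<bar> ^ DIM('a)) * (\<integral>r. u (t + (- e) *\<^sub>R r) * of_real (exp (- (pi * ((t - (t + (- e) *\<^sub>R r)) \<bullet> (t - (t + (- e) *\<^sub>R r))) / e\<^sup>2)) / e ^ DIM('a)) \<partial>lborel)"
    by (rule lborel_integral_affine) (use e in auto)
  also have "\<dots> = (\<integral>r. of_real (exp (- (pi * (r \<bullet> r)))) * u (t + (- e) *\<^sub>R r) \<partial>lborel)"
    unfolding integral_mult_right_zero[symmetric]
    using e by (intro Bochner_Integration.integral_cong) (auto simp: power2_eq_square)
  finally show ?thesis by (simp add: w_def)
qed

text \<open>Off its boundary, a null set, the indicator of a box is locally constant.\<close>

lemma tendsto_indicator_box_AE:
  fixes r :: "'a::euclidean_space"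
  assumes "x \<longlonglongrightarrow> (0::real)"
  shows "AE s in lborel. (\<lambda>n. indicator (box a b) (s + x n *\<^sub>R r) :: real) \<longlonglongrightarrow> indicator (box a b) s"
proof -
  have "AE s in lborel. s \<notin> cbox a b - box a b"
    by (rule AE_not_in[OF null_sets_cbox_Diff_box])
  then show ?thesis
  proof eventually_elim
    fix s assume s: "s \<notin> cbox a b - box a b"
    have lim: "(\<lambda>n. s + x n *\<^sub>R r) \<longlonglongrightarrow> s"
      using tendsto_add[OF tendsto_const tendsto_scaleR[OF assms tendsto_const]] by simp
    show "(\<lambda>n. indicator (box a b) (s + x n *\<^sub>R r) :: real) \<longlonglongrightarrow> indicator (box a b) s"
    proof (cases "s \<in> box a b")
      case True
      then have "\<forall>\<^sub>F n in sequentially. s + x n *\<^sub>R r \<in> box a b"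
        using topological_tendstoD[OF lim open_box] by auto
      then show ?thesis
        using True by (intro tendsto_eventually) (auto elim: eventually_mono)
    next
      case False
      then have "s \<in> - cbox a b" using s by auto
      then have "\<forall>\<^sub>F n in sequentially. s + x n *\<^sub>R r \<in> - cbox a b"
        using topological_tendstoD[OF lim, of "- cbox a b"] closed_cbox by auto
      then show ?thesis
        using False box_subset_cbox by (intro tendsto_eventually) (force elim: eventually_mono)
    qed
  qed
qed

text \<open>The damped inverse transforms converge pointwise to the inverse transform, and their integrals over a
  box converge to the integral of \<open>u\<close>: there the smoothing can be moved from \<open>u\<close> to the indicator of the
  box, whose translates converge almost everywhere. Testing against boxes thus replaces the density of
  continuous functions in \<open>L\<^sup>1\<close>.\<close>

theorem fourier_inversion:
  fixes u :: "'a::euclidean_space \<Rightarrow> complex"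
  assumes u: "integrable lborel u" and fu: "integrable lborel (fourier u)"
  shows "AE t in lborel. u t = (\<integral>\<omega>. fourier u \<omega> * character (\<omega> \<bullet> t) \<partial>lborel)"
proof -
  have [measurable]: "u \<in> borel_measurable borel" "fourier u \<in> borel_measurable borel" using u fu by auto
  let ?g = "\<lambda>n \<omega>. complex_of_real (exp (- (pi * (1 / real (Suc n))\<^sup>2 * (\<omega> \<bullet> \<omega>))))"
  define k where "k t = (\<integral>\<omega>. fourier u \<omega> * character (\<omega> \<bullet> t) \<partial>lborel)" for t
  define M where "M = (\<integral>\<omega>. norm (fourier u \<omega>) \<partial>lborel)"
  define K where "K n t = (\<integral>\<omega>. fourier u \<omega> * character (\<omega> \<bullet> t) * ?g n \<omega> \<partial>lborel)" for n t
  have [measurable]: "k \<in> borel_measurable borel" "K n \<in> borel_measurable borel" for n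
    unfolding k_def K_def by measurable
  have inv: "(\<lambda>n. 1 / real (Suc n)) \<longlonglongrightarrow> 0" by real_asymp
  have K_lim: "(\<lambda>n. K n t) \<longlonglongrightarrow> k t" for t
    unfolding K_def k_def
  proof (rule integral_dominated_convergence[where w="\<lambda>\<omega>. norm (fourier u \<omega>)"])
    show "AE \<omega> in lborel. (\<lambda>n. fourier u \<omega> * character (\<omega> \<bullet> t) * ?g n \<omega>)
        \<longlonglongrightarrow> fourier u \<omega> * character (\<omega> \<bullet> t)"
    proof (rule AE_I2)
      fix \<omega> :: 'a
      have "(\<lambda>n. fourier u \<omega> * character (\<omega> \<bullet> t) * ?g n \<omega>)
        \<longlonglongrightarrow> fourier u \<omega> * character (\<omega> \<bullet> t) * of_real (exp (- (pi * 0\<^sup>2 * (\<omega> \<bullet> \<omega>))))"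
        by (intro tendsto_intros inv)
      then show "(\<lambda>n. fourier u \<omega> * character (\<omega> \<bullet> t) * ?g n \<omega>)
        \<longlonglongrightarrow> fourier u \<omega> * character (\<omega> \<bullet> t)" by simp
    qed
  qed (use fu in \<open>auto simp: norm_mult mult_left_le\<close>)
  have M_bound: "norm (k t) \<le> M" for t
  proof -
    have "norm (k t) \<le> (\<integral>\<omega>. norm (fourier u \<omega> * character (\<omega> \<bullet> t)) \<partial>lborel)"
      unfolding k_def by (rule integral_norm_bound)
    then show ?thesis by (simp add: norm_mult M_def)
  qed
  have K_bound: "norm (K n t) \<le> M" for n t
  proof -
    have "norm (K n t) \<le> (\<integral>\<omega>. norm (fourier u \<omega> * character (\<omega> \<bullet> t) * ?g n \<omega>) \<partial>lborel)"
      unfolding K_def by (rule integral_norm_bound)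
    also have "\<dots> \<le> M" unfolding M_def
      by (rule integral_mono') (use fu in \<open>auto simp: norm_mult mult_left_le\<close>)
    finally show ?thesis .
  qed
  have box_fin: "emeasure lborel (box a b) < \<infinity>" for a b :: 'a
    by (rule emeasure_bounded_finite) simp
  have box: "(\<integral>t. indicator (box a b) t *\<^sub>R u t \<partial>lborel) = (\<integral>t. indicator (box a b) t *\<^sub>R k t \<partial>lborel)" for a b
  proof (rule LIMSEQ_unique)
    let ?E = "\<lambda>n r s. indicator (box a b) (s + (1 / real (Suc n)) *\<^sub>R r) *\<^sub>R u s"
    let ?I = "\<lambda>n. \<integral>t. indicator (box a b) t *\<^sub>R K n t \<partial>lborel"
    show "?I \<longlonglongrightarrow> (\<integral>t. indicator (box a b) t *\<^sub>R k t \<partial>lborel)"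
    proof (rule integral_dominated_convergence[where w="\<lambda>t. M * indicator (box a b) t"])
      show "integrable lborel (\<lambda>t. M * indicator (box a b) t)"
        using box_fin[of a b] by (intro integrable_mult_right) (simp add: integrable_indicator_iff)
    qed (use K_lim K_bound in \<open>auto intro!: tendsto_intros split: split_indicator\<close>)
    define G where "G r = complex_of_real (exp (- (pi * (r \<bullet> r))))" for r :: 'a
    have [measurable]: "G \<in> borel_measurable borel" unfolding G_def by measurable
    have G: "integrable lborel G" "(\<integral>r. G r \<partial>lborel) = 1"
      using gaussian_fourier[of 1 "0::'a"] by (simp_all add: G_def[abs_def])
    have I: "?I n = (\<integral>r. G r * (\<integral>s. ?E n r s \<partial>lborel) \<partial>lborel)" for n
    proof -
      define e where "e = 1 / real (Suc n)"
      have e: "e > 0" by (simp add: e_def)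
      have "?I n = (\<integral>t. (\<integral>r. indicator (box a b) t *\<^sub>R (G r * u (t + (- e) *\<^sub>R r)) \<partial>lborel) \<partial>lborel)"
        unfolding K_def e_def[symmetric] damped_inversion[OF u e] G_def[symmetric]
        by simp
      also have "\<dots> = (\<integral>r. (\<integral>t. indicator (box a b) t *\<^sub>R (G r * u (t + (- e) *\<^sub>R r)) \<partial>lborel) \<partial>lborel)"
      proof (rule lborel_pair.Fubini_integral[where f="\<lambda>r t. indicator (box a b) t *\<^sub>R (G r * u (t + (- e) *\<^sub>R r))"])
        have iu: "integrable lborel (\<lambda>t. u (t + (- e) *\<^sub>R r))" for r
          using lborel_integrable_affine[OF u, of 1 "(- e) *\<^sub>R r"] by (simp add: add.commute)
        have nu: "(\<integral>t. norm (u (t + (- e) *\<^sub>R r)) \<partial>lborel) = (\<integral>t. norm (u t) \<partial>lborel)" for r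
          by (subst (2) lborel_distr_plus[of "(- e) *\<^sub>R r", symmetric])
            (subst integral_distr, auto simp: add.commute)
        show "integrable (lborel \<Otimes>\<^sub>M lborel) (\<lambda>(r, t). indicator (box a b) t *\<^sub>R (G r * u (t + (- e) *\<^sub>R r)))"
        proof (rule Bochner_Integration.integrable_bound)
          show "integrable (lborel \<Otimes>\<^sub>M lborel) (\<lambda>(r, t). G r * u (t + (- e) *\<^sub>R r))"
          proof (rule lborel_pair.Fubini_integrable)
            show "integrable lborel (\<lambda>r. \<integral>t. norm (case (r, t) of (r, t) \<Rightarrow> G r * u (t + (- e) *\<^sub>R r)) \<partial>lborel)"
              using G(1) nu by (simp add: norm_mult)
          qed (use iu in auto)
        qed (auto split: split_indicator)
      qed
      also have "\<dots> = (\<integral>r. G r * (\<integral>s. indicator (box a b) (s + e *\<^sub>R r) *\<^sub>R u s \<partial>lborel) \<partial>lborel)"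
      proof (rule Bochner_Integration.integral_cong[OF refl])
        fix r
        have "(\<integral>s. indicator (box a b) (s + e *\<^sub>R r) *\<^sub>R u s \<partial>lborel)
            = (\<integral>t. indicator (box a b) (((- e) *\<^sub>R r + t) + e *\<^sub>R r) *\<^sub>R u ((- e) *\<^sub>R r + t) \<partial>lborel)"
          by (subst (1) lborel_distr_plus[of "(- e) *\<^sub>R r", symmetric]) (subst integral_distr, auto)
        then show "(\<integral>t. indicator (box a b) t *\<^sub>R (G r * u (t + (- e) *\<^sub>R r)) \<partial>lborel)
            = G r * (\<integral>s. indicator (box a b) (s + e *\<^sub>R r) *\<^sub>R u s \<partial>lborel)"
          by (simp add: add.commute mult.commute[of "G r"] flip: integral_mult_right_zero)
      qed
      finally show ?thesis by (simp add: e_def)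
    qed
    have "(\<lambda>n. \<integral>r. G r * (\<integral>s. ?E n r s \<partial>lborel) \<partial>lborel)
        \<longlonglongrightarrow> (\<integral>r. G r * (\<integral>s. indicator (box a b) s *\<^sub>R u s \<partial>lborel) \<partial>lborel)"
    proof (rule integral_dominated_convergence[where w="\<lambda>r. norm (G r) * (\<integral>s. norm (u s) \<partial>lborel)"])
      show "AE r in lborel. (\<lambda>n. G r * (\<integral>s. ?E n r s \<partial>lborel))
          \<longlonglongrightarrow> G r * (\<integral>s. indicator (box a b) s *\<^sub>R u s \<partial>lborel)"
      proof (intro AE_I2 tendsto_mult tendsto_const)
        fix r :: 'a
        show "(\<lambda>n. \<integral>s. ?E n r s \<partial>lborel)
            \<longlonglongrightarrow> (\<integral>s. indicator (box a b) s *\<^sub>R u s \<partial>lborel)"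
        proof (rule integral_dominated_convergence[where w="\<lambda>s. norm (u s)"])
          show "AE s in lborel. (\<lambda>n. ?E n r s)
              \<longlonglongrightarrow> indicator (box a b) s *\<^sub>R u s"
            using tendsto_indicator_box_AE[OF inv, of a b r]
            by eventually_elim (intro tendsto_intros)
        qed (use u in \<open>auto split: split_indicator\<close>)
      qed
      show "AE r in lborel. norm (G r * (\<integral>s. ?E n r s \<partial>lborel))
          \<le> norm (G r) * (\<integral>s. norm (u s) \<partial>lborel)" for n
      proof (intro AE_I2, unfold norm_mult, intro mult_left_mono norm_ge_zero)
        fix r :: 'a
        have "norm (\<integral>s. ?E n r s \<partial>lborel)
            \<le> (\<integral>s. norm (?E n r s) \<partial>lborel)"
          by (rule integral_norm_bound)
        also have "\<dots> \<le> (\<integral>s. norm (u s) \<partial>lborel)"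
          by (rule integral_mono') (use u in \<open>auto split: split_indicator\<close>)
        finally show "norm (\<integral>s. ?E n r s \<partial>lborel) \<le> (\<integral>s. norm (u s) \<partial>lborel)" .
      qed
    qed (use G(1) in auto)
    then show "?I \<longlonglongrightarrow> (\<integral>t. indicator (box a b) t *\<^sub>R u t \<partial>lborel)"
      by (simp only: I integral_mult_left_zero G(2) mult_1)
  qed
  \<comment> \<open>The inverse transform is bounded but need not be integrable a priori, hence the cut-off to boxes.\<close>
  define B where "B n = box (- real n *\<^sub>R One) (real n *\<^sub>R (One::'a))" for n
  have "AE t in lborel. \<forall>n. indicator (B n) t *\<^sub>R (u t - k t) = 0"
    unfolding AE_all_countable
  proof
    fix n
    have iu: "integrable lborel (\<lambda>t. indicator (box a b) t *\<^sub>R u t)" for a b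
      by (rule integrable_mult_indicator[OF _ u]) simp
    have ik: "integrable lborel (\<lambda>t. indicator (box a b) t *\<^sub>R k t)" for a b
    proof (rule Bochner_Integration.integrable_bound[where f="\<lambda>t. M * indicator (box a b) t"])
      show "integrable lborel (\<lambda>t. M * indicator (box a b) t)"
        using box_fin[of a b] by (intro integrable_mult_right) (simp add: integrable_indicator_iff)
    qed (use M_bound in \<open>auto split: split_indicator intro: order_trans[OF _ abs_ge_self]\<close>)
    show "AE t in lborel. indicator (B n) t *\<^sub>R (u t - k t) = 0"
    proof (rule AE_zero_if_box_integrals_zero)
      show "integrable lborel (\<lambda>t. indicator (B n) t *\<^sub>R (u t - k t))"
        unfolding B_def scaleR_diff_right by (intro Bochner_Integration.integrable_diff iu ik)
      fix a b :: 'a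
      obtain a' b' where ab: "box a b \<inter> B n = box a' b'"
        unfolding B_def box_Int_box by blast
      have "indicator (box a b) t *\<^sub>R indicator (B n) t *\<^sub>R (u t - k t)
          = indicator (box a' b') t *\<^sub>R u t - indicator (box a' b') t *\<^sub>R k t" for t
        unfolding ab[symmetric] by (auto split: split_indicator)
      then show "(\<integral>t. indicator (box a b) t *\<^sub>R indicator (B n) t *\<^sub>R (u t - k t) \<partial>lborel) = 0"
        using iu ik box by simp
    qed
  qed
  then show ?thesis
  proof eventually_elim
    fix t assume t: "\<forall>n. indicator (B n) t *\<^sub>R (u t - k t) = 0"
    obtain n where "t \<in> B n"
    proof -
      have "t \<in> (\<Union>n::nat. B n)" using UN_box_eq_UNIV[where 'a='a] by (simp add: B_def)
      then show ?thesis using that by blast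
    qed
    with t have "u t - k t = 0" by (auto dest!: spec[of _ n])
    then show "u t = (\<integral>\<omega>. fourier u \<omega> * character (\<omega> \<bullet> t) \<partial>lborel)" by (simp add: k_def)
  qed
qed

text \<open>Inserting the inversion formula for \<open>u\<close> needs integrability of \<open>fourier u\<close> only; \<open>fourier v\<close> is merely
  bounded, as it is for the short-time Fourier transform of a general square integrable function.\<close>

theorem parseval:
  fixes u v :: "'a::euclidean_space \<Rightarrow> complex"
  assumes u: "integrable lborel u" and fu: "integrable lborel (fourier u)" and v: "integrable lborel v"
  shows "(\<integral>\<omega>. fourier u \<omega> * cnj (fourier v \<omega>) \<partial>lborel) = (\<integral>t. u t * cnj (v t) \<partial>lborel)"
proof -
  have [measurable]: "u \<in> borel_measurable borel" "v \<in> borel_measurable borel" "fourier u \<in> borel_measurable borel"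
    using u v fu by auto
  have [measurable]: "cnj \<in> borel_measurable borel"
    by (intro borel_measurable_continuous_onI continuous_intros)
  have "(\<integral>\<omega>. fourier u \<omega> * cnj (fourier v \<omega>) \<partial>lborel)
      = (\<integral>\<omega>. (\<integral>t. fourier u \<omega> * character (\<omega> \<bullet> t) * cnj (v t) \<partial>lborel) \<partial>lborel)"
    unfolding fourier_def[of v]
    by (simp add: cnj_character mult_ac flip: Bochner_Integration.integral_cnj integral_mult_right_zero)
  also have "\<dots> = (\<integral>t. (\<integral>\<omega>. fourier u \<omega> * character (\<omega> \<bullet> t) * cnj (v t) \<partial>lborel) \<partial>lborel)"
  proof (rule lborel_pair.Fubini_integral[where f="\<lambda>t \<omega>. fourier u \<omega> * character (\<omega> \<bullet> t) * cnj (v t)"],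
      rule integrable_pair_bound)
    show "integrable lborel (\<lambda>t. norm (v t))" "integrable lborel (\<lambda>\<omega>. norm (fourier u \<omega>))"
      using v fu by simp_all
  qed (simp_all add: norm_mult)
  also have "\<dots> = (\<integral>t. (\<integral>\<omega>. fourier u \<omega> * character (\<omega> \<bullet> t) \<partial>lborel) * cnj (v t) \<partial>lborel)"
    by simp
  also have "\<dots> = (\<integral>t. u t * cnj (v t) \<partial>lborel)"
    using fourier_inversion[OF u fu] by (intro integral_cong_AE) auto
  finally show ?thesis .
qed

section \<open>The short-time Fourier transform with Gaussian window\<close>

definition gauss_fun :: "'a::euclidean_space \<Rightarrow> complex" where
  "gauss_fun x = complex_of_real (2 powr (- real DIM('a) / 4) * exp (- pi * (x \<bullet> x)))"

lemma square_integrable_gauss_fun: "square_integrable gauss_fun"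
  unfolding gauss_fun_def by (rule square_integrable_gaussian)

lemma gaussian_abs_L2: "gaussian = abs_L2 gauss_fun"
  by (simp add: gaussian_def gauss_fun_def[abs_def] map_fun_def)

lemma cnj_gauss_fun [simp]: "cnj (gauss_fun x) = gauss_fun x"
  by (simp add: gauss_fun_def)

lemma borel_measurable_gauss_fun [measurable]: "(gauss_fun :: 'a::euclidean_space \<Rightarrow> complex) \<in> borel_measurable borel"
  using square_integrable_gauss_fun[where 'a='a] by (simp add: square_integrable_def)

lemma borel_measurable_cnj [measurable]: "cnj \<in> borel_measurable borel"
  by (intro borel_measurable_continuous_onI continuous_intros)

lemma stft_abs_L2:
  assumes "square_integrable F" "square_integrable G"
  shows "stft (abs_L2 G) (abs_L2 F) (x, \<omega>) = fourier (\<lambda>t. F t * cnj (G (t - x))) \<omega>"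
  unfolding stft_def tf_shift_abs_L2[OF assms(2)] fourier_def
    cinner_abs_L2[OF assms(1) square_integrable_tf_shift[OF assms(2)]]
  by (simp add: cnj_character mult_ac)

lemma integrable_windowed:
  assumes "square_integrable F" "square_integrable G"
  shows "integrable lborel (\<lambda>t. F t * cnj (G (t - x)))"
  using assms by (intro integrable_inner_L2 square_integrable_translate)

lemma borel_measurable_stft [measurable]: "stft g f \<in> borel_measurable borel"
proof -
  obtain F where F: "f = abs_L2 F" "square_integrable F" by (rule abs_L2_cases)
  obtain G where G: "g = abs_L2 G" "square_integrable G" by (rule abs_L2_cases)
  have [measurable]: "F \<in> borel_measurable borel" "G \<in> borel_measurable borel"
    using F G by (simp_all add: square_integrable_def)
  have "stft g f = (\<lambda>X. \<integral>t. F t * cnj (G (t - fst X)) * character (- (snd X \<bullet> t)) \<partial>lborel)"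
    by (auto simp: fun_eq_iff F G stft_abs_L2 fourier_def)
  then show ?thesis
    unfolding borel_prod[symmetric] by simp
qed

lemma norm_stft_le: "norm (stft g f X) \<le> norm f * norm g"
  unfolding stft_def using norm_cinner_le[of f "blinfun_apply (tf_shift X) g"] by simp

text \<open>Measurability of \<open>V\<^sub>\<phi> f\<close> turns the iterated integral of the definition into an integral over phase space.\<close>

lemma feichtinger_iff_integrable: "f \<in> feichtinger \<longleftrightarrow> integrable lborel (stft gaussian f)"
proof -
  have m: "(\<lambda>X. ennreal (norm (stft gaussian f X))) \<in> borel_measurable (lborel \<Otimes>\<^sub>M lborel)"
    unfolding lborel_prod by simp
  have "(\<integral>\<^sup>+x. \<integral>\<^sup>+\<omega>. ennreal (norm (stft gaussian f (x, \<omega>))) \<partial>lborel \<partial>lborel)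
      = (\<integral>\<^sup>+X. ennreal (norm (stft gaussian f X)) \<partial>lborel)"
    using lborel.nn_integral_fst[OF m] by (simp add: lborel_prod)
  then show ?thesis by (simp add: feichtinger_def integrable_iff_bounded)
qed

lemma norm_gaussian: "complex_of_real ((norm (gaussian :: 'a::euclidean_space L2))\<^sup>2)
    = (\<integral>x. gauss_fun (x::'a) * gauss_fun x \<partial>lborel)"
  unfolding cinner_self[symmetric] gaussian_abs_L2
  by (simp add: cinner_abs_L2 square_integrable_gauss_fun)

lemma gauss_fun_nonzero [simp]: "gauss_fun x \<noteq> 0"
  by (simp add: gauss_fun_def)

lemma integral_gauss_fun_shift:
  "integrable lborel (\<lambda>x. gauss_fun (t - x) * gauss_fun (t - x))"
  "(\<integral>x. gauss_fun (t - x :: 'a::euclidean_space) * gauss_fun (t - x) \<partial>lborel)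
    = complex_of_real ((norm (gaussian :: 'a L2))\<^sup>2)"
proof -
  have i: "integrable lborel (\<lambda>x::'a. gauss_fun x * gauss_fun x)"
    using integrable_inner_L2[OF square_integrable_gauss_fun square_integrable_gauss_fun] by simp
  show "integrable lborel (\<lambda>x. gauss_fun (t - x) * gauss_fun (t - x))"
    using lborel_integrable_affine[OF i, of "-1" t] by simp
  show "(\<integral>x. gauss_fun (t - x :: 'a) * gauss_fun (t - x) \<partial>lborel) = complex_of_real ((norm (gaussian :: 'a L2))\<^sup>2)"
    unfolding norm_gaussian using lborel_integral_affine[of "\<lambda>x::'a. gauss_fun x * gauss_fun x" "-1" t] by simp
qed

text \<open>Moyal's identity for the Gaussian window: Parseval in the frequency variable for almost every
  time shift, followed by integration over the time shift.\<close>

theorem moyal: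
  fixes f g :: "'a::euclidean_space L2"
  assumes f: "f \<in> feichtinger"
  shows "integrable lborel (\<lambda>X. stft gaussian f X * cnj (stft gaussian g X))"
    and "(\<integral>X. stft gaussian f X * cnj (stft gaussian g X) \<partial>lborel)
      = of_real ((norm (gaussian :: 'a L2))\<^sup>2) * cinner f g"
proof -
  let ?S = "\<lambda>X. stft gaussian f X * cnj (stft gaussian g X)"
  obtain F where F: "f = abs_L2 F" "square_integrable F" by (rule abs_L2_cases)
  obtain G where G: "g = abs_L2 G" "square_integrable G" by (rule abs_L2_cases)
  have [measurable]: "F \<in> borel_measurable borel" "G \<in> borel_measurable borel"
    using F G by (simp_all add: square_integrable_def)
  have f': "integrable lborel (stft gaussian f)" using f by (simp add: feichtinger_iff_integrable)
  show int: "integrable lborel ?S"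
  proof (rule Bochner_Integration.integrable_bound)
    show "integrable lborel (\<lambda>X. stft gaussian f X * of_real (norm g * norm (gaussian :: 'a L2)))"
      using f' by (rule integrable_mult_left)
    show "AE X in lborel. norm (?S X) \<le> norm (stft gaussian f X * of_real (norm g * norm (gaussian :: 'a L2)))"
      by (intro AE_I2) (auto simp: norm_mult intro!: mult_left_mono order_trans[OF norm_stft_le])
  qed simp
  let ?P = "\<lambda>t x. (F t * cnj (G t)) * (gauss_fun (t - x) * gauss_fun (t - x))"
  have FG: "integrable lborel (\<lambda>t. F t * cnj (G t))" using F G by (intro integrable_inner_L2)
  have "(\<integral>X. ?S X \<partial>lborel) = (\<integral>x. (\<integral>\<omega>. ?S (x, \<omega>) \<partial>lborel) \<partial>lborel)"
    using lborel_pair.integral_fst'[of ?S] int by (simp add: lborel_prod)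
  also have "\<dots> = (\<integral>x. (\<integral>t. ?P t x \<partial>lborel) \<partial>lborel)"
  proof (rule integral_cong_AE)
    have m: "?S \<in> borel_measurable (lborel \<Otimes>\<^sub>M lborel)" unfolding lborel_prod by measurable
    show "(\<lambda>x. \<integral>\<omega>. ?S (x, \<omega>) \<partial>lborel) \<in> borel_measurable lborel"
      using m by measurable
    have "AE x in lborel. integrable lborel (\<lambda>\<omega>. stft gaussian f (x, \<omega>))"
      using lborel_pair.AE_integrable_fst'[of "stft gaussian f"] f' by (simp add: lborel_prod)
    then show "AE x in lborel. (\<integral>\<omega>. ?S (x, \<omega>) \<partial>lborel) = (\<integral>t. ?P t x \<partial>lborel)"
    proof eventually_elim
      fix x assume x: "integrable lborel (\<lambda>\<omega>. stft gaussian f (x, \<omega>))"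
      let ?u = "\<lambda>t. F t * cnj (gauss_fun (t - x))" and ?v = "\<lambda>t. G t * cnj (gauss_fun (t - x))"
      have uv: "integrable lborel ?u" "integrable lborel ?v"
        by (intro integrable_windowed F G square_integrable_gauss_fun)+
      have S: "stft gaussian f (x, \<omega>) = fourier ?u \<omega>" "stft gaussian g (x, \<omega>) = fourier ?v \<omega>" for \<omega>
        unfolding F G gaussian_abs_L2
        by (simp_all only: stft_abs_L2 F G square_integrable_gauss_fun)
      have "(\<integral>\<omega>. ?S (x, \<omega>) \<partial>lborel) = (\<integral>t. ?u t * cnj (?v t) \<partial>lborel)"
        unfolding S by (rule parseval) (use uv x in \<open>auto simp: S[abs_def]\<close>)
      then show "(\<integral>\<omega>. ?S (x, \<omega>) \<partial>lborel) = (\<integral>t. ?P t x \<partial>lborel)"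
        by (simp add: mult_ac)
    qed
  qed measurable
  also have "\<dots> = (\<integral>t. (\<integral>x. ?P t x \<partial>lborel) \<partial>lborel)"
  proof (rule lborel_pair.Fubini_integral[where f="?P"], rule lborel_pair.Fubini_integrable)
    have "(\<integral>x. norm (gauss_fun (t - x) * gauss_fun (t - x)) \<partial>lborel) = (norm (gaussian :: 'a L2))\<^sup>2" for t :: 'a
    proof -
      have "norm (gauss_fun (t - x) * gauss_fun (t - x)) = Re (gauss_fun (t - x) * gauss_fun (t - x))" for x
        by (simp add: gauss_fun_def norm_mult)
      then have "(\<integral>x. norm (gauss_fun (t - x) * gauss_fun (t - x)) \<partial>lborel)
          = (\<integral>x. Re (gauss_fun (t - x) * gauss_fun (t - x)) \<partial>lborel)"
        by (intro Bochner_Integration.integral_cong refl)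
      also have "\<dots> = Re (\<integral>x. gauss_fun (t - x) * gauss_fun (t - x) \<partial>lborel)"
        by (rule integral_Re[OF integral_gauss_fun_shift(1)])
      finally show ?thesis by (simp only: integral_gauss_fun_shift(2) Re_complex_of_real)
    qed
    then show "integrable lborel (\<lambda>t. \<integral>x. norm (case (t, x) of (t, x) \<Rightarrow> ?P t x) \<partial>lborel)"
      using FG by (simp add: norm_mult[of "F _ * cnj (G _)"] integrable_norm)
    show "AE t in lborel. integrable lborel (\<lambda>x. case (t, x) of (t, x) \<Rightarrow> ?P t x)"
      unfolding prod.case by (intro AE_I2 integrable_mult_right integral_gauss_fun_shift(1))
  qed measurable
  also have "\<dots> = of_real ((norm (gaussian :: 'a L2))\<^sup>2) * cinner f g"
    using F G by (simp add: integral_gauss_fun_shift(2) cinner_abs_L2 mult.commute)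
  finally show "(\<integral>X. ?S X \<partial>lborel) = of_real ((norm (gaussian :: 'a L2))\<^sup>2) * cinner f g" .
qed

lemma norm_gaussian_pos: "norm (gaussian :: 'a::euclidean_space L2) > 0"
proof -
  have "gaussian \<noteq> (0 :: 'a L2)"
  proof
    assume "gaussian = (0 :: 'a L2)"
    then have "L2_rel gauss_fun (\<lambda>_::'a. 0)"
      unfolding gaussian_abs_L2 zero_L2_def
      using Quotient3_rel[OF Quotient3_L2, of gauss_fun "\<lambda>_. 0"] square_integrable_gauss_fun
      by (auto simp: L2_rel_def square_integrable_0)
    then have "AE x::'a in lborel. False" by (auto simp: L2_rel_def)
    then have "emeasure lborel (UNIV :: 'a set) = 0"
      by (simp add: AE_iff_null null_sets_def)
    then show False by (simp add: emeasure_lborel_UNIV)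
  qed
  then show ?thesis by simp
qed

text \<open>Completing the square turns the integrand into a Gaussian of width \<open>1/\<surd>2\<close> centred at \<open>x/2\<close>.\<close>

lemma norm_stft_gaussian:
  fixes X :: "'a::euclidean_space \<times> 'a"
  shows "norm (stft gaussian gaussian X) = (norm (gaussian :: 'a L2))\<^sup>2 * exp (- (pi / 2 * (norm X)\<^sup>2))"
proof -
  define c where "c = (2 powr (- real DIM('a) / 4))\<^sup>2"
  have val: "norm (stft gaussian gaussian X) = c / sqrt 2 ^ DIM('a) * exp (- (pi / 2 * (norm X)\<^sup>2))" for X :: "'a \<times> 'a"
  proof -
    obtain x \<omega> where X: "X = (x, \<omega>)" by (cases X)
    let ?w = "\<lambda>t. gauss_fun t * cnj (gauss_fun (t - x)) * character (- (\<omega> \<bullet> t))"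
    have shifted: "?w ((1/2) *\<^sub>R x + 1 *\<^sub>R t) = (of_real (c * exp (- (pi / 2 * (x \<bullet> x)))) * character (- (\<omega> \<bullet> ((1/2) *\<^sub>R x))))
        * (of_real (exp (- (pi * (sqrt 2)\<^sup>2 * (t \<bullet> t)))) * character ((-\<omega>) \<bullet> t))" for t
    proof -
      let ?y = "(1/2) *\<^sub>R x + t"
      have sq: "?y \<bullet> ?y + (?y - x) \<bullet> (?y - x) = (x \<bullet> x) / 2 + 2 * (t \<bullet> t)"
      proof -
        have "?y - x = t - (1/2) *\<^sub>R x"
          by (metis (no_types, lifting) add.commute add_diff_eq diff_add_cancel field_sum_of_halves diff_diff_add scaleR_left_distrib scaleR_one add_diff_cancel_left diff_minus_eq_add minus_diff_eq)
        then show ?thesis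
          by (simp add: inner_add_left inner_add_right inner_diff_left inner_diff_right inner_commute field_simps)
      qed
      have "gauss_fun ?y * cnj (gauss_fun (?y - x)) = of_real (c * (exp (- pi * (?y \<bullet> ?y)) * exp (- pi * ((?y - x) \<bullet> (?y - x)))))"
        by (simp add: gauss_fun_def c_def power2_eq_square)
      also have "exp (- pi * (?y \<bullet> ?y)) * exp (- pi * ((?y - x) \<bullet> (?y - x))) = exp (- pi * (?y \<bullet> ?y + (?y - x) \<bullet> (?y - x)))"
        by (simp add: exp_add[symmetric] distrib_left)
      also have "\<dots> = exp (- (pi / 2 * (x \<bullet> x))) * exp (- (pi * (sqrt 2)\<^sup>2 * (t \<bullet> t)))"
        unfolding sq by (simp add: exp_add[symmetric] distrib_left)
      finally have e: "gauss_fun ?y * cnj (gauss_fun (?y - x))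
         = of_real (c * (exp (- (pi / 2 * (x \<bullet> x))) * exp (- (pi * (sqrt 2)\<^sup>2 * (t \<bullet> t)))))" .
      have ch: "character (- (\<omega> \<bullet> ?y)) = character (- (\<omega> \<bullet> ((1/2) *\<^sub>R x))) * character ((-\<omega>) \<bullet> t)"
        by (simp add: character_add[symmetric] inner_add_right)
      show ?thesis unfolding scaleR_one e ch by simp
    qed
    have "stft gaussian gaussian X = (\<integral>t. ?w t \<partial>lborel)"
      unfolding X gaussian_abs_L2 by (simp add: stft_abs_L2 square_integrable_gauss_fun fourier_def)
    also have "\<dots> = of_real (\<bar>1\<bar> ^ DIM('a)) * (\<integral>t. ?w ((1/2) *\<^sub>R x + 1 *\<^sub>R t) \<partial>lborel)"
      by (rule lborel_integral_affine) auto
    also have "\<dots> = (of_real (c * exp (- (pi / 2 * (x \<bullet> x)))) * character (- (\<omega> \<bullet> ((1/2) *\<^sub>R x))))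
        * of_real (exp (- (pi * ((-\<omega>) \<bullet> (-\<omega>)) / (sqrt 2)\<^sup>2)) / sqrt 2 ^ DIM('a))"
      unfolding shifted integral_mult_right_zero
      by (subst gaussian_fourier(2)) auto
    finally have "norm (stft gaussian gaussian X) = c * exp (- (pi / 2 * (x \<bullet> x))) * (exp (- (pi * (\<omega> \<bullet> \<omega>) / 2)) / sqrt 2 ^ DIM('a))"
      by (simp add: norm_mult norm_divide c_def norm_power)
    also have "\<dots> = c / sqrt 2 ^ DIM('a) * (exp (- (pi / 2 * (x \<bullet> x))) * exp (- (pi * (\<omega> \<bullet> \<omega>) / 2)))"
      by simp
    also have "exp (- (pi / 2 * (x \<bullet> x))) * exp (- (pi * (\<omega> \<bullet> \<omega>) / 2)) = exp (- (pi / 2 * (norm X)\<^sup>2))"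
      by (simp add: X power2_norm_eq_inner exp_add[symmetric] distrib_left inner_prod_def)
    finally show ?thesis .
  qed
  have "norm (stft gaussian gaussian (0 :: 'a \<times> 'a)) = (norm (gaussian :: 'a L2))\<^sup>2"
    by (simp add: stft_def cinner_self norm_power)
  then have "c / sqrt 2 ^ DIM('a) = (norm (gaussian :: 'a L2))\<^sup>2"
    using val[of 0] by simp
  then show ?thesis using val[of X] by simp
qed

lemma stft_add: "stft g (f + h) X = stft g f X + stft g h X"
  by (simp add: stft_def cinner_add_left)

lemma stft_scaleC: "stft g (c *\<^sub>C f) X = c * stft g f X"
  by (simp add: stft_def cinner_scaleC_left)

lemma norm_stft_tf_shift:
  "norm (stft g (blinfun_apply (tf_shift X) f) Y) = norm (stft g f (Y - X))"
  using stft_tf_shift[of g X f "Y - X"] by (simp add: norm_mult)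

text \<open>Two consequences of Moyal's identity: the reproducing formula for the Gaussian window, and the
  change of window.\<close>

lemma stft_reproducing_bound:
  fixes f :: "'a::euclidean_space L2"
  assumes f: "f \<in> feichtinger"
  shows "norm (stft gaussian f X) \<le> (\<integral>Y. norm (stft gaussian f Y) * exp (- (pi / 2 * (norm (Y - X))\<^sup>2)) \<partial>lborel)"
proof -
  define C where "C = (norm (gaussian :: 'a L2))\<^sup>2"
  have C: "C > 0" unfolding C_def using norm_gaussian_pos[where 'a='a] by simp
  let ?g = "blinfun_apply (tf_shift X) gaussian"
  have g: "norm (stft gaussian ?g Y) = C * exp (- (pi / 2 * (norm (Y - X))\<^sup>2))" for Y
    by (simp add: norm_stft_tf_shift norm_stft_gaussian C_def)
  have "C * norm (stft gaussian f X) = norm (of_real C * cinner f ?g)"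
    using C by (simp add: stft_def norm_mult)
  also have "\<dots> = norm (\<integral>Y. stft gaussian f Y * cnj (stft gaussian ?g Y) \<partial>lborel)"
    using moyal(2)[OF f, of ?g] by (simp add: C_def)
  also have "\<dots> \<le> (\<integral>Y. norm (stft gaussian f Y * cnj (stft gaussian ?g Y)) \<partial>lborel)"
    by (rule integral_norm_bound)
  also have "\<dots> = C * (\<integral>Y. norm (stft gaussian f Y) * exp (- (pi / 2 * (norm (Y - X))\<^sup>2)) \<partial>lborel)"
    by (simp add: norm_mult g mult.left_commute)
  finally show ?thesis using C by simp
qed

lemma stft_change_window_bound:
  fixes f g :: "'a::euclidean_space L2"
  assumes g: "g \<in> feichtinger"
  shows "(norm (gaussian :: 'a L2))\<^sup>2 * norm (stft g f X)
      \<le> (\<integral>Y. norm (stft gaussian g Y) * norm (stft gaussian f (X + Y)) \<partial>lborel)"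
proof -
  \<comment> \<open>The vector \<open>\<pi>(X)\<^sup>* f\<close>, so that \<open>V\<^sub>g f(X)\<close> is conjugate to \<open>\<langle>g, \<pi>(X)\<^sup>* f\<rangle>\<close>.\<close>
  let ?h = "cnj (cocycle X (-X)) *\<^sub>C blinfun_apply (tf_shift (-X)) f"
  have h: "norm (stft gaussian ?h Y) = norm (stft gaussian f (X + Y))" for Y
    by (simp add: stft_scaleC norm_mult norm_stft_tf_shift add.commute)
  have "(norm (gaussian :: 'a L2))\<^sup>2 * norm (stft g f X)
      = norm (of_real ((norm (gaussian :: 'a L2))\<^sup>2) * cinner g ?h)"
    using cinner_commute[of f "blinfun_apply (tf_shift X) g"]
    by (simp add: stft_def norm_mult cinner_tf_shift_left[symmetric] norm_power)
  also have "\<dots> = norm (\<integral>Y. stft gaussian g Y * cnj (stft gaussian ?h Y) \<partial>lborel)"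
    using moyal(2)[OF g, of ?h] by simp
  also have "\<dots> \<le> (\<integral>Y. norm (stft gaussian g Y * cnj (stft gaussian ?h Y)) \<partial>lborel)"
    by (rule integral_norm_bound)
  finally show ?thesis by (simp add: norm_mult h)
qed

section \<open>Feichtinger's algebra is invariant under \<open>\<ell>\<^sup>1\<close> sums of time-frequency shifts\<close>

lemma feichtinger_0: "(0 :: 'a::euclidean_space L2) \<in> feichtinger"
proof -
  have "stft gaussian (0 :: 'a L2) = (\<lambda>_. 0)"
  proof
    fix X show "stft gaussian (0 :: 'a L2) X = 0" using stft_scaleC[of gaussian 0 0 X] by simp
  qed
  then show ?thesis by (simp add: feichtinger_iff_integrable)
qed

lemma feichtinger_add: "f \<in> feichtinger \<Longrightarrow> g \<in> feichtinger \<Longrightarrow> f + g \<in> feichtinger"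
  unfolding feichtinger_iff_integrable stft_add[abs_def] by simp

lemma feichtinger_scaleC: "f \<in> feichtinger \<Longrightarrow> c *\<^sub>C f \<in> feichtinger"
  unfolding feichtinger_iff_integrable stft_scaleC[abs_def] by simp

lemma nn_integral_stft_tf_shift:
  "(\<integral>\<^sup>+Y. ennreal (norm (stft g (blinfun_apply (tf_shift X) f) Y)) \<partial>lborel)
    = (\<integral>\<^sup>+Y. ennreal (norm (stft g f Y)) \<partial>lborel)"
  unfolding norm_stft_tf_shift
  by (subst (2) lborel_distr_plus[of "-X", symmetric]) (simp add: nn_integral_distr)

text \<open>The modulus of the transform of the sum is at most the sum of the moduli, and each term has integral
  \<open>\<bar>a\<^sub>i\<bar>\<close> times that of \<open>V\<^sub>\<phi> g\<close>; Tonelli over the countable index set finishes. The sum of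
  moduli is an \<open>\<integral>\<^sup>+\<close> over counting measure, since it may be infinite at individual points.\<close>

lemma feichtinger_has_sum:
  fixes a :: "'b \<Rightarrow> complex" and p :: "'b \<Rightarrow> 'a::euclidean_space \<times> 'a"
  assumes g: "g \<in> feichtinger" and a: "(\<lambda>i. norm (a i)) summable_on I" and I: "countable I"
    and s: "((\<lambda>i. a i *\<^sub>C blinfun_apply (tf_shift (p i)) g) has_sum s) I"
  shows "s \<in> feichtinger"
proof -
  let ?h = "\<lambda>i. a i *\<^sub>C blinfun_apply (tf_shift (p i)) g"
  define N where "N = (\<integral>\<^sup>+Y. ennreal (norm (stft gaussian g Y)) \<partial>lborel)"
  have N: "N < \<infinity>" using g by (simp add: N_def feichtinger_iff_integrable integrable_iff_bounded)
  have pointwise: "ennreal (norm (stft gaussian s Y)) \<le> (\<integral>\<^sup>+i. ennreal (norm (stft gaussian (?h i) Y)) \<partial>count_space I)" for Y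
  proof -
    have "((\<lambda>i. stft gaussian (?h i) Y) has_sum stft gaussian s Y) I"
      unfolding stft_def by (rule has_sum_bounded_linear[OF bounded_linear_cinner_left s])
    then have "((\<lambda>J. ennreal (norm (\<Sum>i\<in>J. stft gaussian (?h i) Y))) \<longlongrightarrow> ennreal (norm (stft gaussian s Y))) (finite_subsets_at_top I)"
      unfolding has_sum_def by (intro tendsto_intros)
    then show ?thesis
    proof (rule tendsto_upperbound)
      show "\<forall>\<^sub>F J in finite_subsets_at_top I. ennreal (norm (\<Sum>i\<in>J. stft gaussian (?h i) Y))
          \<le> (\<integral>\<^sup>+i. ennreal (norm (stft gaussian (?h i) Y)) \<partial>count_space I)"
      proof (rule eventually_finite_subsets_at_top_weakI)
        fix J assume J: "finite J" "J \<subseteq> I"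
        have "ennreal (norm (\<Sum>i\<in>J. stft gaussian (?h i) Y)) \<le> ennreal (\<Sum>i\<in>J. norm (stft gaussian (?h i) Y))"
          by (intro ennreal_leI norm_sum)
        also have "\<dots> = (\<Sum>i\<in>J. ennreal (norm (stft gaussian (?h i) Y)))"
          by (simp add: sum_ennreal)
        also have "\<dots> = (\<integral>\<^sup>+i. ennreal (norm (stft gaussian (?h i) Y)) \<partial>count_space J)"
          using J by (simp add: nn_integral_count_space_finite)
        also have "\<dots> \<le> (\<integral>\<^sup>+i. ennreal (norm (stft gaussian (?h i) Y)) \<partial>count_space I)"
          using J by (subst (1 2) nn_integral_count_space_indicator)
            (auto intro!: nn_integral_mono split: split_indicator)
        finally show "ennreal (norm (\<Sum>i\<in>J. stft gaussian (?h i) Y))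
          \<le> (\<integral>\<^sup>+i. ennreal (norm (stft gaussian (?h i) Y)) \<partial>count_space I)" .
      qed
    qed simp
  qed
  have "(\<integral>\<^sup>+Y. ennreal (norm (stft gaussian s Y)) \<partial>lborel)
      \<le> (\<integral>\<^sup>+Y. (\<integral>\<^sup>+i. ennreal (norm (stft gaussian (?h i) Y)) \<partial>count_space I) \<partial>lborel)"
    by (intro nn_integral_mono pointwise)
  also have "\<dots> = (\<integral>\<^sup>+i. (\<integral>\<^sup>+Y. ennreal (norm (stft gaussian (?h i) Y)) \<partial>lborel) \<partial>count_space I)"
    by (rule nn_integral_count_space_nn_integral[OF I]) auto
  also have "\<dots> = (\<integral>\<^sup>+i. ennreal (norm (a i)) * N \<partial>count_space I)"
    by (simp add: stft_scaleC norm_mult ennreal_mult nn_integral_cmult nn_integral_stft_tf_shift N_def)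
  also have "\<dots> = (\<integral>\<^sup>+i. ennreal (norm (a i)) \<partial>count_space I) * N"
    by (rule nn_integral_multc) auto
  also have "\<dots> < \<infinity>"
  proof -
    have "integrable (count_space I) a"
      using a abs_summable_equivalent[of a I] by (simp add: Infinite_Set_Sum.abs_summable_on_def)
    then show ?thesis using N by (simp add: integrable_iff_bounded ennreal_mult_less_top)
  qed
  finally show ?thesis
    by (simp add: feichtinger_iff_integrable integrable_iff_bounded)
qed

section \<open>Sampling on a uniformly discrete subgroup\<close>

text \<open>Balls of radius \<open>r\<close> around points at mutual distance \<open>2r\<close> are disjoint.\<close>

lemma sum_disjoint_balls_le:
  fixes h :: "'b::euclidean_space \<Rightarrow> real"
  assumes F: "finite F" and sep: "\<And>x y. x \<in> F \<Longrightarrow> y \<in> F \<Longrightarrow> x \<noteq> y \<Longrightarrow> 2 * r \<le> dist x y"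
    and h: "integrable lborel h" "\<And>y. 0 \<le> h y"
  shows "(\<Sum>x\<in>F. \<integral>y. indicator (ball x r) y * h y \<partial>lborel) \<le> (\<integral>y. h y \<partial>lborel)"
proof -
  have i: "integrable lborel (\<lambda>y. indicator (ball x r) y * h y)" for x
    using integrable_mult_indicator[OF _ h(1), of "ball x r"] by simp
  have "(\<Sum>x\<in>F. \<integral>y. indicator (ball x r) y * h y \<partial>lborel) = (\<integral>y. (\<Sum>x\<in>F. indicator (ball x r) y * h y) \<partial>lborel)"
    using i by simp
  also have "\<dots> \<le> (\<integral>y. h y \<partial>lborel)"
  proof (rule integral_mono)
    fix y
    have "(\<Sum>x\<in>F. indicator (ball x r) y :: real) \<le> 1"
    proof (cases "\<exists>x\<in>F. y \<in> ball x r")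
      case True
      then obtain x where x: "x \<in> F" "y \<in> ball x r" by auto
      have "indicator (ball z r) y = (0::real)" if "z \<in> F" "z \<noteq> x" for z
      proof -
        have "y \<notin> ball z r"
          using sep[OF that(1) x(1) that(2)] dist_triangle[of z x y] x(2) by (auto simp: dist_commute)
        then show ?thesis by simp
      qed
      then have "(\<Sum>x\<in>F. indicator (ball x r) y :: real) = (\<Sum>z\<in>{x}. indicator (ball z r) y)"
        using F x(1) by (intro sum.mono_neutral_right) auto
      then show ?thesis by simp
    next
      case False
      then show ?thesis by (subst sum.neutral) auto
    qed
    then have "(\<Sum>x\<in>F. indicator (ball x r) y) * h y \<le> 1 * h y"
      by (intro mult_right_mono h)
    then show "(\<Sum>x\<in>F. indicator (ball x r) y * h y) \<le> h y"
      by (simp add: sum_distrib_right)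
  qed (use i h in auto)
  finally show ?thesis .
qed

text \<open>A Gaussian at \<open>x\<close> is dominated by a wider Gaussian averaged over a ball around \<open>x\<close>, so its sum over
  a separated set is dominated by an integral, uniformly in translations of the set.\<close>

lemma sum_gaussian_separated_le:
  assumes r: "r > 0"
  shows "\<exists>K. \<forall>F. finite F \<longrightarrow> (\<forall>x\<in>F. \<forall>y\<in>F. x \<noteq> y \<longrightarrow> 2 * r \<le> dist x y)
    \<longrightarrow> (\<Sum>x\<in>F. exp (- (pi / 2 * (norm (x::'b::euclidean_space))\<^sup>2))) \<le> K"
proof -
  \<comment> \<open>Half the decay rate absorbs the factor in \<open>\<bar>y\<bar>\<^sup>2 \<le> 2\<bar>x\<bar>\<^sup>2 + 2r\<^sup>2\<close>.\<close>
  define h where "h y = exp (- (pi * (1/2)\<^sup>2 * (y \<bullet> y)))" for y :: 'b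
  have h: "integrable lborel h" unfolding h_def[abs_def] by (rule gaussian_integrable) simp
  define v where "v = measure lborel (ball (0::'b) r)"
  have v: "v > 0" unfolding v_def using r by (rule content_ball_pos)
  define K where "K = exp (pi / 2 * r\<^sup>2) * (\<integral>y. h y \<partial>lborel) / v"
  have bound: "(\<Sum>x\<in>F. exp (- (pi / 2 * (norm x)\<^sup>2))) \<le> K"
    if F: "finite F" "\<And>x y. x \<in> F \<Longrightarrow> y \<in> F \<Longrightarrow> x \<noteq> y \<Longrightarrow> 2 * r \<le> dist x y" for F :: "'b set"
  proof -
    have one: "v * exp (- (pi / 2 * (norm x)\<^sup>2)) \<le> exp (pi / 2 * r\<^sup>2) * (\<integral>y. indicator (ball x r) y * h y \<partial>lborel)" for x
    proof -
      have fin: "emeasure lborel (ball x r) < \<infinity>" by (rule emeasure_bounded_finite) simp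
      have "v = measure lborel (ball x r)"
        unfolding v_def using r by (simp add: content_ball_conv_unit_ball[of r x] content_ball_conv_unit_ball[of r 0])
      then have "v * exp (- (pi / 2 * (norm x)\<^sup>2)) = (\<integral>y. indicator (ball x r) y * exp (- (pi / 2 * (norm x)\<^sup>2)) \<partial>lborel)"
        using fin by simp
      also have "\<dots> \<le> (\<integral>y. exp (pi / 2 * r\<^sup>2) * (indicator (ball x r) y * h y) \<partial>lborel)"
      proof (rule integral_mono)
        show "integrable lborel (\<lambda>y. indicator (ball x r) y * exp (- (pi / 2 * (norm x)\<^sup>2)))"
          using fin by (intro integrable_mult_left) (simp add: integrable_indicator_iff)
        show "integrable lborel (\<lambda>y. exp (pi / 2 * r\<^sup>2) * (indicator (ball x r) y * h y))"
          using integrable_mult_indicator[OF _ h, of "ball x r"] by (intro integrable_mult_right) simp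
        fix y
        show "indicator (ball x r) y * exp (- (pi / 2 * (norm x)\<^sup>2)) \<le> exp (pi / 2 * r\<^sup>2) * (indicator (ball x r) y * h y)"
        proof (cases "y \<in> ball x r")
          case True
          have "norm y \<le> norm x + norm (y - x)"
            using norm_triangle_ineq[of x "y - x"] by simp
          also have "\<dots> \<le> norm x + r"
            using True by (simp add: dist_norm norm_minus_commute)
          finally have "(norm y)\<^sup>2 \<le> (norm x + r)\<^sup>2" by (intro power_mono) auto
          also have "\<dots> \<le> 2 * (norm x)\<^sup>2 + 2 * r\<^sup>2"
            using sum_squares_bound[of "norm x" r] by (simp add: power2_sum)
          finally have "(norm y)\<^sup>2 \<le> 2 * (norm x)\<^sup>2 + 2 * r\<^sup>2" .
          then have "- (pi / 2 * (norm x)\<^sup>2) \<le> pi / 2 * r\<^sup>2 + (- (pi * (1/2)\<^sup>2 * (norm y)\<^sup>2))"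
            using mult_left_mono[of "(norm y)\<^sup>2" "2 * (norm x)\<^sup>2 + 2 * r\<^sup>2" "pi / 4"]
            by (simp add: power2_eq_square algebra_simps)
          then have "exp (- (pi / 2 * (norm x)\<^sup>2)) \<le> exp (pi / 2 * r\<^sup>2) * h y"
            unfolding h_def power2_norm_eq_inner[symmetric] exp_add[symmetric] by simp
          with True show ?thesis by simp
        qed simp
      qed
      finally show ?thesis by simp
    qed
    have "v * (\<Sum>x\<in>F. exp (- (pi / 2 * (norm x)\<^sup>2))) \<le> (\<Sum>x\<in>F. exp (pi / 2 * r\<^sup>2) * (\<integral>y. indicator (ball x r) y * h y \<partial>lborel))"
      unfolding sum_distrib_left by (intro sum_mono one)
    also have "\<dots> = exp (pi / 2 * r\<^sup>2) * (\<Sum>x\<in>F. \<integral>y. indicator (ball x r) y * h y \<partial>lborel)"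
      by (simp add: sum_distrib_left)
    also have "\<dots> \<le> exp (pi / 2 * r\<^sup>2) * (\<integral>y. h y \<partial>lborel)"
      using sum_disjoint_balls_le[OF F h] by (intro mult_left_mono) (auto simp: h_def)
    finally show ?thesis
      unfolding K_def pos_le_divide_eq[OF v] by (simp only: mult.commute)
  qed
  show ?thesis
    by (rule exI[of _ K]) (intro allI impI bound; simp)
qed

text \<open>Volume comparison: the balls around the points fit into a ball of radius \<open>R + r\<close>.\<close>

lemma card_separated_le:
  assumes r: "r > 0" and R: "R \<ge> 0" and F: "finite F" "F \<subseteq> cball (0::'b::euclidean_space) R"
    and sep: "\<And>x y. x \<in> F \<Longrightarrow> y \<in> F \<Longrightarrow> x \<noteq> y \<Longrightarrow> 2 * r \<le> dist x y"
  shows "real (card F) \<le> ((R + r) / r) ^ DIM('b)"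
proof -
  define v where "v = measure lborel (ball (0::'b) 1)"
  have v: "v > 0" unfolding v_def by (rule content_ball_pos) simp
  have fin: "emeasure lborel (ball x s) < \<infinity>" for x :: 'b and s by (rule emeasure_bounded_finite) simp
  let ?h = "indicator (ball (0::'b) (R + r)) :: 'b \<Rightarrow> real"
  have "(\<Sum>x\<in>F. \<integral>y. indicator (ball x r) y * ?h y \<partial>lborel) = (\<Sum>x\<in>F. r ^ DIM('b) * v)"
  proof (rule sum.cong[OF refl])
    fix x assume "x \<in> F"
    then have "norm x \<le> R" using F by auto
    then have "y \<in> ball 0 (R + r)" if "y \<in> ball x r" for y
      using that norm_triangle_ineq[of x "y - x"] by (simp add: dist_norm norm_minus_commute)
    then have "indicator (ball x r) y * ?h y = indicator (ball x r) y" for y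
      by (auto split: split_indicator)
    then have "(\<integral>y. indicator (ball x r) y * ?h y \<partial>lborel) = (\<integral>y. indicator (ball x r) y \<partial>lborel)"
      by (intro Bochner_Integration.integral_cong refl)
    then show "(\<integral>y. indicator (ball x r) y * ?h y \<partial>lborel) = r ^ DIM('b) * v"
      using r by (simp add: v_def content_ball_conv_unit_ball[of r x])
  qed
  then have "real (card F) * (r ^ DIM('b) * v) = (\<Sum>x\<in>F. \<integral>y. indicator (ball x r) y * ?h y \<partial>lborel)"
    by simp
  also have "\<dots> \<le> (\<integral>y. ?h y \<partial>lborel)"
    using fin[of 0 "R + r"] by (intro sum_disjoint_balls_le F sep) (auto simp: integrable_indicator_iff)
  also have "\<dots> = (R + r) ^ DIM('b) * v"
    using R r by (simp add: v_def content_ball_conv_unit_ball[of "R + r" 0])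
  finally show ?thesis using v r by (simp add: power_divide field_simps)
qed

text \<open>The separation is written \<open>2r\<close> because balls of radius \<open>r\<close> around the points are then disjoint.\<close>

locale separated_subgroup =
  fixes \<Lambda> :: "('a::euclidean_space \<times> 'a) set" and r :: real
  assumes zero_mem: "0 \<in> \<Lambda>"
    and diff_mem: "X \<in> \<Lambda> \<Longrightarrow> Y \<in> \<Lambda> \<Longrightarrow> X - Y \<in> \<Lambda>"
    and r_pos: "r > 0"
    and separated: "X \<in> \<Lambda> \<Longrightarrow> Y \<in> \<Lambda> \<Longrightarrow> X \<noteq> Y \<Longrightarrow> 2 * r \<le> dist X Y"

text \<open>In a discrete subgroup the distances between distinct points are bounded below by the distance from
  \<open>0\<close> to the rest of the subgroup.\<close>

lemma tf_lattice_separated: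
  assumes "tf_lattice \<Lambda>"
  shows "\<exists>r. separated_subgroup \<Lambda> r"
proof -
  have z: "0 \<in> \<Lambda>" and d: "\<And>X Y. X \<in> \<Lambda> \<Longrightarrow> Y \<in> \<Lambda> \<Longrightarrow> X - Y \<in> \<Lambda>" and "discrete \<Lambda>"
    using assms by (auto simp: tf_lattice_def)
  then have "0 isolated_in \<Lambda>" by (auto simp: discrete_def)
  then obtain e where e: "e > 0" "ball 0 e \<inter> \<Lambda> = {0}"
  proof -
    from \<open>0 isolated_in \<Lambda>\<close> obtain e where "e > 0" "\<And>y. y \<in> \<Lambda> \<Longrightarrow> dist 0 y < e \<Longrightarrow> y = 0"
      by (auto simp: isolated_in_dist_Ex_iff)
    then have "e > 0" "ball 0 e \<inter> \<Lambda> = {0}" using z by auto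
    then show ?thesis by (rule that)
  qed
  have "separated_subgroup \<Lambda> (e / 2)"
  proof
    fix X Y assume XY: "X \<in> \<Lambda>" "Y \<in> \<Lambda>" "X \<noteq> Y"
    have "X - Y \<notin> ball 0 e"
    proof
      assume "X - Y \<in> ball 0 e"
      then have "X - Y \<in> {0}" using e(2) d[OF XY(1,2)] by blast
      with XY(3) show False by simp
    qed
    then have "e \<le> norm (X - Y)" by (simp only: mem_ball dist_norm diff_0 norm_minus_cancel not_less)
    then show "2 * (e / 2) \<le> dist X Y" by (simp add: dist_norm)
  qed (use z d e in auto)
  then show ?thesis by blast
qed

context separated_subgroup
begin

lemma uminus_mem: "X \<in> \<Lambda> \<Longrightarrow> - X \<in> \<Lambda>"
  using diff_mem[OF zero_mem, of X] by simp

lemma add_mem: "X \<in> \<Lambda> \<Longrightarrow> Y \<in> \<Lambda> \<Longrightarrow> X + Y \<in> \<Lambda>"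
  using diff_mem[of X "- Y"] uminus_mem by simp

lemma bij_betw_add: "X \<in> \<Lambda> \<Longrightarrow> bij_betw (\<lambda>Y. X + Y) \<Lambda> \<Lambda>"
  by (rule bij_betwI[where g="\<lambda>Y. Y - X"]) (auto intro: add_mem diff_mem)

lemma bij_betw_uminus: "bij_betw uminus \<Lambda> \<Lambda>"
  by (rule bij_betwI[where g=uminus]) (auto intro: uminus_mem)

lemma bij_betw_shear: "bij_betw (\<lambda>(X, Y). (X, X + Y)) (\<Lambda> \<times> \<Lambda>) (\<Lambda> \<times> \<Lambda>)"
  by (rule bij_betwI[where g="\<lambda>(X, Y). (X, Y - X)"]) (auto intro: add_mem diff_mem)

lemma finite_Int_cball: "finite (\<Lambda> \<inter> cball 0 R)"
proof -
  have "uniform_discrete (\<Lambda> \<inter> cball 0 R)"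
    unfolding uniform_discrete_def
    using separated r_pos by (intro exI[of _ "2 * r"]) force
  then show ?thesis
    by (simp add: uniform_discrete_finite_iff[symmetric] bounded_Int)
qed

lemma countable: "countable \<Lambda>"
proof -
  have "\<Lambda> = (\<Union>n::nat. \<Lambda> \<inter> cball 0 (real n))"
    by (auto simp: real_arch_simple)
  then show ?thesis using finite_Int_cball by (metis countable_UN countable_finite UNIV_I countableI_type)
qed

text \<open>The reproducing bound is a convolution with a Gaussian; sampling it on \<open>\<Lambda>\<close> samples the Gaussian. The
  uniformity in \<open>Z\<close> is needed when the window is changed.\<close>

lemma stft_gaussian_sampling:
  assumes f: "f \<in> feichtinger"
  shows "\<exists>K. \<forall>F Z. finite F \<longrightarrow> F \<subseteq> \<Lambda> \<longrightarrow> (\<Sum>X\<in>F. norm (stft gaussian f (X + Z))) \<le> K"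
proof -
  obtain K where K: "\<And>F :: ('a \<times> 'a) set. finite F \<Longrightarrow> (\<forall>x\<in>F. \<forall>y\<in>F. x \<noteq> y \<longrightarrow> 2 * r \<le> dist x y)
      \<Longrightarrow> (\<Sum>x\<in>F. exp (- (pi / 2 * (norm x)\<^sup>2))) \<le> K"
    using sum_gaussian_separated_le[OF r_pos] by metis
  have f': "integrable lborel (stft gaussian f)" using f by (simp add: feichtinger_iff_integrable)
  have "(\<Sum>X\<in>F. norm (stft gaussian f (X + Z))) \<le> (\<integral>Y. norm (stft gaussian f Y) * K \<partial>lborel)"
    if F: "finite F" "F \<subseteq> \<Lambda>" for F Z
  proof -
    let ?e = "\<lambda>X Y. exp (- (pi / 2 * (norm (Y - (X + Z)))\<^sup>2))"
    have i: "integrable lborel (\<lambda>Y. norm (stft gaussian f Y) * ?e X Y)" for X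
      by (rule Bochner_Integration.integrable_bound[OF integrable_norm[OF f']]) (auto simp: mult_left_le)
    have "(\<Sum>X\<in>F. norm (stft gaussian f (X + Z))) \<le> (\<Sum>X\<in>F. \<integral>Y. norm (stft gaussian f Y) * ?e X Y \<partial>lborel)"
      by (intro sum_mono stft_reproducing_bound f)
    also have "\<dots> = (\<integral>Y. norm (stft gaussian f Y) * (\<Sum>X\<in>F. ?e X Y) \<partial>lborel)"
      using i by (simp add: sum_distrib_left)
    also have "\<dots> \<le> (\<integral>Y. norm (stft gaussian f Y) * K \<partial>lborel)"
    proof (rule integral_mono)
      show "integrable lborel (\<lambda>Y. norm (stft gaussian f Y) * (\<Sum>X\<in>F. ?e X Y))"
        using i by (simp add: sum_distrib_left)
      fix Y
      have inj: "inj_on (\<lambda>X. Y - (X + Z)) F" by (auto simp: inj_on_def)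
      have "(\<Sum>X\<in>F. ?e X Y) = (\<Sum>x\<in>(\<lambda>X. Y - (X + Z)) ` F. exp (- (pi / 2 * (norm x)\<^sup>2)))"
        by (simp add: sum.reindex[OF inj])
      also have "\<dots> \<le> K"
      proof (rule K)
        have "dist (Y - (X + Z)) (Y - (X' + Z)) = dist X X'" for X X'
          by (simp add: dist_norm norm_minus_commute)
        moreover have "2 * r \<le> dist X X'" if "X \<in> F" "X' \<in> F" "X \<noteq> X'" for X X'
          using separated[of X X'] F(2) that by blast
        ultimately have "2 * r \<le> dist (Y - (X + Z)) (Y - (X' + Z))"
          if "X \<in> F" "X' \<in> F" "Y - (X + Z) \<noteq> Y - (X' + Z)" for X X'
          using that by metis
        then show "\<forall>x\<in>(\<lambda>X. Y - (X + Z)) ` F. \<forall>y\<in>(\<lambda>X. Y - (X + Z)) ` F. x \<noteq> y \<longrightarrow> 2 * r \<le> dist x y"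
          unfolding ball_simps by blast
      qed (use F in simp)
      finally show "norm (stft gaussian f Y) * (\<Sum>X\<in>F. ?e X Y) \<le> norm (stft gaussian f Y) * K"
        by (intro mult_left_mono) auto
    qed (use f' in auto)
    finally show ?thesis .
  qed
  then show ?thesis by (intro exI allI impI)
qed

text \<open>By the change of window the samples of \<open>V\<^sub>g f\<close> are bounded by averages of translated samples of \<open>V\<^sub>\<phi> f\<close>
  against the integrable function \<open>\<bar>V\<^sub>\<phi> g\<bar>\<close>.\<close>

theorem stft_summable:
  assumes f: "f \<in> feichtinger" and g: "g \<in> feichtinger"
  shows "stft g f \<in> l1 \<Lambda>"
proof -
  obtain K where K: "\<And>F Z. finite F \<Longrightarrow> F \<subseteq> \<Lambda> \<Longrightarrow> (\<Sum>X\<in>F. norm (stft gaussian f (X + Z))) \<le> K"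
    using stft_gaussian_sampling[OF f] by metis
  define C where "C = (norm (gaussian :: 'a L2))\<^sup>2"
  have C: "C > 0" unfolding C_def using norm_gaussian_pos[where 'a='a] by simp
  have g': "integrable lborel (stft gaussian g)" using g by (simp add: feichtinger_iff_integrable)
  have "(\<Sum>X\<in>F. norm (stft g f X)) \<le> (\<integral>Y. norm (stft gaussian g Y) * K \<partial>lborel) / C"
    if F: "finite F" "F \<subseteq> \<Lambda>" for F
  proof -
    have i: "integrable lborel (\<lambda>Y. norm (stft gaussian g Y) * norm (stft gaussian f (X + Y)))" for X
    proof (rule Bochner_Integration.integrable_bound)
      show "integrable lborel (\<lambda>Y. norm (stft gaussian g Y) * (norm f * norm (gaussian :: 'a L2)))"
        using g' by (intro integrable_mult_left integrable_norm)
    qed (auto simp: norm_mult intro!: mult_left_mono norm_stft_le)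
    have "C * (\<Sum>X\<in>F. norm (stft g f X)) \<le> (\<Sum>X\<in>F. \<integral>Y. norm (stft gaussian g Y) * norm (stft gaussian f (X + Y)) \<partial>lborel)"
      unfolding sum_distrib_left C_def by (intro sum_mono stft_change_window_bound g)
    also have "\<dots> = (\<integral>Y. norm (stft gaussian g Y) * (\<Sum>X\<in>F. norm (stft gaussian f (X + Y))) \<partial>lborel)"
      using i by (simp add: sum_distrib_left)
    also have "\<dots> \<le> (\<integral>Y. norm (stft gaussian g Y) * K \<partial>lborel)"
    proof (rule integral_mono)
      show "integrable lborel (\<lambda>Y. norm (stft gaussian g Y) * (\<Sum>X\<in>F. norm (stft gaussian f (X + Y))))"
        using i by (simp add: sum_distrib_left)
      show "integrable lborel (\<lambda>Y. norm (stft gaussian g Y) * K)"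
        using g' by (intro integrable_mult_left integrable_norm)
    qed (intro mult_left_mono K F norm_ge_zero)
    finally show ?thesis using C by (simp add: field_simps)
  qed
  then have "(\<lambda>X. norm (stft g f X)) summable_on \<Lambda>"
    by (intro nonneg_bdd_above_summable_on bdd_aboveI2) auto
  then show ?thesis by (simp add: l1_def)
qed

end

section \<open>Star algebras of operators\<close>

text \<open>A relation rather than the function \<open>cadj\<close>: it can be established term by term and in limits without
  first knowing that the adjoint exists.\<close>

definition adjoint_pair :: "'a::euclidean_space op \<Rightarrow> 'a op \<Rightarrow> bool" where
  "adjoint_pair T S \<longleftrightarrow> (\<forall>f g. cinner (blinfun_apply T f) g = cinner f (blinfun_apply S g))"

lemma adjoint_pairD: "adjoint_pair T S \<Longrightarrow> cinner (blinfun_apply T f) g = cinner f (blinfun_apply S g)"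
  by (simp add: adjoint_pair_def)

lemma adjoint_pair_sym:
  assumes "adjoint_pair T S"
  shows "adjoint_pair S T"
proof -
  have "cinner (blinfun_apply S f) g = cinner f (blinfun_apply T g)" for f g
    by (subst (1 2) cinner_commute) (simp add: adjoint_pairD[OF assms])
  then show ?thesis by (simp add: adjoint_pair_def)
qed

lemma adjoint_pair_unique:
  assumes "adjoint_pair T S" "adjoint_pair T S'"
  shows "S = S'"
proof (rule blinfun_eqI, rule cinner_extI)
  fix f g
  show "cinner (blinfun_apply S f) g = cinner (blinfun_apply S' f) g"
    using assms by (metis adjoint_pairD adjoint_pair_sym)
qed

lemma cadj_eqI:
  assumes "adjoint_pair T S"
  shows "cadj T = S"
  unfolding cadj_def using assms adjoint_pair_unique[of T]
  by (intro the_equality) (auto simp: adjoint_pair_def)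

text \<open>Operators are only real-linear by type, but an adjoint forces complex linearity, because \<open>cinner\<close> is
  complex-linear in the first argument. Star algebras therefore only need adjoints to be exhibited.\<close>

lemma adjoint_pair_complex_linear:
  assumes "adjoint_pair T S"
  shows "blinfun_apply T (c *\<^sub>C f) = c *\<^sub>C blinfun_apply T f"
  by (rule cinner_extI) (simp add: adjoint_pairD[OF assms] cinner_scaleC_left)

lemma adjoint_pair_add:
  "adjoint_pair T S \<Longrightarrow> adjoint_pair T' S' \<Longrightarrow> adjoint_pair (T + T') (S + S')"
  by (simp add: adjoint_pair_def blinfun.add_left cinner_add_left cinner_add_right)

lemma adjoint_pair_scale: "adjoint_pair T S \<Longrightarrow> adjoint_pair (scale_op c T) (scale_op (cnj c) S)"
  by (simp add: adjoint_pair_def cinner_scaleC_left cinner_scaleC_right)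

lemma adjoint_pair_diff:
  "adjoint_pair T S \<Longrightarrow> adjoint_pair T' S' \<Longrightarrow> adjoint_pair (T - T') (S - S')"
  by (simp add: adjoint_pair_def blinfun.diff_left cinner_diff_left cinner_diff_right)

lemma adjoint_pair_tf_shift:
  "adjoint_pair (tf_shift X) (scale_op (cnj (cocycle X (-X))) (tf_shift (-X)))"
  by (simp add: adjoint_pair_def cinner_tf_shift_left)

lemma adjoint_pair_norm_le:
  assumes "adjoint_pair T S"
  shows "norm S \<le> norm T"
proof (rule norm_blinfun_bound)
  fix g
  have "(norm (blinfun_apply S g))\<^sup>2 = norm (cinner (blinfun_apply S g) (blinfun_apply S g))"
    by (simp add: cinner_self norm_power)
  also have "\<dots> = norm (cinner (blinfun_apply T (blinfun_apply S g)) g)"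
    by (simp add: adjoint_pairD[OF assms])
  also have "\<dots> \<le> norm (blinfun_apply T (blinfun_apply S g)) * norm g" by (rule norm_cinner_le)
  also have "\<dots> \<le> (norm T * norm (blinfun_apply S g)) * norm g"
    by (intro mult_right_mono norm_blinfun) simp
  finally have "norm (blinfun_apply S g) * norm (blinfun_apply S g) \<le> (norm T * norm g) * norm (blinfun_apply S g)"
    by (simp add: power2_eq_square mult_ac)
  then show "norm (blinfun_apply S g) \<le> norm T * norm g"
    by (cases "norm (blinfun_apply S g) = 0") (auto simp: mult_le_cancel_right)
qed simp

lemma adjoint_pair_norm: "adjoint_pair T S \<Longrightarrow> norm S = norm T"
  using adjoint_pair_norm_le adjoint_pair_sym by (metis antisym)

lemma adjoint_pair_limit:
  assumes "\<And>n. adjoint_pair (T n) (S n)" "T \<longlonglongrightarrow> T'" "S \<longlonglongrightarrow> S'"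
  shows "adjoint_pair T' S'"
proof -
  have "cinner (blinfun_apply T' f) g = cinner f (blinfun_apply S' g)" for f g
  proof (rule LIMSEQ_unique)
    show "(\<lambda>n. cinner (blinfun_apply (T n) f) g) \<longlonglongrightarrow> cinner (blinfun_apply T' f) g"
      by (intro bounded_linear.tendsto[OF bounded_linear_cinner_left] blinfun.tendsto assms tendsto_const)
    show "(\<lambda>n. cinner (blinfun_apply (T n) f) g) \<longlonglongrightarrow> cinner f (blinfun_apply S' g)"
      unfolding adjoint_pairD[OF assms(1)]
      by (intro bounded_linear.tendsto[OF bounded_linear_cinner_right] blinfun.tendsto assms tendsto_const)
  qed
  then show ?thesis by (simp add: adjoint_pair_def)
qed

lemma adjoint_pair_has_sum:
  assumes "\<And>i. i \<in> I \<Longrightarrow> adjoint_pair (T i) (S i)" "(T has_sum T') I" "(S has_sum S') I"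
  shows "adjoint_pair T' S'"
proof -
  have "cinner (blinfun_apply T' f) g = cinner f (blinfun_apply S' g)" for f g
  proof -
    have l: "((\<lambda>i. cinner (blinfun_apply (T i) f) g) has_sum cinner (blinfun_apply T' f) g) I"
      by (intro has_sum_bounded_linear[OF bounded_linear_cinner_left]
          has_sum_bounded_linear[OF blinfun.bounded_linear_left] assms)
    have r: "((\<lambda>i. cinner f (blinfun_apply (S i) g)) has_sum cinner f (blinfun_apply S' g)) I"
      by (intro has_sum_bounded_linear[OF bounded_linear_cinner_right]
          has_sum_bounded_linear[OF blinfun.bounded_linear_left] assms)
    have "((\<lambda>i. cinner (blinfun_apply (T i) f) g) has_sum cinner f (blinfun_apply S' g)) I"
      by (subst has_sum_cong[OF adjoint_pairD[OF assms(1)]]) (use r in auto)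
    with l show ?thesis by (rule has_sum_unique)
  qed
  then show ?thesis by (simp add: adjoint_pair_def)
qed

lemma star_algebraI:
  assumes "id_blinfun \<in> B" "\<And>S T. S \<in> B \<Longrightarrow> T \<in> B \<Longrightarrow> S + T \<in> B"
    "\<And>c T. T \<in> B \<Longrightarrow> scale_op c T \<in> B" "\<And>S T. S \<in> B \<Longrightarrow> T \<in> B \<Longrightarrow> S o\<^sub>L T \<in> B"
    and adj: "\<And>T. T \<in> B \<Longrightarrow> \<exists>S\<in>B. adjoint_pair T S"
  shows "star_algebra B"
proof
  fix T c f assume "T \<in> B"
  then obtain S where S: "S \<in> B" "adjoint_pair T S" using adj by blast
  show "blinfun_apply T (c *\<^sub>C f) = c *\<^sub>C blinfun_apply T f" by (rule adjoint_pair_complex_linear[OF S(2)])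
  show "cadj T \<in> B" using S by (simp add: cadj_eqI)
  show "\<exists>S. \<forall>f g. cinner (blinfun_apply T f) g = cinner f (blinfun_apply S g)"
    using S by (auto simp: adjoint_pair_def)
qed (use assms in auto)

context star_algebra
begin

lemma adjoint_pair_cadj: "T \<in> B \<Longrightarrow> adjoint_pair T (cadj T)"
  using adj_ex[of T] cadj_eqI[of T] by (auto simp: adjoint_pair_def)

lemma zero_in: "0 \<in> B"
  using scale_mem[OF one_mem, of 0] by simp

lemma minus_in: "T \<in> B \<Longrightarrow> - T \<in> B"
  using scale_mem[of T "-1"] by (simp add: scale_op_minus1)

lemma diff_in: "S \<in> B \<Longrightarrow> T \<in> B \<Longrightarrow> S - T \<in> B"
  using add_mem[OF _ minus_in] by (metis add_uminus_conv_diff)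

lemma sum_in: "(\<And>i. i \<in> I \<Longrightarrow> T i \<in> B) \<Longrightarrow> sum T I \<in> B"
  by (induction I rule: infinite_finite_induct) (auto intro: add_mem zero_in)

end

lemma closed_has_sum_mem:
  fixes T :: "'i \<Rightarrow> 'a::euclidean_space op"
  assumes "star_algebra B" "closed B" "\<And>i. i \<in> I \<Longrightarrow> T i \<in> B" "(T has_sum S) I"
  shows "S \<in> B"
proof -
  interpret star_algebra B by fact
  have "(sum T \<longlongrightarrow> S) (finite_subsets_at_top I)" using assms(4) by (simp add: has_sum_def)
  moreover have "\<forall>\<^sub>F F in finite_subsets_at_top I. sum T F \<in> B"
    by (rule eventually_finite_subsets_at_top_weakI) (auto intro!: sum_in assms(3))
  ultimately show ?thesis
    using Lim_in_closed_set[OF assms(2)] finite_subsets_at_top_neq_bot by blast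
qed

text \<open>Taking adjoints is isometric, so the adjoints of a convergent sequence converge and supply the adjoint of
  the limit.\<close>

lemma star_algebra_closure:
  fixes B :: "'a::euclidean_space op set"
  assumes "star_algebra B"
  shows "star_algebra (closure B)"
proof -
  interpret star_algebra B by fact
  show ?thesis
  proof (rule star_algebraI)
    show "id_blinfun \<in> closure B" using one_mem closure_subset by blast
    show "S + T \<in> closure B" if ST: "S \<in> closure B" "T \<in> closure B" for S T
    proof -
      obtain s t where "\<And>n. s n \<in> B" "s \<longlonglongrightarrow> S" "\<And>n. t n \<in> B" "t \<longlonglongrightarrow> T"
        using ST by (auto simp: closure_sequential)
      then show ?thesis unfolding closure_sequential
        by (intro exI[of _ "\<lambda>n. s n + t n"]) (auto intro!: add_mem tendsto_intros)
    qed
    show "S o\<^sub>L T \<in> closure B" if ST: "S \<in> closure B" "T \<in> closure B" for S T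
    proof -
      obtain s t where "\<And>n. s n \<in> B" "s \<longlonglongrightarrow> S" "\<And>n. t n \<in> B" "t \<longlonglongrightarrow> T"
        using ST by (auto simp: closure_sequential)
      then show ?thesis unfolding closure_sequential
        by (intro exI[of _ "\<lambda>n. s n o\<^sub>L t n"]) (auto intro!: compose_mem bounded_bilinear.tendsto[OF bounded_bilinear_blinfun_compose])
    qed
    show "scale_op c T \<in> closure B" if T: "T \<in> closure B" for c T
    proof -
      obtain t where "\<And>n. t n \<in> B" "t \<longlonglongrightarrow> T"
        using T by (auto simp: closure_sequential)
      then show ?thesis unfolding closure_sequential
        by (intro exI[of _ "\<lambda>n. scale_op c (t n)"])
          (auto intro!: scale_mem bounded_linear.tendsto[OF bounded_linear_scale_op_right])
    qed
    show "\<exists>S\<in>closure B. adjoint_pair T S" if T: "T \<in> closure B" for T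
    proof -
      obtain t where t: "\<And>n. t n \<in> B" "t \<longlonglongrightarrow> T"
        using T by (auto simp: closure_sequential)
      have "norm (cadj (t m) - cadj (t n)) = norm (t m - t n)" for m n
        by (intro adjoint_pair_norm adjoint_pair_diff adjoint_pair_cadj t)
      then have "Cauchy (\<lambda>n. cadj (t n))"
        using LIMSEQ_imp_Cauchy[OF t(2)] unfolding Cauchy_def dist_norm by simp
      then obtain S where S: "(\<lambda>n. cadj (t n)) \<longlonglongrightarrow> S"
        using Cauchy_convergent convergent_def by blast
      have "S \<in> closure B" unfolding closure_sequential
        using S t(1) by (intro exI[of _ "\<lambda>n. cadj (t n)"]) (simp add: cadj_mem)
      moreover have "adjoint_pair T S"
        by (rule adjoint_pair_limit[OF adjoint_pair_cadj t(2) S]) (rule t)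
      ultimately show ?thesis by blast
    qed
  qed
qed

section \<open>The algebra of \<open>\<ell>\<^sup>1\<close> sums of time-frequency shifts\<close>

lemma abs_summable_scale_tf_shift:
  assumes "(\<lambda>i. norm (c i)) summable_on I"
  shows "(\<lambda>i. norm (scale_op (c i) (tf_shift (p i)))) summable_on I"
proof (rule Infinite_Sum.abs_summable_on_comparison_test[of c])
  show "norm (scale_op (c i) (tf_shift (p i))) \<le> norm (c i)" for i
    using mult_left_mono[OF norm_tf_shift_le, of "norm (c i)"] by (simp add: norm_scale_op)
qed (use assms in auto)

lemma summable_scale_tf_shift:
  fixes p :: "'i \<Rightarrow> 'a::euclidean_space \<times> 'a"
  assumes "(\<lambda>i. norm (c i)) summable_on I"
  shows "(\<lambda>i. scale_op (c i) (tf_shift (p i))) summable_on I"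
  by (rule abs_summable_summable[OF abs_summable_scale_tf_shift[OF assms, of p]])

lemma l1_op_has_sum:
  assumes "a \<in> l1 \<Lambda>"
  shows "((\<lambda>X. scale_op (a X) (tf_shift X)) has_sum l1_op \<Lambda> a) \<Lambda>"
  unfolding l1_op_def using summable_scale_tf_shift[of a \<Lambda> "\<lambda>X. X"] assms
  by (intro has_sum_infsum) (simp add: l1_def)

lemma l1_op_apply_has_sum:
  assumes "a \<in> l1 \<Lambda>"
  shows "((\<lambda>X. a X *\<^sub>C blinfun_apply (tf_shift X) g) has_sum blinfun_apply (l1_op \<Lambda> a) g) \<Lambda>"
  using has_sum_bounded_linear[OF blinfun.bounded_linear_left[of g] l1_op_has_sum[OF assms]] by simp

text \<open>Collecting the terms with equal shift turns any absolutely convergent series of multiples of shifts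
  from \<open>\<Lambda>\<close> into an element of the \<open>\<ell>\<^sup>1\<close> algebra; twisted convolution and involution are instances.\<close>

lemma infsum_tf_shift_mem_l1_algebra:
  fixes p :: "'i \<Rightarrow> 'a::euclidean_space \<times> 'a"
  assumes c: "(\<lambda>i. norm (c i)) summable_on I" and p: "\<And>i. i \<in> I \<Longrightarrow> p i \<in> \<Lambda>"
  shows "(\<Sum>\<^sub>\<infinity>i\<in>I. scale_op (c i) (tf_shift (p i))) \<in> l1_algebra \<Lambda>"
proof -
  define J where "J X = {i\<in>I. p i = X}" for X
  have bij: "bij_betw snd (Sigma \<Lambda> J) I"
    by (rule bij_betwI[where g="\<lambda>i. (p i, i)"]) (auto simp: J_def p)
  have c': "(\<lambda>(X, i). norm (c i)) summable_on Sigma \<Lambda> J"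
    using summable_on_reindex_bij_betw[OF bij, of "\<lambda>i. norm (c i)"] c by (simp add: case_prod_unfold)
  define a where "a X = (\<Sum>\<^sub>\<infinity>i\<in>J X. c i)" for X
  have cJ: "(\<lambda>i. norm (c i)) summable_on J X" for X
    by (rule summable_on_subset_banach[OF c]) (auto simp: J_def)
  have "(\<lambda>X. \<Sum>\<^sub>\<infinity>i\<in>J X. norm (c i)) summable_on \<Lambda>"
    by (rule summable_on_Sigma_banach[OF c'])
  then have a: "a \<in> l1 \<Lambda>"
    unfolding l1_def mem_Collect_eq
    by (rule Infinite_Sum.abs_summable_on_comparison_test') (unfold a_def, intro norm_infsum_bound cJ)
  have s: "(\<lambda>(X, i). scale_op (c i) (tf_shift (p i))) summable_on Sigma \<Lambda> J"
    using summable_on_reindex_bij_betw[OF bij, of "\<lambda>i. scale_op (c i) (tf_shift (p i))"]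
      summable_scale_tf_shift[OF c, of p] by (simp add: case_prod_unfold)
  have "(\<Sum>\<^sub>\<infinity>i\<in>I. scale_op (c i) (tf_shift (p i))) = (\<Sum>\<^sub>\<infinity>(X, i)\<in>Sigma \<Lambda> J. scale_op (c i) (tf_shift (p i)))"
    using infsum_reindex_bij_betw[OF bij, of "\<lambda>i. scale_op (c i) (tf_shift (p i))"]
    by (simp add: case_prod_unfold)
  also have "\<dots> = (\<Sum>\<^sub>\<infinity>X\<in>\<Lambda>. \<Sum>\<^sub>\<infinity>i\<in>J X. scale_op (c i) (tf_shift (p i)))"
    by (rule infsum_Sigma'_banach[OF s, symmetric])
  also have "\<dots> = (\<Sum>\<^sub>\<infinity>X\<in>\<Lambda>. scale_op (a X) (tf_shift X))"
  proof (rule infsum_cong)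
    fix X
    have "(c has_sum a X) (J X)"
      unfolding a_def by (rule has_sum_infsum[OF abs_summable_summable[OF cJ]])
    then have "((\<lambda>i. scale_op (c i) (tf_shift X)) has_sum scale_op (a X) (tf_shift X)) (J X)"
      by (rule has_sum_bounded_linear[OF bounded_linear_scale_op_left])
    then have "(\<Sum>\<^sub>\<infinity>i\<in>J X. scale_op (c i) (tf_shift X)) = scale_op (a X) (tf_shift X)"
      by (rule infsumI)
    moreover have "(\<Sum>\<^sub>\<infinity>i\<in>J X. scale_op (c i) (tf_shift (p i))) = (\<Sum>\<^sub>\<infinity>i\<in>J X. scale_op (c i) (tf_shift X))"
      by (rule infsum_cong) (auto simp: J_def)
    ultimately show "(\<Sum>\<^sub>\<infinity>i\<in>J X. scale_op (c i) (tf_shift (p i))) = scale_op (a X) (tf_shift X)" by simp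
  qed
  finally show ?thesis using a by (auto simp: l1_algebra_def l1_op_def)
qed

lemma abs_summable_times:
  fixes a :: "'i \<Rightarrow> complex" and b :: "'j \<Rightarrow> complex"
  assumes "(\<lambda>i. norm (a i)) summable_on I" "(\<lambda>j. norm (b j)) summable_on J"
  shows "(\<lambda>(i, j). norm (a i * b j)) summable_on I \<times> J"
proof -
  have "(\<lambda>ij. norm (a (fst ij) * b (snd ij))) summable_on I \<times> J"
    unfolding Infinite_Sum.abs_summable_on_Sigma_iff
    using assms by (auto simp: norm_mult infsum_cmult_right' abs_mult infsum_nonneg intro!: summable_on_cmult_right summable_on_cmult_left)
  then show ?thesis by (simp add: case_prod_unfold)
qed

context separated_subgroup
begin

lemma l1_op_compose:
  assumes a: "a \<in> l1 \<Lambda>" and b: "b \<in> l1 \<Lambda>"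
  shows "l1_op \<Lambda> a o\<^sub>L l1_op \<Lambda> b
    = (\<Sum>\<^sub>\<infinity>X\<in>\<Lambda>. \<Sum>\<^sub>\<infinity>Y\<in>\<Lambda>. scale_op (a X * b Y) (tf_shift X o\<^sub>L tf_shift Y))"
proof -
  have comp: "scale_op (a X) (tf_shift X) o\<^sub>L scale_op (b Y) (tf_shift Y)
      = scale_op (a X * b Y) (tf_shift X o\<^sub>L tf_shift Y)" for X Y
    by (rule blinfun_eqI) (simp add: tf_shift_scaleC scaleC_scaleC)
  have "(\<Sum>\<^sub>\<infinity>Y\<in>\<Lambda>. scale_op (a X * b Y) (tf_shift X o\<^sub>L tf_shift Y)) = scale_op (a X) (tf_shift X) o\<^sub>L l1_op \<Lambda> b" for X
    using has_sum_bounded_linear[OF bounded_bilinear.bounded_linear_right[OF bounded_bilinear_blinfun_compose, of "scale_op (a X) (tf_shift X)"] l1_op_has_sum[OF b]]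
    by (intro infsumI) (simp add: comp)
  then show ?thesis
    using infsumI[OF has_sum_bounded_linear[OF bounded_bilinear.bounded_linear_left[OF bounded_bilinear_blinfun_compose, of "l1_op \<Lambda> b"] l1_op_has_sum[OF a]]]
    by simp
qed

lemma star_algebra_l1_algebra: "star_algebra (l1_algebra \<Lambda>)"
proof (rule star_algebraI)
  show "id_blinfun \<in> l1_algebra \<Lambda>"
    using infsum_tf_shift_mem_l1_algebra[of "\<lambda>_. 1" "{0::'a \<times> 'a}" "\<lambda>_. 0" \<Lambda>] zero_mem by simp
next
  fix S T assume "S \<in> l1_algebra \<Lambda>" "T \<in> l1_algebra \<Lambda>"
  then obtain a b where a: "a \<in> l1 \<Lambda>" "S = l1_op \<Lambda> a" and b: "b \<in> l1 \<Lambda>" "T = l1_op \<Lambda> b"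
    by (auto simp: l1_algebra_def)
  have "(\<lambda>X. norm (a X) + norm (b X)) summable_on \<Lambda>"
    using a b by (intro summable_on_add) (auto simp: l1_def)
  then have ab: "(\<lambda>X. a X + b X) \<in> l1 \<Lambda>"
    unfolding l1_def mem_Collect_eq
    by (rule Infinite_Sum.abs_summable_on_comparison_test') (rule norm_triangle_ineq)
  have "S + T = l1_op \<Lambda> (\<lambda>X. a X + b X)"
    using infsumI[OF has_sum_add[OF l1_op_has_sum[OF a(1)] l1_op_has_sum[OF b(1)]]] a b
    by (simp add: l1_op_def scale_op_add_left)
  then show "S + T \<in> l1_algebra \<Lambda>" using ab by (auto simp: l1_algebra_def)
  let ?c = "\<lambda>(X, Y). a X * b Y * cocycle X Y"
  have "(\<lambda>(X, Y). norm (a X * b Y)) summable_on \<Lambda> \<times> \<Lambda>"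
    using a b by (intro abs_summable_times) (auto simp: l1_def)
  then have c: "(\<lambda>i. norm (?c i)) summable_on \<Lambda> \<times> \<Lambda>"
    by (simp add: case_prod_unfold norm_mult)
  have "S o\<^sub>L T = (\<Sum>\<^sub>\<infinity>X\<in>\<Lambda>. \<Sum>\<^sub>\<infinity>Y\<in>\<Lambda>. scale_op (?c (X, Y)) (tf_shift (X + Y)))"
    unfolding a b l1_op_compose[OF a(1) b(1)] by (simp add: tf_shift_compose scale_op_scale_op)
  also have "\<dots> = (\<Sum>\<^sub>\<infinity>(X, Y)\<in>\<Lambda> \<times> \<Lambda>. scale_op (?c (X, Y)) (tf_shift (X + Y)))"
    using summable_scale_tf_shift[OF c, of "\<lambda>(X, Y). X + Y"]
    by (intro infsum_Sigma'_banach) (simp add: case_prod_unfold)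
  also have "\<dots> \<in> l1_algebra \<Lambda>"
    using infsum_tf_shift_mem_l1_algebra[OF c, of "\<lambda>(X, Y). X + Y" \<Lambda>] add_mem by (auto simp: case_prod_unfold)
  finally show "S o\<^sub>L T \<in> l1_algebra \<Lambda>" .
next
  fix T c assume "T \<in> l1_algebra \<Lambda>"
  then obtain a where a: "a \<in> l1 \<Lambda>" "T = l1_op \<Lambda> a" by (auto simp: l1_algebra_def)
  have "(\<lambda>X. c * a X) \<in> l1 \<Lambda>"
    using a by (auto simp: l1_def norm_mult intro: summable_on_cmult_right)
  moreover have "scale_op c T = l1_op \<Lambda> (\<lambda>X. c * a X)"
    using infsumI[OF has_sum_bounded_linear[OF bounded_linear_scale_op_right[of c] l1_op_has_sum[OF a(1)]]] a
    by (simp add: l1_op_def scale_op_scale_op)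
  ultimately show "scale_op c T \<in> l1_algebra \<Lambda>" by (auto simp: l1_algebra_def)
  let ?c = "\<lambda>X. cnj (a X) * cnj (cocycle X (-X))"
  have c: "(\<lambda>X. norm (?c X)) summable_on \<Lambda>" using a by (simp add: l1_def norm_mult)
  let ?S = "\<Sum>\<^sub>\<infinity>X\<in>\<Lambda>. scale_op (?c X) (tf_shift (- X))"
  have "adjoint_pair T ?S"
  proof (rule adjoint_pair_has_sum)
    show "((\<lambda>X. scale_op (a X) (tf_shift X)) has_sum T) \<Lambda>" using a l1_op_has_sum by simp
    show "((\<lambda>X. scale_op (?c X) (tf_shift (- X))) has_sum ?S) \<Lambda>"
      by (intro has_sum_infsum summable_scale_tf_shift c)
    show "adjoint_pair (scale_op (a X) (tf_shift X)) (scale_op (?c X) (tf_shift (- X)))" for X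
      using adjoint_pair_scale[OF adjoint_pair_tf_shift[of X], of "a X"] by (simp add: scale_op_scale_op)
  qed
  moreover have "?S \<in> l1_algebra \<Lambda>"
    by (rule infsum_tf_shift_mem_l1_algebra[OF c uminus_mem])
  ultimately show "\<exists>S\<in>l1_algebra \<Lambda>. adjoint_pair T S" by blast
qed

lemma Cstar_eq_closure: "Cstar \<Lambda> = closure (l1_algebra \<Lambda>)"
proof (rule antisym)
  have "tf_shift X \<in> l1_algebra \<Lambda>" if "X \<in> \<Lambda>" for X
    using infsum_tf_shift_mem_l1_algebra[of "\<lambda>_. 1" "{X}" "\<lambda>X. X" \<Lambda>] that by simp
  then have "tf_shift ` \<Lambda> \<subseteq> closure (l1_algebra \<Lambda>)"
    using closure_subset by blast
  then show "Cstar \<Lambda> \<subseteq> closure (l1_algebra \<Lambda>)"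
    unfolding Cstar_def using star_algebra_closure[OF star_algebra_l1_algebra] by blast
  show "closure (l1_algebra \<Lambda>) \<subseteq> Cstar \<Lambda>"
    unfolding Cstar_def
  proof (rule Inter_greatest)
    fix B :: "'a op set" assume "B \<in> {B. star_algebra B \<and> closed B \<and> tf_shift ` \<Lambda> \<subseteq> B}"
    then have B: "star_algebra B" "closed B" "\<And>X. X \<in> \<Lambda> \<Longrightarrow> tf_shift X \<in> B" by auto
    have "l1_op \<Lambda> a \<in> B" if "a \<in> l1 \<Lambda>" for a
      by (rule closed_has_sum_mem[OF B(1,2) _ l1_op_has_sum[OF that]])
        (intro star_algebra.scale_mem[OF B(1)] B(3))
    then have "l1_algebra \<Lambda> \<subseteq> B" by (auto simp: l1_algebra_def)
    then show "closure (l1_algebra \<Lambda>) \<subseteq> B" using B(2) by (rule closure_minimal)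
  qed
qed

lemma star_algebra_Cstar: "star_algebra (Cstar \<Lambda>)"
  unfolding Cstar_eq_closure by (rule star_algebra_closure[OF star_algebra_l1_algebra])

lemma closed_Cstar: "closed (Cstar \<Lambda>)"
  unfolding Cstar_eq_closure by simp

lemma l1_algebra_subset_Cstar: "l1_algebra \<Lambda> \<subseteq> Cstar \<Lambda>"
  unfolding Cstar_eq_closure by (rule closure_subset)

section \<open>The inner product module\<close>

lemma l1_algebra_feichtinger:
  assumes "T \<in> l1_algebra \<Lambda>" "g \<in> feichtinger"
  shows "blinfun_apply T g \<in> feichtinger"
proof -
  obtain a where a: "a \<in> l1 \<Lambda>" "T = l1_op \<Lambda> a" using assms by (auto simp: l1_algebra_def)
  show ?thesis
    using feichtinger_has_sum[OF assms(2) _ countable l1_op_apply_has_sum[OF a(1)]] a by (simp add: l1_def)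
qed

lemma S0_inner_eq_l1_op: "S0_inner \<Lambda> f g = l1_op \<Lambda> (stft g f)"
  by (simp add: S0_inner_def l1_op_def)

lemma S0_inner_mem: "f \<in> feichtinger \<Longrightarrow> g \<in> feichtinger \<Longrightarrow> S0_inner \<Lambda> f g \<in> l1_algebra \<Lambda>"
  unfolding S0_inner_eq_l1_op l1_algebra_def by (intro imageI stft_summable)

lemma S0_inner_has_sum:
  assumes "f \<in> feichtinger" "g \<in> feichtinger"
  shows "((\<lambda>X. scale_op (stft g f X) (tf_shift X)) has_sum S0_inner \<Lambda> f g) \<Lambda>"
  unfolding S0_inner_eq_l1_op by (rule l1_op_has_sum[OF stft_summable[OF assms]])

lemma S0_inner_add_left:
  assumes "f \<in> feichtinger" "g \<in> feichtinger" "h \<in> feichtinger"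
  shows "S0_inner \<Lambda> (f + g) h = S0_inner \<Lambda> f h + S0_inner \<Lambda> g h"
  using infsumI[OF has_sum_add[OF S0_inner_has_sum[OF assms(1,3)] S0_inner_has_sum[OF assms(2,3)]]]
  by (simp add: S0_inner_def stft_add scale_op_add_left)

lemma S0_inner_scale_left:
  assumes "f \<in> feichtinger" "g \<in> feichtinger"
  shows "S0_inner \<Lambda> (c *\<^sub>C f) g = scale_op c (S0_inner \<Lambda> f g)"
  using infsumI[OF has_sum_bounded_linear[OF bounded_linear_scale_op_right[of c] S0_inner_has_sum[OF assms]]]
  by (simp add: S0_inner_def stft_scaleC scale_op_scale_op)

text \<open>The adjoint of the term at \<open>X\<close> of one series is the term at \<open>-X\<close> of the other: the phase of
  \<open>\<pi>(X)\<^sup>*\<close> cancels the phase of \<open>V\<^sub>f g(-X)\<close>.\<close>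

lemma S0_inner_adjoint_pair:
  assumes f: "f \<in> feichtinger" and g: "g \<in> feichtinger"
  shows "adjoint_pair (S0_inner \<Lambda> f g) (S0_inner \<Lambda> g f)"
proof (rule adjoint_pair_has_sum)
  show "((\<lambda>X. scale_op (stft g f X) (tf_shift X)) has_sum S0_inner \<Lambda> f g) \<Lambda>"
    by (rule S0_inner_has_sum[OF f g])
  show "((\<lambda>X. scale_op (stft f g (- X)) (tf_shift (- X))) has_sum S0_inner \<Lambda> g f) \<Lambda>"
    using has_sum_reindex_bij_betw[OF bij_betw_uminus, of "\<lambda>X. scale_op (stft f g X) (tf_shift X)"]
      S0_inner_has_sum[OF g f] by blast
  fix X
  have "cnj (stft g f X) = cinner (blinfun_apply (tf_shift X) g) f"
    unfolding stft_def by (rule cinner_commute[symmetric])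
  also have "\<dots> = cinner g (cnj (cocycle X (- X)) *\<^sub>C blinfun_apply (tf_shift (- X)) f)"
    by (rule cinner_tf_shift_left)
  also have "\<dots> = cocycle X (- X) * stft f g (- X)"
    by (simp add: cinner_scaleC_right stft_def)
  finally have "cnj (stft g f X) * cnj (cocycle X (- X))
      = (cocycle X (- X) * cnj (cocycle X (- X))) * stft f g (- X)" by simp
  then have "cnj (stft g f X) * cnj (cocycle X (- X)) = stft f g (- X)" by simp
  then show "adjoint_pair (scale_op (stft g f X) (tf_shift X)) (scale_op (stft f g (- X)) (tf_shift (- X)))"
    using adjoint_pair_scale[OF adjoint_pair_tf_shift[of X], of "stft g f X"] by (simp add: scale_op_scale_op)
qed

lemma S0_inner_cadj:
  "f \<in> feichtinger \<Longrightarrow> g \<in> feichtinger \<Longrightarrow> S0_inner \<Lambda> f g = cadj (S0_inner \<Lambda> g f)"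
  using cadj_eqI[OF S0_inner_adjoint_pair] by metis

text \<open>By covariance the coefficient of \<open>\<pi>(X + Y)\<close> contributed by \<open>a(X) \<pi>(X) f\<close> is exactly that of
  \<open>a(X) V\<^sub>g f(Y) \<pi>(X) \<pi>(Y)\<close>. The shear \<open>(X, Y) \<mapsto> (X, X + Y)\<close> of \<open>\<Lambda> \<times> \<Lambda>\<close> matches the two absolutely
  convergent double series.\<close>

lemma S0_inner_act:
  assumes T: "T \<in> l1_algebra \<Lambda>" and f: "f \<in> feichtinger" and g: "g \<in> feichtinger"
  shows "S0_inner \<Lambda> (blinfun_apply T f) g = T o\<^sub>L S0_inner \<Lambda> f g"
proof -
  obtain a where a: "a \<in> l1 \<Lambda>" "T = l1_op \<Lambda> a" using T by (auto simp: l1_algebra_def)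
  define b where "b X Y = a X * stft g (blinfun_apply (tf_shift X) f) Y" for X Y
  have "(\<lambda>(X, Y). norm (a X * stft g f Y)) summable_on \<Lambda> \<times> \<Lambda>"
    using a stft_summable[OF f g] by (intro abs_summable_times) (auto simp: l1_def)
  also have "(\<lambda>(X, Y). norm (a X * stft g f Y)) = (\<lambda>(X, Y). norm (b X (X + Y)))"
    by (auto simp: b_def stft_tf_shift norm_mult)
  finally have b: "(\<lambda>XY. norm (case XY of (X, Y) \<Rightarrow> b X Y)) summable_on \<Lambda> \<times> \<Lambda>"
    using summable_on_reindex_bij_betw[OF bij_betw_shear, of "\<lambda>(X, Y). norm (b X Y)"]
    by (simp add: case_prod_unfold)
  have s: "(\<lambda>(X, Y). scale_op (b X Y) (tf_shift Y)) summable_on \<Lambda> \<times> \<Lambda>"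
    using summable_scale_tf_shift[OF b, of snd] by (simp add: case_prod_unfold)
  have stft_T: "((\<lambda>X. b X Y) has_sum stft g (blinfun_apply T f) Y) \<Lambda>" for Y
    using has_sum_bounded_linear[OF bounded_linear_cinner_left l1_op_apply_has_sum[OF a(1), of f]]
    by (simp add: b_def stft_def a cinner_scaleC_left)
  have "S0_inner \<Lambda> (blinfun_apply T f) g = (\<Sum>\<^sub>\<infinity>Y\<in>\<Lambda>. \<Sum>\<^sub>\<infinity>X\<in>\<Lambda>. scale_op (b X Y) (tf_shift Y))"
    unfolding S0_inner_def
    by (simp add: infsumI[OF has_sum_bounded_linear[OF bounded_linear_scale_op_left stft_T]])
  also have "\<dots> = (\<Sum>\<^sub>\<infinity>X\<in>\<Lambda>. \<Sum>\<^sub>\<infinity>Y\<in>\<Lambda>. scale_op (b X Y) (tf_shift Y))"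
    by (rule infsum_swap_banach[OF s, symmetric])
  also have "\<dots> = (\<Sum>\<^sub>\<infinity>X\<in>\<Lambda>. \<Sum>\<^sub>\<infinity>Y\<in>\<Lambda>. scale_op (b X (X + Y)) (tf_shift (X + Y)))"
    by (rule infsum_cong, rule infsum_reindex_bij_betw[OF bij_betw_add, symmetric])
  also have "\<dots> = (\<Sum>\<^sub>\<infinity>X\<in>\<Lambda>. \<Sum>\<^sub>\<infinity>Y\<in>\<Lambda>. scale_op (a X * stft g f Y) (tf_shift X o\<^sub>L tf_shift Y))"
    by (simp add: b_def stft_tf_shift tf_shift_compose scale_op_scale_op mult_ac)
  also have "\<dots> = T o\<^sub>L S0_inner \<Lambda> f g"
    unfolding a S0_inner_eq_l1_op by (rule l1_op_compose[OF a(1) stft_summable[OF f g], symmetric])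
  finally show ?thesis .
qed

end

section \<open>Positivity\<close>

text \<open>The entrywise product of two Gram matrices is positive semidefinite (Schur). Expanding one of them as
  an integral makes the sum of its entries an integral of squared norms.\<close>

lemma schur_product_nonneg:
  fixes u :: "'i \<Rightarrow> 'a::euclidean_space L2" and v :: "'i \<Rightarrow> 'b::euclidean_space L2"
  shows "0 \<le> Re (\<Sum>i\<in>M. \<Sum>j\<in>M. cinner (u i) (u j) * cinner (v j) (v i))"
proof -
  have "\<exists>U. u i = abs_L2 U \<and> square_integrable U" for i by (meson abs_L2_cases)
  then obtain U where U: "\<And>i. u i = abs_L2 (U i)" "\<And>i. square_integrable (U i)" by metis
  define w where "w x = (\<Sum>i\<in>M. cnj (U i x) *\<^sub>C v i)" for x
  have w: "(\<Sum>i\<in>M. \<Sum>j\<in>M. U i x * cnj (U j x) * cinner (v j) (v i)) = of_real ((norm (w x))\<^sup>2)" for x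
    unfolding cinner_self[symmetric] w_def
      bounded_linear.linear[OF bounded_linear_cinner_left, THEN linear_sum]
      bounded_linear.linear[OF bounded_linear_cinner_right, THEN linear_sum]
    by (simp add: cinner_scaleC_left cinner_scaleC_right mult_ac)
  have i: "integrable lborel (\<lambda>x. U i x * cnj (U j x) * cinner (v j) (v i))" for i j
    using integrable_inner_L2[OF U(2)[of i] U(2)[of j]] by (rule integrable_mult_left)
  have "(\<Sum>i\<in>M. \<Sum>j\<in>M. cinner (u i) (u j) * cinner (v j) (v i))
      = (\<Sum>i\<in>M. \<Sum>j\<in>M. \<integral>x. U i x * cnj (U j x) * cinner (v j) (v i) \<partial>lborel)"
    by (simp add: U cinner_abs_L2)
  also have "\<dots> = (\<integral>x. (\<Sum>i\<in>M. \<Sum>j\<in>M. U i x * cnj (U j x) * cinner (v j) (v i)) \<partial>lborel)"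
    using i by simp
  also have "\<dots> = of_real (\<integral>x. (norm (w x))\<^sup>2 \<partial>lborel)"
    unfolding w by (rule integral_complex_of_real)
  finally show ?thesis by simp
qed

context separated_subgroup
begin

definition ball_points :: "real \<Rightarrow> ('a \<times> 'a) set" where
  "ball_points R = \<Lambda> \<inter> cball 0 R"

lemma finite_ball_points [simp]: "finite (ball_points R)"
  unfolding ball_points_def by (rule finite_Int_cball)

lemma card_ball_points_pos: "R \<ge> 0 \<Longrightarrow> card (ball_points R) > 0"
  using zero_mem by (auto simp: card_gt_0_iff) (auto simp: ball_points_def)

text \<open>Polynomial growth forbids the number of points from gaining a fixed factor with every step of length
  \<open>\<rho>\<close>: this is the amenability of \<open>\<Lambda>\<close>, with balls as Folner sets.\<close>

lemma ball_points_folner: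
  assumes rho: "\<rho> > 0" and e: "e > 0"
  shows "\<exists>R\<ge>\<rho>. real (card (ball_points R)) \<le> (1 + e) * real (card (ball_points (R - \<rho>)))"
proof (rule ccontr)
  assume "\<not> ?thesis"
  then have step: "(1 + e) * real (card (ball_points (R - \<rho>))) < real (card (ball_points R))" if "R \<ge> \<rho>" for R
    using that by (meson not_less)
  have lower: "(1 + e) ^ k \<le> real (card (ball_points (real k * \<rho>)))" for k
  proof (induction k)
    case 0
    then show ?case using card_ball_points_pos[of 0] by simp
  next
    case (Suc k)
    have "(1 + e) ^ Suc k \<le> (1 + e) * real (card (ball_points (real k * \<rho>)))"
      using Suc e by (simp add: mult_left_mono)
    also have "\<dots> \<le> real (card (ball_points (real (Suc k) * \<rho>)))"
      using step[of "real (Suc k) * \<rho>"] rho by (simp add: algebra_simps)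
    finally show ?case .
  qed
  define D where "D = DIM('a \<times> 'a)"
  define c where "c = \<rho> / r"
  have c: "c > 0" using rho r_pos by (simp add: c_def)
  have upper: "real (card (ball_points (real k * \<rho>))) \<le> (real k * c + 1) ^ D" for k
  proof -
    have "real (card (ball_points (real k * \<rho>))) \<le> ((real k * \<rho> + r) / r) ^ DIM('a \<times> 'a)"
    proof (rule card_separated_le[OF r_pos])
      show "2 * r \<le> dist X Y" if "X \<in> ball_points (real k * \<rho>)" "Y \<in> ball_points (real k * \<rho>)" "X \<noteq> Y" for X Y
        using that separated unfolding ball_points_def by blast
    qed (use rho in \<open>simp_all add: ball_points_def finite_Int_cball\<close>)
    then show ?thesis using r_pos by (simp add: c_def D_def add_divide_distrib)
  qed
  have "(\<lambda>k. (real k * c + 1) ^ D / (1 + e) ^ k) \<longlonglongrightarrow> 0"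
    using c e by real_asymp
  then have "\<forall>\<^sub>F k in sequentially. (real k * c + 1) ^ D / (1 + e) ^ k < 1"
    by (rule order_tendstoD) simp
  then obtain k where "(real k * c + 1) ^ D / (1 + e) ^ k < 1"
    by (auto simp: eventually_sequentially)
  then have "(real k * c + 1) ^ D < (1 + e) ^ k" using e by (simp add: divide_simps)
  with lower[of k] upper[of k] show False by simp
qed

text \<open>Summing the positive kernel \<open>(\<mu>, \<nu>) \<mapsto> b(\<nu> - \<mu>)\<close> over a large ball gives the number of points of
  the ball times \<open>\<Sum> b\<close>, up to the boundary terms that the Folner property controls.\<close>

lemma sum_positive_kernel_nonneg:
  fixes b :: "'a \<times> 'a \<Rightarrow> complex"
  assumes b: "(\<lambda>X. norm (b X)) summable_on \<Lambda>"
    and pos: "\<And>M. finite M \<Longrightarrow> M \<subseteq> \<Lambda> \<Longrightarrow> 0 \<le> Re (\<Sum>X\<in>M. \<Sum>Y\<in>M. b (Y - X))"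
  shows "0 \<le> Re (infsum b \<Lambda>)"
proof -
  define S where "S = infsum b \<Lambda>"
  define B where "B = (\<Sum>\<^sub>\<infinity>X\<in>\<Lambda>. norm (b X))"
  have S: "(b has_sum S) \<Lambda>" unfolding S_def by (rule has_sum_infsum[OF abs_summable_summable[OF b]])
  have B0: "B \<ge> 0" unfolding B_def by (rule infsum_nonneg) simp
  have B: "norm (sum b A) \<le> B" if "finite A" "A \<subseteq> \<Lambda>" for A
  proof -
    have "norm (sum b A) \<le> (\<Sum>X\<in>A. norm (b X))" by (rule norm_sum)
    also have "\<dots> \<le> B" unfolding B_def by (rule finite_sum_le_infsum[OF b that]) simp
    finally show ?thesis .
  qed
  have bound: "- (e + e * B) \<le> Re S" if e: "e > 0" for e
  proof -
    have "\<forall>\<^sub>F A in finite_subsets_at_top \<Lambda>. dist (sum b A) S < e"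
      using S e unfolding has_sum_def by (rule tendstoD)
    then obtain G where G: "finite G" "G \<subseteq> \<Lambda>"
      and near: "\<And>A. finite A \<Longrightarrow> G \<subseteq> A \<Longrightarrow> A \<subseteq> \<Lambda> \<Longrightarrow> dist (sum b A) S < e"
      by (auto simp: eventually_finite_subsets_at_top)
    define \<rho> where "\<rho> = 1 + (\<Sum>X\<in>G. norm X)"
    have rho: "\<rho> > 0" by (simp add: \<rho>_def add_pos_nonneg sum_nonneg)
    have rhoG: "norm X \<le> \<rho>" if "X \<in> G" for X
      using member_le_sum[OF that, of norm] G by (simp add: \<rho>_def)
    obtain R where R: "R \<ge> \<rho>" "real (card (ball_points R)) \<le> (1 + e) * real (card (ball_points (R - \<rho>)))"
      using ball_points_folner[OF rho e] by blast
    let ?M = "ball_points R" and ?N = "ball_points (R - \<rho>)"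
    have N: "?N \<subseteq> ?M" using rho by (auto simp: ball_points_def)
    have shift: "(\<Sum>Y\<in>?M. b (Y - X)) = sum b ((\<lambda>Y. Y - X) ` ?M)" for X
      by (subst sum.reindex) (auto simp: inj_on_def)
    have sub: "(\<lambda>Y. Y - X) ` ?M \<subseteq> \<Lambda>" if "X \<in> ?M" for X
      by (rule image_subsetI, rule diff_mem) (use that in \<open>simp_all add: ball_points_def\<close>)
    have inner: "Re (\<Sum>Y\<in>?M. b (Y - X)) \<le> Re S + e" if X: "X \<in> ?N" for X
    proof -
      have "G \<subseteq> (\<lambda>Y. Y - X) ` ?M"
      proof
        fix Z assume Z: "Z \<in> G"
        have "norm (Z + X) \<le> \<rho> + (R - \<rho>)"
          using X rhoG[OF Z] by (intro norm_triangle_le add_mono) (auto simp: ball_points_def)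
        moreover have "Z + X \<in> \<Lambda>"
          using Z G X by (intro add_mem) (auto simp: ball_points_def)
        ultimately have "Z + X \<in> ?M" by (simp add: ball_points_def)
        then show "Z \<in> (\<lambda>Y. Y - X) ` ?M" by force
      qed
      then have "dist (\<Sum>Y\<in>?M. b (Y - X)) S < e"
        unfolding shift using X N by (intro near sub) auto
      then show ?thesis
        using abs_Re_le_cmod[of "(\<Sum>Y\<in>?M. b (Y - X)) - S"] by (simp add: dist_norm)
    qed
    have outer: "Re (\<Sum>Y\<in>?M. b (Y - X)) \<le> B" if X: "X \<in> ?M" for X
      using complex_Re_le_cmod[of "\<Sum>Y\<in>?M. b (Y - X)"] B[OF _ sub[OF X]] unfolding shift
      by (meson finite_ball_points finite_imageI order_trans)
    have "0 \<le> Re (\<Sum>X\<in>?M. \<Sum>Y\<in>?M. b (Y - X))"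
      by (rule pos) (auto simp: ball_points_def finite_Int_cball)
    also have "\<dots> = (\<Sum>X\<in>?N. Re (\<Sum>Y\<in>?M. b (Y - X))) + (\<Sum>X\<in>?M - ?N. Re (\<Sum>Y\<in>?M. b (Y - X)))"
      using sum.subset_diff[OF N finite_ball_points, of "\<lambda>X. Re (\<Sum>Y\<in>?M. b (Y - X))"]
      by (simp add: add.commute)
    also have "\<dots> \<le> (\<Sum>X\<in>?N. Re S + e) + (\<Sum>X\<in>?M - ?N. B)"
      by (intro add_mono sum_mono inner outer) auto
    also have "\<dots> = real (card ?N) * (Re S + e) + (real (card ?M) - real (card ?N)) * B"
      using N by (simp add: card_Diff_subset of_nat_diff card_mono)
    also have "\<dots> \<le> real (card ?N) * (Re S + e) + (e * real (card ?N)) * B"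
      using R(2) B0 by (intro add_left_mono mult_right_mono) (auto simp: algebra_simps)
    finally have "0 \<le> real (card ?N) * (Re S + e + e * B)" by (simp add: algebra_simps)
    moreover have "0 < real (card ?N)"
      using card_ball_points_pos[of "R - \<rho>"] R(1) by simp
    ultimately have "0 \<le> Re S + e + e * B"
      unfolding zero_le_mult_iff by linarith
    then show ?thesis by simp
  qed
  have "0 \<le> Re S"
  proof (rule ccontr)
    assume neg: "\<not> 0 \<le> Re S"
    \<comment> \<open>Chosen so that \<open>e + e B\<close> is half of \<open>- Re S\<close>.\<close>
    define e where "e = - Re S / (2 * (1 + B))"
    have "e > 0" unfolding e_def by (rule divide_pos_pos) (use neg B0 in auto)
    moreover have "e + e * B = - Re S / 2"
    proof -
      have "e + e * B = e * (1 + B)" by (simp add: algebra_simps)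
      also have "\<dots> = - Re S / 2" using B0 by (simp add: e_def field_simps)
      finally show ?thesis .
    qed
    ultimately show False using bound[of e] neg by simp
  qed
  then show ?thesis by (simp add: S_def)
qed

text \<open>The two cocycle phases in \<open>b(\<nu> - \<mu>)\<close> are conjugate and cancel, which leaves a product of Gram matrices.\<close>

theorem S0_inner_nonneg:
  assumes f: "f \<in> feichtinger"
  shows "0 \<le> Re (cinner (blinfun_apply (S0_inner \<Lambda> f f) h) h)"
proof -
  define b where "b X = stft f f X * cinner (blinfun_apply (tf_shift X) h) h" for X
  have "(b has_sum cinner (blinfun_apply (S0_inner \<Lambda> f f) h) h) \<Lambda>"
    using has_sum_bounded_linear[OF bounded_linear_cinner_left
        has_sum_bounded_linear[OF blinfun.bounded_linear_left[of h] S0_inner_has_sum[OF f f]], of h]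
    by (simp add: b_def[abs_def] cinner_scaleC_left)
  then have sum: "infsum b \<Lambda> = cinner (blinfun_apply (S0_inner \<Lambda> f f) h) h" by (rule infsumI)
  have summable: "(\<lambda>X. norm (b X)) summable_on \<Lambda>"
  proof (rule Infinite_Sum.abs_summable_on_comparison_test'[of "\<lambda>X. norm (stft f f X) * (norm h * norm h)"])
    show "(\<lambda>X. norm (stft f f X) * (norm h * norm h)) summable_on \<Lambda>"
      using stft_summable[OF f f] by (intro summable_on_cmult_left) (simp add: l1_def)
    show "norm (b X) \<le> norm (stft f f X) * (norm h * norm h)" for X
      using norm_cinner_le[of "blinfun_apply (tf_shift X) h" h]
      by (simp add: b_def norm_mult mult_left_mono)
  qed
  have "0 \<le> Re (\<Sum>X\<in>M. \<Sum>Y\<in>M. b (Y - X))" for M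
  proof -
    have "b (Y - X) = cinner (blinfun_apply (tf_shift X) f) (blinfun_apply (tf_shift Y) f)
        * cinner (blinfun_apply (tf_shift Y) h) (blinfun_apply (tf_shift X) h)" for X Y
    proof -
      have Y: "blinfun_apply (tf_shift Y) k
          = cnj (cocycle X (Y - X)) *\<^sub>C blinfun_apply (tf_shift X) (blinfun_apply (tf_shift (Y - X)) k)" for k
        using tf_shift_add[of X "Y - X"] by simp
      show ?thesis
        by (simp add: Y cinner_scaleC_left cinner_scaleC_right b_def stft_def mult_ac)
    qed
    then show ?thesis using schur_product_nonneg[where M=M] by simp
  qed
  then show ?thesis using sum_positive_kernel_nonneg[OF summable] by (simp add: sum)
qed

end

section \<open>From positive numerical range to positive spectrum\<close>

text \<open>If \<open>Q\<close> is bounded below in the numerical sense then \<open>1 - tQ\<close> is a contraction for small \<open>t > 0\<close>, and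
  the fixed point equations \<open>S = (1 - tQ) S + t\<close> and \<open>S = S (1 - tQ) + t\<close> produce one-sided inverses inside
  any closed algebra containing \<open>Q\<close>.\<close>

lemma invertible_if_numerically_coercive:
  fixes A :: "'a::euclidean_space op set"
  assumes "star_algebra A" "closed A" and Q: "Q \<in> A" and d: "d > 0"
    and coercive: "\<And>h. d * (norm h)\<^sup>2 \<le> Re (cinner (blinfun_apply Q h) h)"
  shows "\<exists>S\<in>A. S o\<^sub>L Q = id_blinfun \<and> Q o\<^sub>L S = id_blinfun"
proof -
  interpret star_algebra A by fact
  define m where "m = norm Q + d"
  have m: "m > 0" "norm Q \<le> m" "d \<le> m" using d by (auto simp: m_def add_nonneg_pos)
  \<comment> \<open>The minimum of \<open>1 - 2td + t\<^sup>2m\<^sup>2\<close>, which bounds \<open>\<parallel>1 - tQ\<parallel>\<^sup>2\<close>, is attained at this \<open>t\<close>.\<close>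
  define t where "t = d / m\<^sup>2"
  have t: "t > 0" using d m by (simp add: t_def)
  define N where "N = id_blinfun - t *\<^sub>R Q"
  have N: "N \<in> A" "t *\<^sub>R id_blinfun \<in> A"
    unfolding N_def scale_op_of_real[symmetric] by (intro diff_in one_mem scale_mem Q)+
  define q where "q = sqrt (1 - d\<^sup>2 / m\<^sup>2)"
  have q: "0 \<le> q" "q < 1" "q\<^sup>2 = 1 - d\<^sup>2 / m\<^sup>2"
    using m d by (auto simp: q_def divide_le_eq_1 power_mono)
  have "norm N \<le> q"
  proof (rule norm_blinfun_bound[OF q(1)])
    fix h
    have "(norm (blinfun_apply N h))\<^sup>2 = (norm h)\<^sup>2 - 2 * t * Re (cinner (blinfun_apply Q h) h) + t\<^sup>2 * (norm (blinfun_apply Q h))\<^sup>2"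
      unfolding N_def power2_norm_eq_inner Re_cinner
      by (simp add: blinfun.diff_left blinfun.scaleR_left inner_diff_left inner_diff_right
          inner_commute power2_eq_square algebra_simps)
    also have "\<dots> \<le> (norm h)\<^sup>2 - 2 * t * (d * (norm h)\<^sup>2) + t\<^sup>2 * (m * norm h)\<^sup>2"
      using coercive[of h] t order_trans[OF norm_blinfun[of Q h] mult_right_mono[OF m(2), of "norm h"]]
      by (intro add_mono diff_mono mult_left_mono power_mono) auto
    also have "\<dots> = (q * norm h)\<^sup>2"
      unfolding power_mult_distrib q(3) using m by (simp add: t_def field_simps power2_eq_square)
    finally show "norm (blinfun_apply N h) \<le> q * norm h"
      by (rule power2_le_imp_le) (use q(1) in simp)
  qed
  then have N1: "norm N < 1" using q by simp
  have fixpoint: "\<exists>!S. S \<in> A \<and> F S = S"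
    if "\<And>S. S \<in> A \<Longrightarrow> F S \<in> A" "\<And>S S'. dist (F S) (F S') \<le> norm N * dist S S'" for F
    using Banach_fix[of A "norm N" F] \<open>closed A\<close> one_mem that N1
    by (auto simp: complete_eq_closed)
  have "\<exists>!S. S \<in> A \<and> (N o\<^sub>L S) + t *\<^sub>R id_blinfun = S"
  proof (rule fixpoint)
    show "dist ((N o\<^sub>L S) + t *\<^sub>R id_blinfun) ((N o\<^sub>L S') + t *\<^sub>R id_blinfun) \<le> norm N * dist S S'" for S S'
      using norm_blinfun_compose[of N "S - S'"]
      by (simp add: dist_norm bounded_bilinear.diff_right[OF bounded_bilinear_blinfun_compose])
  qed (intro add_mem compose_mem N)
  then obtain S where S: "S \<in> A" "(N o\<^sub>L S) + t *\<^sub>R id_blinfun = S" by blast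
  have "\<exists>!S. S \<in> A \<and> (S o\<^sub>L N) + t *\<^sub>R id_blinfun = S"
  proof (rule fixpoint)
    show "dist ((S o\<^sub>L N) + t *\<^sub>R id_blinfun) ((S' o\<^sub>L N) + t *\<^sub>R id_blinfun) \<le> norm N * dist S S'" for S S'
      using norm_blinfun_compose[of "S - S'" N]
      by (simp add: dist_norm bounded_bilinear.diff_left[OF bounded_bilinear_blinfun_compose] mult.commute)
  qed (intro add_mem compose_mem N)
  then obtain S' where S': "(S' o\<^sub>L N) + t *\<^sub>R id_blinfun = S'" by blast
  have "t *\<^sub>R blinfun_apply Q (blinfun_apply S h) = t *\<^sub>R h" for h
    using arg_cong[OF S(2), of "\<lambda>T. blinfun_apply T h"]
    by (auto simp: N_def blinfun.diff_left blinfun.add_left blinfun.scaleR_left)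
  then have "blinfun_apply Q (blinfun_apply S h) = h" for h
    using t by (metis less_irrefl scaleR_cancel_left)
  then have QS: "Q o\<^sub>L S = id_blinfun" by (intro blinfun_eqI) simp
  have "t *\<^sub>R blinfun_apply S' (blinfun_apply Q h) = t *\<^sub>R h" for h
    using arg_cong[OF S', of "\<lambda>T. blinfun_apply T h"]
    by (auto simp: N_def blinfun.diff_left blinfun.add_left blinfun.scaleR_left blinfun.diff_right blinfun.scaleR_right)
  then have "blinfun_apply S' (blinfun_apply Q h) = h" for h
    using t by (metis less_irrefl scaleR_cancel_left)
  then have SQ: "S' o\<^sub>L Q = id_blinfun" by (intro blinfun_eqI) simp
  have "S' = S' o\<^sub>L (Q o\<^sub>L S)" by (rule blinfun_eqI) (simp add: QS)
  also have "\<dots> = (S' o\<^sub>L Q) o\<^sub>L S" by (rule blinfun_eqI) simp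
  also have "\<dots> = S" by (rule blinfun_eqI) (simp add: SQ)
  finally have "S' = S" .
  with S QS SQ show ?thesis by blast
qed

text \<open>Off the half-line \<open>[0, \<infinity>)\<close> one of the multiples of \<open>T - z\<close> by \<open>i\<close>, \<open>-i\<close>, \<open>1\<close> is numerically coercive.\<close>

lemma positive_in_if_numerically_positive:
  fixes A :: "'a::euclidean_space op set"
  assumes A: "star_algebra A" "closed A" and T: "T \<in> A" and self: "adjoint_pair T T"
    and pos: "\<And>h. 0 \<le> Re (cinner (blinfun_apply T h) h)"
  shows "positive_in A T"
proof -
  interpret star_algebra A by fact
  have "z \<notin> spectrum_in A T" if z: "z \<notin> \<real>\<^sub>\<ge>\<^sub>0" for z
  proof -
    define W where "W = T - scale_op z id_blinfun"
    have W: "W \<in> A" unfolding W_def by (intro diff_in T scale_mem one_mem)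
    have im: "Im (cinner (blinfun_apply T h) h) = 0" for h
      using cinner_commute[of "blinfun_apply T h" h] adjoint_pairD[OF self, of h h]
      by (simp add: complex_eq_iff)
    have Wh: "cinner (blinfun_apply W h) h = cinner (blinfun_apply T h) h - z * of_real ((norm h)\<^sup>2)" for h
      by (simp add: W_def blinfun.diff_left cinner_diff_left cinner_scaleC_left cinner_self del: of_real_power)
    obtain c d where cd: "d > 0" "\<And>h. d * (norm h)\<^sup>2 \<le> Re (c * cinner (blinfun_apply W h) h)"
    proof -
      consider "Im z > 0" | "Im z < 0" | "Re z < 0"
        using z by (auto simp: complex_nonneg_Reals_iff) linarith
      then show ?thesis
      proof cases
        case 1
        then show ?thesis by (intro that[of "Im z" \<i>]) (auto simp: Wh im)
      next
        case 2
        then show ?thesis by (intro that[of "- Im z" "- \<i>"]) (auto simp: Wh im)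
      next
        case 3
        then show ?thesis using pos by (intro that[of "- Re z" 1]) (auto simp: Wh)
      qed
    qed
    obtain S where S: "S \<in> A" "S o\<^sub>L scale_op c W = id_blinfun" "scale_op c W o\<^sub>L S = id_blinfun"
      using invertible_if_numerically_coercive[OF A scale_mem[OF W] cd(1), of c] cd(2)
      by (auto simp: cinner_scaleC_left)
    have "scale_op c S o\<^sub>L W = id_blinfun"
      unfolding S(2)[symmetric] using complex_linear[OF S(1)] by (intro blinfun_eqI) simp
    moreover have "W o\<^sub>L scale_op c S = id_blinfun"
      unfolding S(3)[symmetric] using complex_linear[OF W] by (intro blinfun_eqI) simp
    ultimately show ?thesis
      using scale_mem[OF S(1), of c] by (auto simp: spectrum_in_def W_def)
  qed
  then show ?thesis using T cadj_eqI[OF self] by (auto simp: positive_in_def)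
qed

section \<open>Faithfulness\<close>

text \<open>The character \<open>e\<^sup>2\<^sup>\<pi>\<^sup>i\<^sup>\<sigma>\<close> of the symplectic form \<open>\<sigma>(Z, X)\<close> on phase space.\<close>

definition commutator_phase :: "'a::euclidean_space \<times> 'a \<Rightarrow> 'a \<times> 'a \<Rightarrow> complex" where
  "commutator_phase Z X = cocycle Z X * cnj (cocycle X Z)"

lemma tf_shift_commute:
  "tf_shift Z o\<^sub>L tf_shift X = scale_op (commutator_phase Z X) (tf_shift X) o\<^sub>L tf_shift Z"
  by (simp add: scale_op_compose_left tf_shift_compose scale_op_scale_op commutator_phase_def
      add.commute mult.assoc)

lemma norm_commutator_phase [simp]: "norm (commutator_phase Z X) = 1"
  by (simp add: commutator_phase_def norm_mult)

lemma commutator_phase_0 [simp]: "commutator_phase Z 0 = 1"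
  by (simp add: commutator_phase_def cocycle_def)

text \<open>The symplectic form is nondegenerate, so some shift anticommutes with \<open>\<pi>(Y)\<close>.\<close>

lemma anticommuting_shift_ex:
  assumes "Y \<noteq> 0"
  shows "\<exists>Z. commutator_phase Z Y = -1"
proof -
  obtain x \<omega> where Y: "Y = (x, \<omega>)" by (cases Y)
  define s where "s = x \<bullet> x + \<omega> \<bullet> \<omega>"
  have s: "s \<noteq> 0" using assms by (auto simp: s_def Y zero_prod_def add_nonneg_eq_0_iff)
  \<comment> \<open>The symplectic partner of \<open>Y\<close>, scaled so that \<open>\<sigma>(Z, Y) = 1/2\<close>.\<close>
  define Z where "Z = ((- 1 / (2 * s)) *\<^sub>R \<omega>, (1 / (2 * s)) *\<^sub>R x)"
  have "commutator_phase Z Y = character (- (\<omega> \<bullet> fst Z) + snd Z \<bullet> x)"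
    by (simp add: commutator_phase_def cocycle_def cnj_character Y flip: character_add)
  also have "- (\<omega> \<bullet> fst Z) + snd Z \<bullet> x = 1 / 2"
  proof -
    have "- (\<omega> \<bullet> fst Z) + snd Z \<bullet> x = (x \<bullet> x + \<omega> \<bullet> \<omega>) / (2 * s)"
      by (simp add: Z_def add_divide_distrib)
    then show ?thesis using s by (simp add: s_def[symmetric])
  qed
  finally have "commutator_phase Z Y = -1" by simp
  then show ?thesis by (rule exI)
qed

context separated_subgroup
begin

text \<open>Averaging a vanishing series with its conjugate by an anticommuting shift removes one coefficient,
  keeps the one at \<open>0\<close>, and increases none.\<close>

lemma l1_op_zero_average:
  assumes a: "a \<in> l1 \<Lambda>" "l1_op \<Lambda> a = 0"
  shows "(\<lambda>X. (1 + commutator_phase Z X) / 2 * a X) \<in> l1 \<Lambda>"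
    and "l1_op \<Lambda> (\<lambda>X. (1 + commutator_phase Z X) / 2 * a X) = 0"
    and "norm ((1 + commutator_phase Z X) / 2 * a X) \<le> norm (a X)"
proof -
  let ?a = "\<lambda>X. (1 + commutator_phase Z X) / 2 * a X"
  show le: "norm (?a X) \<le> norm (a X)" for X
  proof -
    have "norm ((1 + commutator_phase Z X) / 2) \<le> 1"
      using norm_triangle_ineq[of 1 "commutator_phase Z X"] by (simp add: norm_divide)
    then show ?thesis unfolding norm_mult by (intro mult_left_le_one_le) auto
  qed
  show a': "?a \<in> l1 \<Lambda>"
    using a(1) unfolding l1_def mem_Collect_eq
    by (rule Infinite_Sum.abs_summable_on_comparison_test') (rule le)
  have "(\<lambda>X. commutator_phase Z X * a X) \<in> l1 \<Lambda>"
    using a(1) by (simp add: l1_def norm_mult)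
  then have c: "((\<lambda>X. scale_op (commutator_phase Z X * a X) (tf_shift X)) has_sum l1_op \<Lambda> (\<lambda>X. commutator_phase Z X * a X)) \<Lambda>"
    by (rule l1_op_has_sum)
  have "((\<lambda>X. tf_shift Z o\<^sub>L scale_op (a X) (tf_shift X)) has_sum (tf_shift Z o\<^sub>L l1_op \<Lambda> a)) \<Lambda>"
    by (rule has_sum_bounded_linear[OF bounded_bilinear.bounded_linear_right[OF bounded_bilinear_blinfun_compose] l1_op_has_sum[OF a(1)]])
  moreover have "tf_shift Z o\<^sub>L scale_op (a X) (tf_shift X) = scale_op (commutator_phase Z X * a X) (tf_shift X) o\<^sub>L tf_shift Z" for X
  proof (rule blinfun_eqI)
    fix h
    show "blinfun_apply (tf_shift Z o\<^sub>L scale_op (a X) (tf_shift X)) h = blinfun_apply (scale_op (commutator_phase Z X * a X) (tf_shift X) o\<^sub>L tf_shift Z) h"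
      using arg_cong[OF tf_shift_commute[of Z X], of "\<lambda>T. blinfun_apply T h"]
      by (simp add: tf_shift_scaleC scaleC_scaleC mult.commute)
  qed
  ultimately have s0: "((\<lambda>X. scale_op (commutator_phase Z X * a X) (tf_shift X) o\<^sub>L tf_shift Z) has_sum 0) \<Lambda>"
    using a(2) by simp
  have s1: "((\<lambda>X. scale_op (commutator_phase Z X * a X) (tf_shift X) o\<^sub>L tf_shift Z) has_sum
      (l1_op \<Lambda> (\<lambda>X. commutator_phase Z X * a X) o\<^sub>L tf_shift Z)) \<Lambda>"
    by (rule has_sum_bounded_linear[OF bounded_bilinear.bounded_linear_left[OF bounded_bilinear_blinfun_compose] c])
  have z: "l1_op \<Lambda> (\<lambda>X. commutator_phase Z X * a X) o\<^sub>L tf_shift Z = 0"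
    by (rule has_sum_unique[OF s1 s0])
  have "l1_op \<Lambda> (\<lambda>X. commutator_phase Z X * a X) = 0"
  proof (rule blinfun_eqI)
    fix h
    define k where "k = blinfun_apply (tf_shift (- Z)) (cnj (cocycle Z (- Z)) *\<^sub>C h)"
    have "blinfun_apply (tf_shift Z) k = h"
      using arg_cong[OF tf_shift_compose[of Z "- Z"], of "\<lambda>T. blinfun_apply T (cnj (cocycle Z (- Z)) *\<^sub>C h)"]
      by (simp add: k_def scaleC_scaleC)
    then show "blinfun_apply (l1_op \<Lambda> (\<lambda>X. commutator_phase Z X * a X)) h = blinfun_apply 0 h"
      using arg_cong[OF z, of "\<lambda>T. blinfun_apply T k"] by simp
  qed
  with c have "((\<lambda>X. scale_op (1/2) (scale_op (a X) (tf_shift X) + scale_op (commutator_phase Z X * a X) (tf_shift X)))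
      has_sum scale_op (1/2) (0 + 0)) \<Lambda>"
    using l1_op_has_sum[OF a(1)] a(2)
    by (intro has_sum_bounded_linear[OF bounded_linear_scale_op_right] has_sum_add) auto
  moreover have "scale_op (1/2) (scale_op (a X) (tf_shift X) + scale_op (commutator_phase Z X * a X) (tf_shift X))
      = scale_op (?a X) (tf_shift X)" for X
    by (simp add: scale_op_add_left[symmetric] scale_op_scale_op algebra_simps add_divide_distrib)
  ultimately have "((\<lambda>X. scale_op (?a X) (tf_shift X)) has_sum 0) \<Lambda>" by simp
  then show "l1_op \<Lambda> ?a = 0" unfolding l1_op_def by (rule infsumI)
qed

lemma l1_op_zero_kill:
  assumes "finite G" "0 \<notin> G" and a: "a \<in> l1 \<Lambda>" "l1_op \<Lambda> a = 0"
  shows "\<exists>a'\<in>l1 \<Lambda>. l1_op \<Lambda> a' = 0 \<and> a' 0 = a 0 \<and> (\<forall>X\<in>G. a' X = 0) \<and> (\<forall>X. norm (a' X) \<le> norm (a X))"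
  using assms(1,2)
proof (induction G rule: finite_induct)
  case empty
  then show ?case using a by (intro bexI[of _ a]) auto
next
  case (insert Y G)
  then obtain a' where a': "a' \<in> l1 \<Lambda>" "l1_op \<Lambda> a' = 0" "a' 0 = a 0" "\<And>X. X \<in> G \<Longrightarrow> a' X = 0"
      "\<And>X. norm (a' X) \<le> norm (a X)"
    by auto
  obtain Z where Z: "commutator_phase Z Y = -1"
    using anticommuting_shift_ex[of Y] insert.prems by auto
  show ?case
  proof (intro bexI[of _ "\<lambda>X. (1 + commutator_phase Z X) / 2 * a' X"] conjI ballI allI)
    show "(1 + commutator_phase Z X) / 2 * a' X = 0" if "X \<in> insert Y G" for X
      using that Z a'(4)[of X] by (cases "X = Y") simp_all
    show "norm ((1 + commutator_phase Z X) / 2 * a' X) \<le> norm (a X)" for X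
      using l1_op_zero_average(3)[OF a'(1,2)] a'(5) by (rule order_trans)
  qed (use l1_op_zero_average(1,2)[OF a'(1,2), of Z] a'(3) in simp_all)
qed

lemma has_sum_minus_finite:
  fixes f :: "'i \<Rightarrow> 'b::real_normed_vector"
  assumes s: "(f has_sum s) A" and H: "finite H" "H \<subseteq> A"
  shows "(f has_sum (s - sum f H)) (A - H)"
proof -
  have "f summable_on (A - H)"
    using s H(1) by (intro summable_on_cofin_subset) (auto simp: summable_on_def)
  then have t: "(f has_sum infsum f (A - H)) (A - H)" by (rule has_sum_infsum)
  have "(f has_sum (infsum f (A - H) + sum f H)) ((A - H) \<union> H)"
    by (rule has_sum_Un_disjoint[OF t has_sum_finite[OF H(1)]]) auto
  moreover have "(A - H) \<union> H = A" using H(2) by blast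
  ultimately have "s = infsum f (A - H) + sum f H" using s has_sum_unique by metis
  then show ?thesis using t by simp
qed

text \<open>After the coefficients on a large finite set are removed, \<open>a(0)\<close> times the identity equals minus the
  remaining part of the series, whose norm is at most a tail of \<open>\<Sum> \<bar>a\<bar>\<close>.\<close>

lemma l1_op_zero_coefficient:
  assumes a: "a \<in> l1 \<Lambda>" "l1_op \<Lambda> a = 0"
  shows "a 0 = 0"
proof -
  have "norm (a 0) \<le> e" if e: "e > 0" for e
  proof -
    have an: "(\<lambda>X. norm (a X)) summable_on \<Lambda>" using a by (simp add: l1_def)
    obtain G where G: "finite G" "G \<subseteq> \<Lambda>" and tail: "dist (\<Sum>X\<in>G. norm (a X)) (\<Sum>\<^sub>\<infinity>X\<in>\<Lambda>. norm (a X)) \<le> e"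
      using infsum_finite_approximation[OF an e] by blast
    define H where "H = insert 0 G"
    have H: "finite H" "H \<subseteq> \<Lambda>" using G zero_mem by (auto simp: H_def)
    obtain a' where a': "a' \<in> l1 \<Lambda>" "l1_op \<Lambda> a' = 0" "a' 0 = a 0" "\<And>X. X \<in> G - {0} \<Longrightarrow> a' X = 0"
        "\<And>X. norm (a' X) \<le> norm (a X)"
      using l1_op_zero_kill[of "G - {0}" a] G a by auto
    have sH: "(\<Sum>X\<in>H. scale_op (a' X) (tf_shift X)) = scale_op (a 0) id_blinfun"
    proof -
      have "(\<Sum>X\<in>H. scale_op (a' X) (tf_shift X)) = (\<Sum>X\<in>{0}. scale_op (a' X) (tf_shift X))"
        using H(1) a'(4) by (intro sum.mono_neutral_right) (auto simp: H_def)
      then show ?thesis by (simp add: a'(3))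
    qed
    have s1: "((\<lambda>X. scale_op (a' X) (tf_shift X)) has_sum (0 - scale_op (a 0) id_blinfun)) (\<Lambda> - H)"
      using has_sum_minus_finite[OF l1_op_has_sum[OF a'(1)] H]
      by (simp add: sH a'(2))
    have s2: "((\<lambda>X. norm (a X)) has_sum ((\<Sum>\<^sub>\<infinity>X\<in>\<Lambda>. norm (a X)) - (\<Sum>X\<in>H. norm (a X)))) (\<Lambda> - H)"
      using has_sum_minus_finite[OF has_sum_infsum[OF an] H] .
    have "norm (0 - scale_op (a 0) (id_blinfun :: 'a op)) \<le> (\<Sum>\<^sub>\<infinity>X\<in>\<Lambda>. norm (a X)) - (\<Sum>X\<in>H. norm (a X))"
    proof (rule norm_infsum_le[OF s1 s2])
      show "norm (scale_op (a' X) (tf_shift X)) \<le> norm (a X)" for X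
        using mult_left_mono[OF norm_tf_shift_le[of X], of "norm (a' X)"] a'(5)[of X]
        by (simp add: norm_scale_op)
    qed
    also have "(\<Sum>X\<in>G. norm (a X)) \<le> (\<Sum>X\<in>H. norm (a X))"
      using H by (intro sum_mono2) (auto simp: H_def)
    then have "(\<Sum>\<^sub>\<infinity>X\<in>\<Lambda>. norm (a X)) - (\<Sum>X\<in>H. norm (a X)) \<le> e"
      using tail by (simp add: dist_real_def)
    finally have n: "norm (scale_op (a 0) (id_blinfun :: 'a op)) \<le> e" by simp
    have "norm (a 0) * norm (gaussian :: 'a L2) = norm (blinfun_apply (scale_op (a 0) id_blinfun) (gaussian :: 'a L2))"
      by (simp add: norm_scaleC)
    also have "\<dots> \<le> norm (scale_op (a 0) (id_blinfun :: 'a op)) * norm (gaussian :: 'a L2)"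
      by (rule norm_blinfun)
    also have "\<dots> \<le> e * norm (gaussian :: 'a L2)" using n by (rule mult_right_mono) simp
    finally show ?thesis using norm_gaussian_pos[where 'a='a] by simp
  qed
  then have "norm (a 0) \<le> 0" by (rule field_le_epsilon[of _ 0, simplified])
  then show ?thesis by simp
qed

lemma S0_inner_nonzero:
  assumes "f \<in> feichtinger" "f \<noteq> 0"
  shows "S0_inner \<Lambda> f f \<noteq> 0"
proof
  assume "S0_inner \<Lambda> f f = 0"
  then have "stft f f 0 = 0"
    using l1_op_zero_coefficient[OF stft_summable[OF assms(1) assms(1)]] by (simp add: S0_inner_eq_l1_op)
  then show False using assms(2) by (simp add: stft_def cinner_self)
qed

end

section \<open>The norm of an inner product module\<close>

lemma tendsto_double_sequence:
  fixes h :: "nat \<Rightarrow> nat \<Rightarrow> real"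
  shows "((\<lambda>(m, n). h m n) \<longlongrightarrow> 0) (sequentially \<times>\<^sub>F sequentially)
    \<longleftrightarrow> (\<forall>e>0. \<exists>N. \<forall>m\<ge>N. \<forall>n\<ge>N. \<bar>h m n\<bar> < e)"
  unfolding tendsto_iff
  by (simp add: case_prod_unfold dist_real_def eventually_prod_sequentially) blast

text \<open>The closed algebra \<open>A\<close> need not act on \<open>V\<close>, so the values of the inner product are required to lie in the
  dense subalgebra \<open>B\<close> that does; the proof of Cauchy--Schwarz lets them act. Positivity is demanded in the
  numerical sense, which passes to limits, whereas positivity of the spectrum is recovered at the end.\<close>

locale pre_hilbert_module = inner_product_module A B V act ip
  for A B :: "'a::euclidean_space op set"
    and V :: "('m, 'z) complex_space_scheme"
    and act :: "'a op \<Rightarrow> 'm \<Rightarrow> 'm"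
    and ip :: "'m \<Rightarrow> 'm \<Rightarrow> 'a op" +
  assumes closure_B: "A = closure B"
    and ip_mem: "x \<in> vcarrier V \<Longrightarrow> y \<in> vcarrier V \<Longrightarrow> ip x y \<in> B"
    and ip_nonneg: "x \<in> vcarrier V \<Longrightarrow> 0 \<le> Re (cinner (blinfun_apply (ip x x) h) h)"
begin

declare zero_closed [simp] add_closed [simp] scale_closed [simp] act_closed [simp]
  ip_add_left [simp] ip_scale_left [simp] ip_add_right [simp] ip_scale_right [simp]

definition vminus :: "'m \<Rightarrow> 'm \<Rightarrow> 'm" where
  "vminus x y = vadd V x (vscale V (-1) y)"

abbreviation nrm :: "'m \<Rightarrow> real" where "nrm \<equiv> ip_norm ip"
abbreviation dst :: "'m \<Rightarrow> 'm \<Rightarrow> real" where "dst \<equiv> ip_dist V ip"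

lemma dst_eq: "dst x y = nrm (vminus x y)"
  by (simp add: ip_dist_def vminus_def)

lemma vminus_closed [simp]: "x \<in> vcarrier V \<Longrightarrow> y \<in> vcarrier V \<Longrightarrow> vminus x y \<in> vcarrier V"
  by (simp add: vminus_def)

lemma ip_minus_left [simp]:
  "x \<in> vcarrier V \<Longrightarrow> y \<in> vcarrier V \<Longrightarrow> z \<in> vcarrier V \<Longrightarrow> ip (vminus x y) z = ip x z - ip y z"
  by (simp add: vminus_def scale_op_minus1)

lemma ip_minus_right [simp]:
  "x \<in> vcarrier V \<Longrightarrow> y \<in> vcarrier V \<Longrightarrow> z \<in> vcarrier V \<Longrightarrow> ip z (vminus x y) = ip z x - ip z y"
  by (simp add: vminus_def scale_op_minus1)

lemma ip_zero_left [simp]: "y \<in> vcarrier V \<Longrightarrow> ip (vzero V) y = 0"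
  using ip_add_left[of "vzero V" "vzero V" y] add_zero[of "vzero V"] by simp

lemma ip_zero_right [simp]: "y \<in> vcarrier V \<Longrightarrow> ip y (vzero V) = 0"
  using ip_add_right[of y "vzero V" "vzero V"] add_zero[of "vzero V"] by simp

lemma ip_self_zero: "x \<in> vcarrier V \<Longrightarrow> ip x x = 0 \<Longrightarrow> x = vzero V"
  using ip_pos[of x] by blast

lemma vminus_zero_imp_eq:
  assumes x: "x \<in> vcarrier V" "y \<in> vcarrier V" and d: "vminus x y = vzero V"
  shows "x = y"
proof -
  have "x = vadd V x (vadd V (vscale V (-1) y) y)"
    using x add_neg[of y] add_commute[of y "vscale V (-1) y"] add_zero[of x] by simp
  also have "\<dots> = vadd V (vminus x y) y"
    using x by (simp add: add_assoc vminus_def)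
  also have "\<dots> = y" using x add_zero[of y] add_commute[of "vzero V" y] by (simp add: d)
  finally show ?thesis .
qed

text \<open>Vectors are determined by their inner products, which turns identities in \<open>V\<close> into identities
  between operators.\<close>

lemma ip_ext:
  assumes x: "x \<in> vcarrier V" "y \<in> vcarrier V" and e: "\<And>z. z \<in> vcarrier V \<Longrightarrow> ip x z = ip y z"
  shows "x = y"
proof (rule vminus_zero_imp_eq[OF x], rule ip_self_zero)
  have "vminus x y \<in> vcarrier V" using x by simp
  then show "ip (vminus x y) (vminus x y) = 0"
    using x by (subst ip_minus_left) (auto simp: e)
qed (use x in simp)

lemma ip_adjoint_pair: "x \<in> vcarrier V \<Longrightarrow> y \<in> vcarrier V \<Longrightarrow> adjoint_pair (ip x y) (ip y x)"
  using adjoint_pair_cadj[OF ip_mem, of x y] ip_adj[of y x] by simp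

lemma star_algebra_A: "star_algebra A"
  unfolding closure_B by (rule star_algebra_closure) unfold_locales

lemma closed_A: "closed A"
  unfolding closure_B by simp

lemma nrm_nonneg [simp]: "0 \<le> nrm x"
  by (simp add: ip_norm_def)

lemma nrm_square: "(nrm x)\<^sup>2 = norm (ip x x)"
  by (simp add: ip_norm_def)

lemma nrm_zero [simp]: "nrm (vzero V) = 0"
  by (simp add: ip_norm_def)

text \<open>Cauchy--Schwarz: expand \<open>\<langle>y', y'\<rangle> \<ge> 0\<close> for \<open>y' = y - \<parallel>\<langle>x, x\<rangle>\<parallel>\<^sup>-\<^sup>1 \<langle>y, x\<rangle> x\<close>, which makes sense because the
  values of the inner product act on \<open>V\<close>.\<close>

lemma cauchy_schwarz:
  assumes x: "x \<in> vcarrier V" and y: "y \<in> vcarrier V"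
  shows "norm (ip x y) \<le> nrm x * nrm y"
proof (cases "ip x x = 0")
  case True
  then have "x = vzero V" using x by (rule ip_self_zero[rotated])
  then show ?thesis using y by simp
next
  case False
  define \<alpha> where "\<alpha> = norm (ip x x)"
  have a: "\<alpha> > 0" using False by (simp add: \<alpha>_def)
  define T where "T = scale_op (of_real (- (1 / \<alpha>))) (ip y x)"
  have T: "T \<in> B" unfolding T_def by (intro scale_mem ip_mem x y)
  define T' where "T' = scale_op (of_real (- (1 / \<alpha>))) (ip x y)"
  have TT': "adjoint_pair T T'"
    using adjoint_pair_scale[OF ip_adjoint_pair[OF y x], of "of_real (- (1 / \<alpha>))"] by (simp add: T_def T'_def)
  have Tx: "act T x \<in> vcarrier V" using T x by simp
  have pointwise: "(norm (blinfun_apply (ip x y) h))\<^sup>2 \<le> \<alpha> * (norm (ip y y) * (norm h)\<^sup>2)" for h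
  proof -
    define k where "k = blinfun_apply (ip x y) h"
    have T'h: "blinfun_apply T' h = of_real (- (1 / \<alpha>)) *\<^sub>C k" by (simp add: T'_def k_def)
    have 1: "Re (cinner (blinfun_apply (ip (act T x) (act T x)) h) h) \<le> (norm k)\<^sup>2 / \<alpha>"
    proof -
      have "cinner (blinfun_apply (ip (act T x) (act T x)) h) h
          = cinner (blinfun_apply (ip x (act T x)) h) (blinfun_apply T' h)"
        using T x Tx by (simp add: ip_act adjoint_pairD[OF TT'])
      also have "\<dots> = cinner h (blinfun_apply (ip (act T x) x) (blinfun_apply T' h))"
        using ip_adjoint_pair[OF x Tx] by (rule adjoint_pairD)
      also have "\<dots> = cinner (blinfun_apply T' h) (blinfun_apply (ip x x) (blinfun_apply T' h))"
        using T x by (simp add: ip_act adjoint_pairD[OF adjoint_pair_sym[OF TT']])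
      finally have "Re (cinner (blinfun_apply (ip (act T x) (act T x)) h) h)
          \<le> norm (blinfun_apply T' h) * norm (blinfun_apply (ip x x) (blinfun_apply T' h))"
        using complex_Re_le_cmod norm_cinner_le order_trans by metis
      also have "\<dots> \<le> norm (blinfun_apply T' h) * (\<alpha> * norm (blinfun_apply T' h))"
        unfolding \<alpha>_def by (intro mult_left_mono norm_blinfun) simp
      also have "\<dots> = (norm k)\<^sup>2 / \<alpha>"
        using a unfolding T'h by (simp add: norm_scaleC power2_eq_square norm_divide)
      finally show ?thesis .
    qed
    have 2: "cinner (blinfun_apply (ip (act T x) y) h) h = of_real (- ((norm k)\<^sup>2 / \<alpha>))"
    proof -
      have "cinner (blinfun_apply (ip (act T x) y) h) h = cinner k (blinfun_apply T' h)"
        using T x y by (simp add: ip_act adjoint_pairD[OF TT'] k_def)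
      then show ?thesis by (simp add: T'h cinner_scaleC_right cinner_self del: of_real_power)
    qed
    have 3: "cinner (blinfun_apply (ip y (act T x)) h) h = of_real (- ((norm k)\<^sup>2 / \<alpha>))"
    proof -
      have "cinner (blinfun_apply (ip y (act T x)) h) h = cinner h (blinfun_apply (ip (act T x) y) h)"
        using ip_adjoint_pair[OF y Tx] by (rule adjoint_pairD)
      also have "\<dots> = cnj (cinner (blinfun_apply (ip (act T x) y) h) h)" by (rule cinner_commute)
      finally show ?thesis by (simp only: 2 complex_cnj_complex_of_real)
    qed
    have "0 \<le> Re (cinner (blinfun_apply (ip (vadd V (act T x) y) (vadd V (act T x) y)) h) h)"
      by (rule ip_nonneg) (use Tx y in simp)
    also have "\<dots> = Re (cinner (blinfun_apply (ip (act T x) (act T x)) h) h) - 2 * ((norm k)\<^sup>2 / \<alpha>)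
        + Re (cinner (blinfun_apply (ip y y) h) h)"
      using Tx y by (simp add: blinfun.add_left cinner_add_left 2 3 del: of_real_power of_real_minus of_real_divide)
    also have "\<dots> \<le> (norm k)\<^sup>2 / \<alpha> - 2 * ((norm k)\<^sup>2 / \<alpha>) + norm (ip y y) * (norm h)\<^sup>2"
    proof (intro add_mono diff_right_mono 1)
      have "Re (cinner (blinfun_apply (ip y y) h) h) \<le> norm (blinfun_apply (ip y y) h) * norm h"
        using complex_Re_le_cmod norm_cinner_le order_trans by metis
      also have "\<dots> \<le> (norm (ip y y) * norm h) * norm h"
        by (intro mult_right_mono norm_blinfun) simp
      finally show "Re (cinner (blinfun_apply (ip y y) h) h) \<le> norm (ip y y) * (norm h)\<^sup>2"
        by (simp add: power2_eq_square mult.assoc)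
    qed
    finally have "(norm k)\<^sup>2 / \<alpha> \<le> norm (ip y y) * (norm h)\<^sup>2" by simp
    then show ?thesis using a by (simp add: k_def divide_simps mult.commute)
  qed
  show ?thesis
  proof (rule norm_blinfun_bound)
    fix h
    have "(norm (blinfun_apply (ip x y) h))\<^sup>2 \<le> (nrm x * nrm y * norm h)\<^sup>2"
      using pointwise[of h] by (simp add: power_mult_distrib nrm_square \<alpha>_def mult.assoc)
    then show "norm (blinfun_apply (ip x y) h) \<le> nrm x * nrm y * norm h"
      by (rule power2_le_imp_le) simp
  qed simp
qed

lemma nrm_add_le:
  assumes "x \<in> vcarrier V" "y \<in> vcarrier V"
  shows "nrm (vadd V x y) \<le> nrm x + nrm y"
proof (rule power2_le_imp_le)
  have "(nrm (vadd V x y))\<^sup>2 = norm ((ip x x + ip y x) + (ip x y + ip y y))"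
    using assms by (simp add: nrm_square)
  also have "\<dots> \<le> (norm (ip x x) + norm (ip y x)) + (norm (ip x y) + norm (ip y y))"
    by (intro norm_triangle_mono norm_triangle_ineq)
  also have "\<dots> \<le> (nrm x * nrm x + nrm y * nrm x) + (nrm x * nrm y + nrm y * nrm y)"
    using assms by (intro add_mono cauchy_schwarz)
  also have "\<dots> = (nrm x + nrm y)\<^sup>2" by (simp add: power2_eq_square algebra_simps)
  finally show "(nrm (vadd V x y))\<^sup>2 \<le> (nrm x + nrm y)\<^sup>2" .
qed simp

lemma nrm_scale: "x \<in> vcarrier V \<Longrightarrow> nrm (vscale V c x) = norm c * nrm x"
  by (simp add: ip_norm_def norm_scale_op real_sqrt_mult)

text \<open>From \<open>\<langle>Tx, Tx\<rangle> = T \<langle>x, Tx\<rangle>\<close> and Cauchy--Schwarz, \<open>\<bar>Tx\<bar>\<^sup>2 \<le> \<parallel>T\<parallel> \<bar>x\<bar> \<bar>Tx\<bar>\<close>.\<close>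

lemma nrm_act_le:
  assumes "T \<in> B" "x \<in> vcarrier V"
  shows "nrm (act T x) \<le> norm T * nrm x"
proof -
  have "(nrm (act T x))\<^sup>2 = norm (T o\<^sub>L ip x (act T x))"
    using assms by (simp add: nrm_square ip_act)
  also have "\<dots> \<le> norm T * norm (ip x (act T x))" by (rule norm_blinfun_compose)
  also have "\<dots> \<le> norm T * (nrm x * nrm (act T x))"
    using assms by (intro mult_left_mono cauchy_schwarz) auto
  finally have "nrm (act T x) * nrm (act T x) \<le> (norm T * nrm x) * nrm (act T x)"
    by (simp add: power2_eq_square mult.assoc)
  then show ?thesis
    using nrm_nonneg[of "act T x"] by (cases "nrm (act T x) = 0") (auto simp: mult_le_cancel_right)
qed

lemma dst_self [simp]: "x \<in> vcarrier V \<Longrightarrow> dst x x = 0"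
  using add_neg[of x] by (simp add: ip_dist_def)

lemma dst_nonneg [simp]: "0 \<le> dst x y"
  by (simp add: ip_dist_def)

lemma dst_commute: "x \<in> vcarrier V \<Longrightarrow> y \<in> vcarrier V \<Longrightarrow> dst x y = dst y x"
proof -
  assume x: "x \<in> vcarrier V" "y \<in> vcarrier V"
  have "vminus x y = vscale V (-1) (vminus y x)"
    by (rule ip_ext) (use x in \<open>auto simp: scale_op_minus1\<close>)
  then show ?thesis using x by (simp add: dst_eq nrm_scale)
qed

lemma dst_triangle:
  assumes "x \<in> vcarrier V" "y \<in> vcarrier V" "z \<in> vcarrier V"
  shows "dst x z \<le> dst x y + dst y z"
proof -
  have "vminus x z = vadd V (vminus x y) (vminus y z)"
    by (rule ip_ext) (use assms in auto)
  then show ?thesis using assms by (simp add: dst_eq nrm_add_le)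
qed

lemma nrm_le_dst:
  assumes "x \<in> vcarrier V" "y \<in> vcarrier V"
  shows "nrm x \<le> nrm y + dst x y"
proof -
  have "x = vadd V y (vminus x y)" by (rule ip_ext) (use assms in auto)
  then show ?thesis using nrm_add_le[of y "vminus x y"] assms by (simp add: dst_eq)
qed

lemma dst_add_le:
  assumes "x \<in> vcarrier V" "y \<in> vcarrier V" "x' \<in> vcarrier V" "y' \<in> vcarrier V"
  shows "dst (vadd V x y) (vadd V x' y') \<le> dst x x' + dst y y'"
proof -
  have "vminus (vadd V x y) (vadd V x' y') = vadd V (vminus x x') (vminus y y')"
    by (rule ip_ext) (use assms in auto)
  then show ?thesis using assms by (simp add: dst_eq nrm_add_le)
qed

lemma dst_scale:
  assumes "x \<in> vcarrier V" "y \<in> vcarrier V"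
  shows "dst (vscale V c x) (vscale V c y) = norm c * dst x y"
proof -
  have "vminus (vscale V c x) (vscale V c y) = vscale V c (vminus x y)"
    by (rule ip_ext) (use assms in \<open>auto simp: linear_simps(2)[OF bounded_linear_scale_op_right]\<close>)
  then show ?thesis using assms by (simp add: dst_eq nrm_scale)
qed

lemma dst_act_le:
  assumes "S \<in> B" "T \<in> B" "x \<in> vcarrier V" "y \<in> vcarrier V"
  shows "dst (act S x) (act T y) \<le> norm S * dst x y + norm (S - T) * nrm y"
proof -
  have "vminus (act S x) (act T y) = vadd V (act S (vminus x y)) (act (S - T) y)"
    by (rule ip_ext) (use assms in \<open>auto simp: ip_act diff_in
      bounded_bilinear.diff_left[OF bounded_bilinear_blinfun_compose]
      bounded_bilinear.diff_right[OF bounded_bilinear_blinfun_compose]\<close>)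
  then have "dst (act S x) (act T y) \<le> nrm (act S (vminus x y)) + nrm (act (S - T) y)"
    using assms by (simp add: dst_eq nrm_add_le diff_in)
  also have "\<dots> \<le> norm S * dst x y + norm (S - T) * nrm y"
    unfolding dst_eq using assms by (intro add_mono nrm_act_le) (auto simp: diff_in)
  finally show ?thesis .
qed

lemma norm_ip_diff_le:
  assumes "x \<in> vcarrier V" "y \<in> vcarrier V" "x' \<in> vcarrier V" "y' \<in> vcarrier V"
  shows "norm (ip x y - ip x' y') \<le> dst x x' * nrm y + nrm x' * dst y y'"
proof -
  have "ip x y - ip x' y' = ip (vminus x x') y + ip x' (vminus y y')" using assms by simp
  then have "norm (ip x y - ip x' y') \<le> norm (ip (vminus x x') y) + norm (ip x' (vminus y y'))"
    by (simp only: norm_triangle_ineq)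
  also have "\<dots> \<le> dst x x' * nrm y + nrm x' * dst y y'"
    unfolding dst_eq using assms by (intro add_mono cauchy_schwarz) auto
  finally show ?thesis .
qed

section \<open>Cauchy sequences and their classes\<close>

abbreviation Cau :: "(nat \<Rightarrow> 'm) \<Rightarrow> bool" where "Cau \<equiv> ip_Cauchy V ip"
abbreviation cls :: "(nat \<Rightarrow> 'm) \<Rightarrow> (nat \<Rightarrow> 'm) set" where "cls u \<equiv> null_rel V ip `` {u}"

lemma Cau_mem [simp]: "Cau u \<Longrightarrow> u n \<in> vcarrier V"
  by (auto simp: ip_Cauchy_def)

text \<open>Filter form of the Cauchy property: a termwise operation then preserves it as soon as its distance is
  dominated by a null double sequence, and limits of sums and products apply to the dominating term.\<close>

lemma Cau_iff:
  "Cau u \<longleftrightarrow> range u \<subseteq> vcarrier V \<and> ((\<lambda>(m, n). dst (u m) (u n)) \<longlongrightarrow> 0) (sequentially \<times>\<^sub>F sequentially)"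
  unfolding tendsto_double_sequence ip_Cauchy_def by simp

lemma Cau_tendsto: "Cau u \<Longrightarrow> ((\<lambda>(m, n). dst (u m) (u n)) \<longlongrightarrow> 0) (sequentially \<times>\<^sub>F sequentially)"
  by (simp add: Cau_iff)

lemma Cau_const: "x \<in> vcarrier V \<Longrightarrow> Cau (\<lambda>_. x)"
  by (auto simp: ip_Cauchy_def)

lemma Cau_bounded:
  assumes "Cau u"
  shows "\<exists>K. \<forall>n. nrm (u n) \<le> K"
proof -
  obtain N where N: "\<And>m n. m \<ge> N \<Longrightarrow> n \<ge> N \<Longrightarrow> dst (u m) (u n) < 1"
    using assms unfolding ip_Cauchy_def by (meson zero_less_one)
  have "nrm (u n) \<le> nrm (u N) + 1 + (\<Sum>k<N. nrm (u k))" for n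
  proof (cases "n < N")
    case True
    then have "nrm (u n) \<le> (\<Sum>k<N. nrm (u k))" by (intro member_le_sum) auto
    then show ?thesis using nrm_nonneg[of "u N"] by linarith
  next
    case False
    then have "nrm (u n) \<le> nrm (u N) + 1"
      using nrm_le_dst[of "u n" "u N"] N[of n N] assms by simp
    moreover have "0 \<le> (\<Sum>k<N. nrm (u k))" by (intro sum_nonneg) simp
    ultimately show ?thesis by linarith
  qed
  then show ?thesis by blast
qed

lemma null_rel_iff:
  "(u, v) \<in> null_rel V ip \<longleftrightarrow> Cau u \<and> Cau v \<and> (\<lambda>n. dst (u n) (v n)) \<longlonglongrightarrow> 0"
  by (simp add: null_rel_def)

lemma equiv_null_rel: "equiv (Collect Cau) (null_rel V ip)"
proof (rule equivI)
  show "null_rel V ip \<subseteq> Collect Cau \<times> Collect Cau" by (auto simp: null_rel_iff)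
  show "refl_on (Collect Cau) (null_rel V ip)"
    by (rule refl_onI) (auto simp: null_rel_iff)
  show "sym (null_rel V ip)"
    by (rule symI) (auto simp: null_rel_iff dst_commute)
  show "trans (null_rel V ip)"
  proof (rule transI)
    fix u v w assume "(u, v) \<in> null_rel V ip" "(v, w) \<in> null_rel V ip"
    then have *: "Cau u" "Cau v" "Cau w" "(\<lambda>n. dst (u n) (v n)) \<longlonglongrightarrow> 0" "(\<lambda>n. dst (v n) (w n)) \<longlonglongrightarrow> 0"
      by (auto simp: null_rel_iff)
    have "(\<lambda>n. dst (u n) (w n)) \<longlonglongrightarrow> 0"
      by (rule tendsto_sandwich[OF _ _ tendsto_const tendsto_add_zero[OF *(4,5)]])
        (use * in \<open>auto intro!: always_eventually dst_triangle\<close>)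
    then show "(u, w) \<in> null_rel V ip" using * by (simp add: null_rel_iff)
  qed
qed

lemma cls_eq_iff: "Cau u \<Longrightarrow> Cau v \<Longrightarrow> cls u = cls v \<longleftrightarrow> (\<lambda>n. dst (u n) (v n)) \<longlonglongrightarrow> 0"
  using eq_equiv_class_iff[OF equiv_null_rel, of u v] by (simp add: null_rel_iff)

lemma self_mem_cls: "Cau u \<Longrightarrow> u \<in> cls u"
  by (simp add: null_rel_iff)

abbreviation W :: "(nat \<Rightarrow> 'm) set complex_space" where "W \<equiv> ip_completion V ip"

lemma carrier_completion: "vcarrier W = cls ` Collect Cau"
  by (auto simp: ip_completion_def quotient_def)

lemma cls_in_carrier [simp]: "Cau u \<Longrightarrow> cls u \<in> vcarrier W"
  by (auto simp: carrier_completion)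

lemma carrierE:
  assumes "F \<in> vcarrier W"
  obtains u where "Cau u" "F = cls u"
  using assms by (auto simp: carrier_completion)

lemma mem_carrier:
  assumes "F \<in> vcarrier W" "u \<in> F"
  shows "Cau u" "F = cls u"
proof -
  obtain v where v: "Cau v" "F = cls v" using assms(1) by (rule carrierE)
  then show u: "Cau u" using assms(2) by (simp add: null_rel_iff)
  show "F = cls u" using v(2) assms(2) unfolding v(2) cls_eq_iff[OF v(1) u] by (simp add: null_rel_iff)
qed

lemma Cau_add:
  assumes u: "Cau u" and v: "Cau v"
  shows "Cau (\<lambda>n. vadd V (u n) (v n))"
  unfolding Cau_iff
proof
  have "((\<lambda>mn. dst (u (fst mn)) (u (snd mn)) + dst (v (fst mn)) (v (snd mn))) \<longlongrightarrow> 0) (sequentially \<times>\<^sub>F sequentially)"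
    using tendsto_add_zero[OF Cau_tendsto[OF u] Cau_tendsto[OF v]] by (simp add: case_prod_unfold)
  then show "((\<lambda>(m, n). dst (vadd V (u m) (v m)) (vadd V (u n) (v n))) \<longlongrightarrow> 0) (sequentially \<times>\<^sub>F sequentially)"
    by (rule tendsto_sandwich[OF _ _ tendsto_const, rotated 2])
      (use u v in \<open>auto intro!: always_eventually dst_add_le\<close>)
qed (use u v in auto)

lemma Cau_scale: "Cau u \<Longrightarrow> Cau (\<lambda>n. vscale V c (u n))"
  unfolding Cau_iff
  using tendsto_mult_right_zero[of "\<lambda>(m, n). dst (u m) (u n)" "sequentially \<times>\<^sub>F sequentially" "norm c"]
  by (auto simp: case_prod_unfold dst_scale image_subset_iff)

lemma product_null:
  fixes f g :: "'k \<Rightarrow> real"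
  assumes "\<And>k. \<bar>f k\<bar> \<le> K" "(g \<longlongrightarrow> 0) F"
  shows "((\<lambda>k. f k * g k) \<longlongrightarrow> 0) F"
proof (rule Lim_null_comparison)
  show "\<forall>\<^sub>F k in F. norm (f k * g k) \<le> K * \<bar>g k\<bar>"
    using assms(1) by (intro always_eventually allI) (simp add: abs_mult mult_right_mono)
  show "((\<lambda>k. K * \<bar>g k\<bar>) \<longlongrightarrow> 0) F"
    using assms(2) by (intro tendsto_mult_right_zero tendsto_rabs_zero)
qed

lemma Cau_act:
  assumes u: "Cau u" and S: "range S \<subseteq> B" "S \<longlonglongrightarrow> T"
  shows "Cau (\<lambda>n. act (S n) (u n))"
  unfolding Cau_iff
proof
  have SB: "S n \<in> B" for n using S by auto
  obtain K where K: "\<And>n. nrm (u n) \<le> K" using Cau_bounded[OF u] by blast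
  obtain L where L: "\<And>n. norm (S n) \<le> L"
    using convergent_imp_Bseq[of S] S(2) by (auto simp: convergent_def Bseq_def)
  have "Cauchy S" using S(2) by (rule LIMSEQ_imp_Cauchy)
  then have "((\<lambda>(m, n). norm (S m - S n)) \<longlongrightarrow> 0) (sequentially \<times>\<^sub>F sequentially)"
    unfolding tendsto_double_sequence Cauchy_def by (simp add: dist_norm)
  then have "((\<lambda>mn. norm (S (fst mn)) * dst (u (fst mn)) (u (snd mn)) + nrm (u (snd mn)) * norm (S (fst mn) - S (snd mn))) \<longlongrightarrow> 0)
      (sequentially \<times>\<^sub>F sequentially)"
    using Cau_tendsto[OF u] K L
    by (intro tendsto_add_zero product_null[of _ L] product_null[of _ K]) (auto simp: case_prod_unfold)
  then show "((\<lambda>(m, n). dst (act (S m) (u m)) (act (S n) (u n))) \<longlongrightarrow> 0) (sequentially \<times>\<^sub>F sequentially)"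
    by (rule tendsto_sandwich[OF _ _ tendsto_const, rotated 2])
      (use dst_act_le[OF SB SB] u in \<open>auto intro!: always_eventually simp: mult.commute[of "nrm _"]\<close>)
qed (use u S in auto)

lemma null_act:
  assumes u: "Cau u" "Cau v" "(\<lambda>n. dst (u n) (v n)) \<longlonglongrightarrow> 0"
    and S: "range S \<subseteq> B" "S \<longlonglongrightarrow> T" and S': "range S' \<subseteq> B" "S' \<longlonglongrightarrow> T"
  shows "(\<lambda>n. dst (act (S n) (u n)) (act (S' n) (v n))) \<longlonglongrightarrow> 0"
proof -
  have B: "S n \<in> B" "S' n \<in> B" for n using S S' by auto
  obtain K where K: "\<And>n. nrm (v n) \<le> K" using Cau_bounded[OF u(2)] by blast
  obtain L where L: "\<And>n. norm (S n) \<le> L"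
    using convergent_imp_Bseq[of S] S(2) by (auto simp: convergent_def Bseq_def)
  have "(\<lambda>n. norm (S n - S' n)) \<longlonglongrightarrow> 0"
    using tendsto_norm_zero[OF LIM_zero[OF tendsto_diff[OF S(2) S'(2)]]] by simp
  then have "(\<lambda>n. norm (S n) * dst (u n) (v n) + nrm (v n) * norm (S n - S' n)) \<longlonglongrightarrow> 0"
    using u(3) K L by (intro tendsto_add_zero product_null[of _ L] product_null[of _ K]) auto
  then show ?thesis
    by (rule tendsto_sandwich[OF _ _ tendsto_const, rotated 2])
      (use dst_act_le[OF B(1) B(2)] u in \<open>auto intro!: always_eventually simp: mult.commute[of "nrm _"]\<close>)
qed

lemma ip_null:
  assumes u: "Cau u" "Cau u'" "(\<lambda>n. dst (u n) (u' n)) \<longlonglongrightarrow> 0"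
    and v: "Cau v" "Cau v'" "(\<lambda>n. dst (v n) (v' n)) \<longlonglongrightarrow> 0"
  shows "(\<lambda>n. ip (u n) (v n) - ip (u' n) (v' n)) \<longlonglongrightarrow> 0"
proof (rule Lim_null_comparison)
  obtain K where K: "\<And>n. nrm (v n) \<le> K" using Cau_bounded[OF v(1)] by blast
  obtain L where L: "\<And>n. nrm (u' n) \<le> L" using Cau_bounded[OF u(2)] by blast
  show "(\<lambda>n. nrm (v n) * dst (u n) (u' n) + nrm (u' n) * dst (v n) (v' n)) \<longlonglongrightarrow> 0"
    using u v K L by (intro tendsto_add_zero product_null[of _ K] product_null[of _ L]) auto
  show "\<forall>\<^sub>F n in sequentially. norm (ip (u n) (v n) - ip (u' n) (v' n))
      \<le> nrm (v n) * dst (u n) (u' n) + nrm (u' n) * dst (v n) (v' n)"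
    using norm_ip_diff_le u v by (intro always_eventually allI) (simp add: mult.commute[of "nrm (v _)"])
qed

lemma ip_convergent:
  assumes u: "Cau u" and v: "Cau v"
  shows "convergent (\<lambda>n. ip (u n) (v n))"
proof (rule Cauchy_convergent)
  obtain K where K: "\<And>n. nrm (v n) \<le> K" using Cau_bounded[OF v] by blast
  obtain L where L: "\<And>n. nrm (u n) \<le> L" using Cau_bounded[OF u] by blast
  have "((\<lambda>mn. nrm (v (fst mn)) * dst (u (fst mn)) (u (snd mn)) + nrm (u (snd mn)) * dst (v (fst mn)) (v (snd mn))) \<longlongrightarrow> 0)
      (sequentially \<times>\<^sub>F sequentially)"
    using Cau_tendsto[OF u] Cau_tendsto[OF v] K L
    by (intro tendsto_add_zero product_null[of _ K] product_null[of _ L]) (auto simp: case_prod_unfold)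
  then have "((\<lambda>mn. norm (ip (u (fst mn)) (v (fst mn)) - ip (u (snd mn)) (v (snd mn)))) \<longlongrightarrow> 0) (sequentially \<times>\<^sub>F sequentially)"
    by (rule tendsto_sandwich[OF _ _ tendsto_const, rotated 2])
      (use norm_ip_diff_le u v in \<open>auto intro!: always_eventually simp: mult.commute[of "nrm (v _)"]\<close>)
  then show "Cauchy (\<lambda>n. ip (u n) (v n))"
    unfolding Cauchy_def dist_norm
    using tendsto_double_sequence[of "\<lambda>m n. norm (ip (u m) (v m) - ip (u n) (v n))"]
    by (simp add: case_prod_unfold)
qed

end

section \<open>The completion\<close>

text \<open>The operations of the completion are unions over all choices of representatives. Each one is first
  evaluated on classes \<open>cls u\<close>, which shows that the choices agree; the module axioms then hold termwise.\<close>

context pre_hilbert_module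
begin

abbreviation cact :: "'a op \<Rightarrow> (nat \<Rightarrow> 'm) set \<Rightarrow> (nat \<Rightarrow> 'm) set" where
  "cact \<equiv> completion_act B V act ip"

abbreviation cip :: "(nat \<Rightarrow> 'm) set \<Rightarrow> (nat \<Rightarrow> 'm) set \<Rightarrow> 'a op" where
  "cip \<equiv> completion_ip ip"

lemma completion_zero: "vzero W = cls (\<lambda>_. vzero V)"
  by (simp add: ip_completion_def)

lemma completion_add:
  assumes u: "Cau u" and v: "Cau v"
  shows "vadd W (cls u) (cls v) = cls (\<lambda>n. vadd V (u n) (v n))"
proof -
  have "cls (\<lambda>n. vadd V (u' n) (v' n)) = cls (\<lambda>n. vadd V (u n) (v n))"
    if "u' \<in> cls u" "v' \<in> cls v" for u' v'
  proof -
    have *: "Cau u'" "Cau v'" "(\<lambda>n. dst (u n) (u' n)) \<longlonglongrightarrow> 0" "(\<lambda>n. dst (v n) (v' n)) \<longlonglongrightarrow> 0"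
      using that by (simp_all add: null_rel_iff)
    have "(\<lambda>n. dst (vadd V (u n) (v n)) (vadd V (u' n) (v' n))) \<longlonglongrightarrow> 0"
      by (rule tendsto_sandwich[OF _ _ tendsto_const tendsto_add_zero[OF *(3,4)]])
        (use u v * in \<open>auto intro!: always_eventually dst_add_le\<close>)
    then show ?thesis
      using cls_eq_iff[OF Cau_add[OF u v] Cau_add[OF *(1,2)]] by simp
  qed
  then have "(\<Union>u'\<in>cls u. \<Union>v'\<in>cls v. cls (\<lambda>n. vadd V (u' n) (v' n))) = cls (\<lambda>n. vadd V (u n) (v n))"
    using self_mem_cls[OF u] self_mem_cls[OF v] by blast
  then show ?thesis by (simp add: ip_completion_def)
qed

lemma completion_scale:
  assumes u: "Cau u"
  shows "vscale W c (cls u) = cls (\<lambda>n. vscale V c (u n))"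
proof -
  have "cls (\<lambda>n. vscale V c (u' n)) = cls (\<lambda>n. vscale V c (u n))" if "u' \<in> cls u" for u'
  proof -
    have *: "Cau u'" "(\<lambda>n. dst (u n) (u' n)) \<longlonglongrightarrow> 0" using that by (simp_all add: null_rel_iff)
    have "(\<lambda>n. dst (vscale V c (u n)) (vscale V c (u' n))) \<longlonglongrightarrow> 0"
      using u * by (simp add: dst_scale tendsto_mult_right_zero)
    then show ?thesis
      using cls_eq_iff[OF Cau_scale[OF u, of c] Cau_scale[OF *(1), of c]] by simp
  qed
  then have "(\<Union>u'\<in>cls u. cls (\<lambda>n. vscale V c (u' n))) = cls (\<lambda>n. vscale V c (u n))"
    using self_mem_cls[OF u] by blast
  then show ?thesis by (simp add: ip_completion_def)
qed

lemma completion_act_cls: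
  assumes u: "Cau u" and S: "range S \<subseteq> B" "S \<longlonglongrightarrow> T"
  shows "cact T (cls u) = cls (\<lambda>n. act (S n) (u n))"
proof -
  have "cls (\<lambda>n. act (S' n) (u' n)) = cls (\<lambda>n. act (S n) (u n))"
    if "S' \<in> {S. range S \<subseteq> B \<and> S \<longlonglongrightarrow> T}" "u' \<in> cls u" for S' u'
  proof -
    have *: "Cau u'" "(\<lambda>n. dst (u n) (u' n)) \<longlonglongrightarrow> 0" "range S' \<subseteq> B" "S' \<longlonglongrightarrow> T"
      using that by (simp_all add: null_rel_iff)
    show ?thesis
      using cls_eq_iff[OF Cau_act[OF u S] Cau_act[OF *(1,3,4)]] null_act[OF u *(1,2) S *(3,4)] by simp
  qed
  then have "(\<Union>S'\<in>{S. range S \<subseteq> B \<and> S \<longlonglongrightarrow> T}. \<Union>u'\<in>cls u. cls (\<lambda>n. act (S' n) (u' n))) = cls (\<lambda>n. act (S n) (u n))"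
    using self_mem_cls[OF u] S by blast
  then show ?thesis by (simp add: completion_act_def)
qed

lemma completion_ip_tendsto:
  assumes u: "Cau u" and v: "Cau v"
  shows "(\<lambda>n. ip (u n) (v n)) \<longlonglongrightarrow> cip (cls u) (cls v)"
proof -
  obtain L where L: "(\<lambda>n. ip (u n) (v n)) \<longlonglongrightarrow> L"
    using ip_convergent[OF u v] by (auto simp: convergent_def)
  have all: "(\<lambda>n. ip (u' n) (v' n)) \<longlonglongrightarrow> L" if "u' \<in> cls u" "v' \<in> cls v" for u' v'
  proof -
    have "(\<lambda>n. ip (u n) (v n) - ip (u' n) (v' n)) \<longlonglongrightarrow> 0"
      using that u v by (intro ip_null) (simp_all add: null_rel_iff)
    from tendsto_diff[OF L this] show ?thesis by simp
  qed
  have "cip (cls u) (cls v) = L"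
    unfolding completion_ip_def
  proof (rule the_equality)
    show "\<forall>u'\<in>cls u. \<forall>v'\<in>cls v. (\<lambda>n. ip (u' n) (v' n)) \<longlonglongrightarrow> L" using all by blast
    fix L' assume "\<forall>u'\<in>cls u. \<forall>v'\<in>cls v. (\<lambda>n. ip (u' n) (v' n)) \<longlonglongrightarrow> L'"
    then have "(\<lambda>n. ip (u n) (v n)) \<longlonglongrightarrow> L'" using self_mem_cls u v by blast
    then show "L' = L" using L by (rule LIMSEQ_unique)
  qed
  with L show ?thesis by simp
qed

lemma completion_ip_eqI:
  assumes "Cau u" "Cau v" "(\<lambda>n. ip (u n) (v n)) \<longlonglongrightarrow> L"
  shows "cip (cls u) (cls v) = L"
  by (rule LIMSEQ_unique[OF completion_ip_tendsto[OF assms(1,2)] assms(3)])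

lemma approximants_ex: "T \<in> A \<Longrightarrow> \<exists>S. range S \<subseteq> B \<and> S \<longlonglongrightarrow> T \<and> (\<forall>n. S n \<in> B)"
  unfolding closure_B closure_sequential by blast

lemma completion_dist_tendsto:
  assumes u: "Cau u" and v: "Cau v"
  shows "(\<lambda>n. dst (u n) (v n)) \<longlonglongrightarrow> ip_dist W cip (cls u) (cls v)"
proof -
  let ?d = "\<lambda>n. vadd V (u n) (vscale V (-1) (v n))"
  have d: "Cau ?d" by (intro Cau_add Cau_scale u v)
  have "vadd W (cls u) (vscale W (-1) (cls v)) = cls ?d"
    by (simp only: completion_scale[OF v] completion_add[OF u Cau_scale[OF v]])
  then have "ip_dist W cip (cls u) (cls v) = sqrt (norm (cip (cls ?d) (cls ?d)))"
    by (simp only: ip_dist_def ip_norm_def)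
  then show ?thesis
    unfolding ip_dist_def[of V ip] ip_norm_def
    using tendsto_real_sqrt[OF tendsto_norm[OF completion_ip_tendsto[OF d d]]] by simp
qed

lemma completion_vector_space: "complex_vector_space W"
proof
  show "vzero W \<in> vcarrier W" by (simp add: completion_zero Cau_const)
  fix x y z c d
  {
    assume x: "x \<in> vcarrier W"
    then obtain u where u: "Cau u" "x = cls u" by (rule carrierE)
    show "vscale W c x \<in> vcarrier W" by (simp add: u completion_scale Cau_scale)
    show "vadd W x (vzero W) = x"
      by (simp add: u completion_zero completion_add Cau_const add_zero)
    show "vadd W x (vscale W (-1) x) = vzero W"
      by (simp add: u completion_zero completion_add completion_scale Cau_scale add_neg)
    show "vscale W (c + d) x = vadd W (vscale W c x) (vscale W d x)"
      by (simp add: u completion_add completion_scale Cau_scale add_scale)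
    show "vscale W c (vscale W d x) = vscale W (c * d) x"
      by (simp add: u completion_scale Cau_scale scale_scale)
    show "vscale W 1 x = x"
      by (simp add: u completion_scale scale_one)
    assume y: "y \<in> vcarrier W"
    then obtain v where v: "Cau v" "y = cls v" by (rule carrierE)
    show "vadd W x y \<in> vcarrier W" by (simp add: u v completion_add Cau_add)
    show "vadd W x y = vadd W y x"
      by (simp add: u v completion_add add_commute)
    show "vscale W c (vadd W x y) = vadd W (vscale W c x) (vscale W c y)"
      by (simp add: u v completion_add completion_scale Cau_add Cau_scale scale_add)
    assume z: "z \<in> vcarrier W"
    then obtain w where w: "Cau w" "z = cls w" by (rule carrierE)
    show "vadd W (vadd W x y) z = vadd W x (vadd W y z)"
      by (simp add: u v w completion_add Cau_add add_assoc)
  }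
qed

lemma completion_module: "left_module A W cact"
proof (intro left_module.intro left_module_axioms.intro star_algebra_A completion_vector_space)
  fix x assume "x \<in> vcarrier W"
  then obtain u where u: "Cau u" "x = cls u" by (rule carrierE)
  show "cact id_blinfun x = x"
    using completion_act_cls[OF u(1), of "\<lambda>_. id_blinfun" id_blinfun] u by (simp add: one_mem one_act image_subset_iff)
  fix T assume T: "T \<in> A"
  then obtain t where t: "range t \<subseteq> B" "t \<longlonglongrightarrow> T" "\<And>n. t n \<in> B" using approximants_ex by blast
  note tu = completion_act_cls[OF u(1) t(1,2)] Cau_act[OF u(1) t(1,2)]
  show "cact T x \<in> vcarrier W" by (simp add: u tu)
  show "cact T (vscale W c x) = vscale W c (cact T x)" for c
    using u t by (simp add: tu completion_scale completion_act_cls[OF Cau_scale[OF u(1)] t(1,2)] act_scale)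
  show "cact (scale_op c T) x = vscale W c (cact T x)" for c
  proof -
    have "range (\<lambda>n. scale_op c (t n)) \<subseteq> B" using t(3) by (auto intro: scale_mem)
    moreover have "(\<lambda>n. scale_op c (t n)) \<longlonglongrightarrow> scale_op c T"
      by (rule bounded_linear.tendsto[OF bounded_linear_scale_op_right t(2)])
    ultimately have "cact (scale_op c T) x = cls (\<lambda>n. act (scale_op c (t n)) (u n))"
      unfolding u by (rule completion_act_cls[OF u(1)])
    then show ?thesis using u t by (simp add: tu completion_scale scale_act)
  qed
  show "cact T (vadd W x y) = vadd W (cact T x) (cact T y)" if y: "y \<in> vcarrier W" for y
  proof -
    obtain v where v: "Cau v" "y = cls v" using y by (rule carrierE)
    note tv = completion_act_cls[OF v(1) t(1,2)] Cau_act[OF v(1) t(1,2)]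
    show ?thesis
      using u v t by (simp add: tu tv completion_add completion_act_cls[OF Cau_add[OF u(1) v(1)] t(1,2)] act_add)
  qed
  fix S assume S: "S \<in> A"
  then obtain s where s: "range s \<subseteq> B" "s \<longlonglongrightarrow> S" "\<And>n. s n \<in> B" using approximants_ex by blast
  note su = completion_act_cls[OF u(1) s(1,2)] Cau_act[OF u(1) s(1,2)]
  show "cact (S + T) x = vadd W (cact S x) (cact T x)"
  proof -
    have "range (\<lambda>n. s n + t n) \<subseteq> B" using s(3) t(3) by (auto intro: add_mem)
    then have "cact (S + T) x = cls (\<lambda>n. act (s n + t n) (u n))"
      unfolding u by (rule completion_act_cls[OF u(1) _ tendsto_add[OF s(2) t(2)]])
    then show ?thesis using u s t by (simp add: tu su completion_add add_act)
  qed
  show "cact (S o\<^sub>L T) x = cact S (cact T x)"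
  proof -
    have "range (\<lambda>n. s n o\<^sub>L t n) \<subseteq> B" using s(3) t(3) by (auto intro: compose_mem)
    then have "cact (S o\<^sub>L T) x = cls (\<lambda>n. act (s n o\<^sub>L t n) (u n))"
      unfolding u
      by (rule completion_act_cls[OF u(1) _ bounded_bilinear.tendsto[OF bounded_bilinear_blinfun_compose s(2) t(2)]])
    then show ?thesis
      using u s t by (simp add: tu completion_act_cls[OF tu(2) s(1,2)] compose_act)
  qed
qed

lemma completion_ip_limit:
  assumes "Cau u" "Cau v"
  shows "cip (cls u) (cls v) \<in> A" "adjoint_pair (cip (cls u) (cls v)) (cip (cls v) (cls u))"
proof -
  show "cip (cls u) (cls v) \<in> A"
    unfolding closure_B closure_sequential
    using completion_ip_tendsto[OF assms] ip_mem assms by (intro exI[of _ "\<lambda>n. ip (u n) (v n)"]) simp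
  show "adjoint_pair (cip (cls u) (cls v)) (cip (cls v) (cls u))"
    by (rule adjoint_pair_limit[OF _ completion_ip_tendsto[OF assms] completion_ip_tendsto[OF assms(2,1)]])
      (use assms in \<open>simp add: ip_adjoint_pair\<close>)
qed

lemma completion_ip_nonneg:
  assumes u: "Cau u"
  shows "0 \<le> Re (cinner (blinfun_apply (cip (cls u) (cls u)) h) h)"
proof (rule LIMSEQ_le_const)
  show "(\<lambda>n. Re (cinner (blinfun_apply (ip (u n) (u n)) h) h)) \<longlonglongrightarrow> Re (cinner (blinfun_apply (cip (cls u) (cls u)) h) h)"
    by (intro tendsto_Re bounded_linear.tendsto[OF bounded_linear_cinner_left] blinfun.tendsto
        completion_ip_tendsto u tendsto_const)
  show "\<exists>N. \<forall>n\<ge>N. 0 \<le> Re (cinner (blinfun_apply (ip (u n) (u n)) h) h)"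
    using ip_nonneg u by auto
qed

text \<open>The completion is again of the same kind, now over \<open>A\<close> itself, so the norm estimates above also apply to
  it; the proof of completeness uses its triangle inequality.\<close>

theorem completion_pre_hilbert: "pre_hilbert_module A A W cact cip"
proof (intro pre_hilbert_module.intro pre_hilbert_module_axioms.intro inner_product_module.intro
    inner_product_module_axioms.intro completion_module order_refl)
  show "A = closure A" using closed_A by simp
  fix x assume "x \<in> vcarrier W"
  then obtain u where u: "Cau u" "x = cls u" by (rule carrierE)
  show "0 \<le> Re (cinner (blinfun_apply (cip x x) h) h)" for h
    unfolding u by (rule completion_ip_nonneg[OF u(1)])
  show "positive_in A (cip x x) \<and> cip x x \<noteq> 0" if "x \<noteq> vzero W"
  proof
    show "positive_in A (cip x x)"
      unfolding u by (intro positive_in_if_numerically_positive star_algebra_A closed_A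
          completion_ip_limit completion_ip_nonneg u(1))
    show "cip x x \<noteq> 0"
    proof
      assume "cip x x = 0"
      then have "(\<lambda>n. ip (u n) (u n)) \<longlonglongrightarrow> 0"
        using completion_ip_tendsto[OF u(1) u(1)] by (simp add: u)
      from tendsto_real_sqrt[OF tendsto_norm[OF this]] have "(\<lambda>n. nrm (u n)) \<longlonglongrightarrow> 0"
        by (simp add: ip_norm_def)
      moreover have "vminus (u n) (vzero V) = u n" for n
        by (rule ip_ext) (use u in auto)
      ultimately have "(\<lambda>n. dst (u n) (vzero V)) \<longlonglongrightarrow> 0" by (simp add: dst_eq)
      then have "x = vzero W"
        unfolding u completion_zero using cls_eq_iff[OF u(1) Cau_const[of "vzero V"]] by simp
      with that show False by simp
    qed
  qed
  fix y assume "y \<in> vcarrier W"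
  then obtain v where v: "Cau v" "y = cls v" by (rule carrierE)
  show "cip x y \<in> A" "cip x y \<in> A" unfolding u v by (rule completion_ip_limit[OF u(1) v(1)])+
  show "cip x y = cadj (cip y x)"
    unfolding u v by (rule cadj_eqI[OF completion_ip_limit(2)[OF v(1) u(1)], symmetric])
  show "cip (vscale W c x) y = scale_op c (cip x y)" for c
    unfolding u v completion_scale[OF u(1)]
    using bounded_linear.tendsto[OF bounded_linear_scale_op_right completion_ip_tendsto[OF u(1) v(1)]] u v
    by (intro completion_ip_eqI Cau_scale) simp_all
  show "cip x (vscale W c y) = scale_op (cnj c) (cip x y)" for c
    unfolding u v completion_scale[OF v(1)]
    using bounded_linear.tendsto[OF bounded_linear_scale_op_right completion_ip_tendsto[OF u(1) v(1)]] u v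
    by (intro completion_ip_eqI Cau_scale) simp_all
  show "cip (cact T x) y = T o\<^sub>L cip x y" if T: "T \<in> A" for T
  proof -
    obtain t where t: "range t \<subseteq> B" "t \<longlonglongrightarrow> T" "\<And>n. t n \<in> B" using approximants_ex[OF T] by blast
    show ?thesis
      unfolding u v completion_act_cls[OF u(1) t(1,2)]
    proof (rule completion_ip_eqI[OF Cau_act[OF u(1) t(1,2)] v(1)])
      have "(\<lambda>n. t n o\<^sub>L ip (u n) (v n)) \<longlonglongrightarrow> (T o\<^sub>L cip (cls u) (cls v))"
        by (rule bounded_bilinear.tendsto[OF bounded_bilinear_blinfun_compose t(2) completion_ip_tendsto[OF u(1) v(1)]])
      then show "(\<lambda>n. ip (act (t n) (u n)) (v n)) \<longlonglongrightarrow> (T o\<^sub>L cip (cls u) (cls v))"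
        using u v t by (simp add: ip_act)
    qed
  qed
  fix z assume "z \<in> vcarrier W"
  then obtain w where w: "Cau w" "z = cls w" by (rule carrierE)
  show "cip (vadd W x y) z = cip x z + cip y z"
    unfolding u v w completion_add[OF u(1) v(1)]
    using tendsto_add[OF completion_ip_tendsto[OF u(1) w(1)] completion_ip_tendsto[OF v(1) w(1)]] u v w
    by (intro completion_ip_eqI Cau_add) simp_all
  show "cip x (vadd W y z) = cip x y + cip x z"
    unfolding u v w completion_add[OF v(1) w(1)]
    using tendsto_add[OF completion_ip_tendsto[OF u(1) v(1)] completion_ip_tendsto[OF u(1) w(1)]] u v w
    by (intro completion_ip_eqI Cau_add) simp_all
qed

text \<open>Completeness: a Cauchy sequence of classes is approximated by constant classes with error \<open>1/(k+1)\<close>,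
  and the constants form a Cauchy sequence whose class is the limit.\<close>

theorem completion_left_hilbert: "left_hilbert_module A W cact cip"
proof (rule left_hilbert_module.intro)
  interpret W: pre_hilbert_module A A W cact cip by (rule completion_pre_hilbert)
  show "inner_product_module A A W cact cip" by unfold_locales
  show "left_hilbert_module_axioms W cip"
  proof
    fix U assume U: "ip_Cauchy W cip U"
    let ?D = "ip_dist W cip"
    let ?const = "\<lambda>x. cls (\<lambda>_. x)"
    have UW [simp]: "U k \<in> vcarrier W" for k using U by (auto simp: ip_Cauchy_def)
    have "\<exists>x\<in>vcarrier V. ?D (U k) (?const x) \<le> 1 / real (Suc k)" for k
    proof -
      obtain w where w: "Cau w" "U k = cls w" using UW[of k] by (rule carrierE)
      have "1 / real (Suc k) > 0" by simp
      then obtain N where N: "\<And>m n. m \<ge> N \<Longrightarrow> n \<ge> N \<Longrightarrow> dst (w m) (w n) < 1 / real (Suc k)"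
        using w(1) unfolding ip_Cauchy_def by metis
      have "?D (cls w) (?const (w N)) \<le> 1 / real (Suc k)"
      proof (rule LIMSEQ_le_const2[OF completion_dist_tendsto[OF w(1) Cau_const]])
        show "\<exists>M. \<forall>n\<ge>M. dst (w n) (w N) \<le> 1 / real (Suc k)"
          using N by (intro exI[of _ N]) (auto intro: less_imp_le)
      qed (use w in simp)
      then show ?thesis using w by (intro bexI[of _ "w N"]) simp_all
    qed
    then obtain z where z: "\<And>k. z k \<in> vcarrier V" "\<And>k. ?D (U k) (?const (z k)) \<le> 1 / real (Suc k)" by metis
    have const_W [simp]: "?const (z k) \<in> vcarrier W" for k using z(1) by (simp add: Cau_const)
    have const_D: "?D (?const (z k)) (?const (z l)) = dst (z k) (z l)" for k l
      using LIMSEQ_unique[OF completion_dist_tendsto[OF Cau_const[OF z(1)] Cau_const[OF z(1)]] tendsto_const] .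
    have zz: "dst (z k) (z l) \<le> 1 / real (Suc k) + ?D (U k) (U l) + 1 / real (Suc l)" for k l
    proof -
      have "dst (z k) (z l) \<le> ?D (?const (z k)) (U k) + ?D (U k) (?const (z l))"
        unfolding const_D[symmetric] by (rule W.dst_triangle) simp_all
      also have "\<dots> \<le> ?D (?const (z k)) (U k) + (?D (U k) (U l) + ?D (U l) (?const (z l)))"
        by (intro add_left_mono W.dst_triangle) simp_all
      also have "?D (?const (z k)) (U k) = ?D (U k) (?const (z k))"
        by (rule W.dst_commute) simp_all
      finally show ?thesis using z(2)[of k] z(2)[of l] by linarith
    qed
    have Z: "Cau z"
      unfolding Cau_iff
    proof
      have inv: "(\<lambda>k. 1 / real (Suc k)) \<longlonglongrightarrow> 0" by real_asymp
      have "((\<lambda>mn. 1 / real (Suc (fst mn)) + ?D (U (fst mn)) (U (snd mn)) + 1 / real (Suc (snd mn))) \<longlongrightarrow> 0)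
          (sequentially \<times>\<^sub>F sequentially)"
        using W.Cau_tendsto[OF U]
        by (intro tendsto_add_zero filterlim_compose[OF inv filterlim_fst] filterlim_compose[OF inv filterlim_snd])
          (simp add: case_prod_unfold)
      then show "((\<lambda>(m, n). dst (z m) (z n)) \<longlongrightarrow> 0) (sequentially \<times>\<^sub>F sequentially)"
        by (rule tendsto_sandwich[OF _ _ tendsto_const, rotated 2])
          (use zz in \<open>auto intro!: always_eventually simp del: of_nat_Suc\<close>)
    qed (use z in auto)
    show "\<exists>x\<in>vcarrier W. (\<lambda>n. ?D (U n) x) \<longlonglongrightarrow> 0"
    proof (intro bexI[of _ "cls z"] metric_LIMSEQ_I)
      fix e :: real assume e: "e > 0"
      then obtain N where N: "\<And>m n. m \<ge> N \<Longrightarrow> n \<ge> N \<Longrightarrow> dst (z m) (z n) < e / 3"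
        using Z unfolding ip_Cauchy_def by (meson divide_pos_pos zero_less_numeral)
      obtain M where M: "1 / real (Suc M) < e / 3" using nat_approx_posE[of "e / 3"] e by auto
      have "?D (U k) (cls z) < e" if k: "k \<ge> max M N" for k
      proof -
        have "?D (?const (z k)) (cls z) \<le> e / 3"
        proof (rule LIMSEQ_le_const2[OF completion_dist_tendsto[OF Cau_const[OF z(1)] Z]])
          show "\<exists>M. \<forall>n\<ge>M. dst (z k) (z n) \<le> e / 3"
            using N k by (intro exI[of _ N]) (auto intro: less_imp_le)
        qed
        moreover have "1 / real (Suc k) \<le> 1 / real (Suc M)"
          using k by (simp add: frac_le)
        moreover have "?D (U k) (cls z) \<le> ?D (U k) (?const (z k)) + ?D (?const (z k)) (cls z)"
          using Z by (intro W.dst_triangle) simp_all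
        ultimately show ?thesis using z(2)[of k] M e by linarith
      qed
      then show "\<exists>no. \<forall>n\<ge>no. dist (?D (U n) (cls z)) 0 < e"
        by (intro exI[of _ "max M N"]) (simp add: dist_real_def)
    qed (use Z in simp)
  qed
qed

end

section \<open>Feichtinger's algebra as a Hilbert module\<close>

lemma S0_space_simps [simp]:
  "vcarrier S0_space = feichtinger" "vzero S0_space = 0" "vadd S0_space = (+)" "vscale S0_space = scaleC"
  by (simp_all add: S0_space_def)

lemma complex_vector_space_S0: "complex_vector_space S0_space"
  by unfold_locales
    (auto simp: feichtinger_0 feichtinger_add feichtinger_scaleC scaleC_add_right scaleC_add_left
      scaleC_scaleC scaleC_minus1 add_ac)

context separated_subgroup
begin

lemma left_module_S0: "left_module (l1_algebra \<Lambda>) S0_space blinfun_apply"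
proof (intro left_module.intro left_module_axioms.intro star_algebra_l1_algebra complex_vector_space_S0)
  show "blinfun_apply T (vscale S0_space c x) = vscale S0_space c (blinfun_apply T x)"
    if "T \<in> l1_algebra \<Lambda>" for T c x
    using star_algebra.complex_linear[OF star_algebra_l1_algebra that] by simp
qed (simp_all add: l1_algebra_feichtinger blinfun.add_right blinfun.add_left)

lemma inner_product_module_S0:
  "inner_product_module (Cstar \<Lambda>) (l1_algebra \<Lambda>) S0_space blinfun_apply (S0_inner \<Lambda>)"
proof (intro inner_product_module.intro inner_product_module_axioms.intro left_module_S0 l1_algebra_subset_Cstar)
  fix f assume "f \<in> vcarrier (S0_space :: 'a L2 complex_space)"
  then have f: "f \<in> feichtinger" by simp
  show "positive_in (Cstar \<Lambda>) (S0_inner \<Lambda> f f) \<and> S0_inner \<Lambda> f f \<noteq> 0" if "f \<noteq> vzero S0_space"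
    using that f S0_inner_mem[OF f f] l1_algebra_subset_Cstar
    by (intro conjI S0_inner_nonzero positive_in_if_numerically_positive star_algebra_Cstar closed_Cstar
        S0_inner_adjoint_pair S0_inner_nonneg) auto
  fix g assume "g \<in> vcarrier (S0_space :: 'a L2 complex_space)"
  then have g: "g \<in> feichtinger" by simp
  show "S0_inner \<Lambda> f g \<in> Cstar \<Lambda>" using S0_inner_mem[OF f g] l1_algebra_subset_Cstar by blast
  show "S0_inner \<Lambda> f g = cadj (S0_inner \<Lambda> g f)" by (rule S0_inner_cadj[OF f g])
  show "S0_inner \<Lambda> (vscale S0_space c f) g = scale_op c (S0_inner \<Lambda> f g)" for c
    by (simp add: S0_inner_scale_left f g)
  show "S0_inner \<Lambda> (blinfun_apply T f) g = T o\<^sub>L S0_inner \<Lambda> f g" if "T \<in> l1_algebra \<Lambda>" for T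
    by (rule S0_inner_act[OF that f g])
  show "S0_inner \<Lambda> f (vscale S0_space c g) = scale_op (cnj c) (S0_inner \<Lambda> f g)" for c
  proof -
    have "S0_inner \<Lambda> f (c *\<^sub>C g) = cadj (scale_op c (S0_inner \<Lambda> g f))"
      using S0_inner_cadj[OF f feichtinger_scaleC[OF g]] by (simp add: S0_inner_scale_left f g)
    also have "\<dots> = scale_op (cnj c) (S0_inner \<Lambda> f g)"
      by (intro cadj_eqI adjoint_pair_scale S0_inner_adjoint_pair f g)
    finally show ?thesis by simp
  qed
  fix h assume "h \<in> vcarrier (S0_space :: 'a L2 complex_space)"
  then have h: "h \<in> feichtinger" by simp
  show "S0_inner \<Lambda> (vadd S0_space f g) h = S0_inner \<Lambda> f h + S0_inner \<Lambda> g h"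
    by (simp add: S0_inner_add_left f g h)
  show "S0_inner \<Lambda> f (vadd S0_space g h) = S0_inner \<Lambda> f g + S0_inner \<Lambda> f h"
  proof -
    have "S0_inner \<Lambda> f (g + h) = cadj (S0_inner \<Lambda> g f + S0_inner \<Lambda> h f)"
      using S0_inner_cadj[OF f feichtinger_add[OF g h]] by (simp add: S0_inner_add_left f g h)
    also have "\<dots> = S0_inner \<Lambda> f g + S0_inner \<Lambda> f h"
      by (intro cadj_eqI adjoint_pair_add S0_inner_adjoint_pair f g h)
    finally show ?thesis by simp
  qed
qed

lemma pre_hilbert_module_S0:
  "pre_hilbert_module (Cstar \<Lambda>) (l1_algebra \<Lambda>) S0_space blinfun_apply (S0_inner \<Lambda>)"
  by (intro pre_hilbert_module.intro pre_hilbert_module_axioms.intro inner_product_module_S0 Cstar_eq_closure)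
    (simp_all add: S0_inner_mem S0_inner_nonneg)

end

theorem theorem4p13:
  fixes \<Lambda> :: "((real ^ 'd) \<times> (real ^ 'd)) set"
  assumes "tf_lattice \<Lambda>"
  shows
    "(\<forall>f\<in>feichtinger. \<forall>g\<in>feichtinger. stft g f \<in> l1 \<Lambda>)
     \<and> (\<forall>a\<in>l1 \<Lambda>. (\<lambda>X. scale_op (a X) (tf_shift X)) summable_on \<Lambda>)
     \<and> (\<forall>a\<in>l1 \<Lambda>. \<forall>g\<in>feichtinger.
          ((\<lambda>X. a X *\<^sub>C blinfun_apply (tf_shift X) g) has_sum blinfun_apply (l1_op \<Lambda> a) g) \<Lambda>)
     \<and> inner_product_module (Cstar \<Lambda>) (l1_algebra \<Lambda>) S0_space blinfun_apply (S0_inner \<Lambda>)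
     \<and> left_hilbert_module (Cstar \<Lambda>)
          (ip_completion S0_space (S0_inner \<Lambda>))
          (completion_act (l1_algebra \<Lambda>) S0_space blinfun_apply (S0_inner \<Lambda>))
          (completion_ip (S0_inner \<Lambda>))
     \<and> (\<forall>T\<in>l1_algebra \<Lambda>. \<forall>f\<in>feichtinger.
          completion_act (l1_algebra \<Lambda>) S0_space blinfun_apply (S0_inner \<Lambda>) T
            (completion_embed S0_space (S0_inner \<Lambda>) f)
          = completion_embed S0_space (S0_inner \<Lambda>) (blinfun_apply T f))
     \<and> (\<forall>f\<in>feichtinger. \<forall>g\<in>feichtinger.
          completion_ip (S0_inner \<Lambda>)
            (completion_embed S0_space (S0_inner \<Lambda>) f) (completion_embed S0_space (S0_inner \<Lambda>) g)
          = S0_inner \<Lambda> f g)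
     \<and> (\<forall>T\<in>Cstar \<Lambda>. \<forall>F\<in>vcarrier (ip_completion S0_space (S0_inner \<Lambda>)). \<forall>S u.
          range S \<subseteq> l1_algebra \<Lambda> \<and> S \<longlonglongrightarrow> T \<and> u \<in> F \<longrightarrow>
          (\<lambda>n. blinfun_apply (S n) (u n))
            \<in> completion_act (l1_algebra \<Lambda>) S0_space blinfun_apply (S0_inner \<Lambda>) T F)
     \<and> (\<forall>F\<in>vcarrier (ip_completion S0_space (S0_inner \<Lambda>)).
        \<forall>G\<in>vcarrier (ip_completion S0_space (S0_inner \<Lambda>)). \<forall>u\<in>F. \<forall>v\<in>G.
          (\<lambda>n. S0_inner \<Lambda> (u n) (v n)) \<longlonglongrightarrow> completion_ip (S0_inner \<Lambda>) F G)"
proof -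
  obtain r where "separated_subgroup \<Lambda> r" using tf_lattice_separated[OF assms] by blast
  then interpret separated_subgroup \<Lambda> r .
  interpret M: pre_hilbert_module "Cstar \<Lambda>" "l1_algebra \<Lambda>" S0_space blinfun_apply "S0_inner \<Lambda>"
    by (rule pre_hilbert_module_S0)
  show ?thesis
  proof (intro conjI ballI allI impI)
    show "stft g f \<in> l1 \<Lambda>" if "f \<in> feichtinger" "g \<in> feichtinger" for f g
      by (rule stft_summable[OF that])
    show "(\<lambda>X. scale_op (a X) (tf_shift X)) summable_on \<Lambda>" if "a \<in> l1 \<Lambda>" for a
      using l1_op_has_sum[OF that] by (auto simp: summable_on_def)
    show "((\<lambda>X. a X *\<^sub>C blinfun_apply (tf_shift X) g) has_sum blinfun_apply (l1_op \<Lambda> a) g) \<Lambda>"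
      if "a \<in> l1 \<Lambda>" for a g
      by (rule l1_op_apply_has_sum[OF that])
    show "inner_product_module (Cstar \<Lambda>) (l1_algebra \<Lambda>) S0_space blinfun_apply (S0_inner \<Lambda>)"
      by (rule inner_product_module_S0)
    show "left_hilbert_module (Cstar \<Lambda>) (ip_completion S0_space (S0_inner \<Lambda>))
        (completion_act (l1_algebra \<Lambda>) S0_space blinfun_apply (S0_inner \<Lambda>)) (completion_ip (S0_inner \<Lambda>))"
      by (rule M.completion_left_hilbert)
    show "completion_act (l1_algebra \<Lambda>) S0_space blinfun_apply (S0_inner \<Lambda>) T
          (completion_embed S0_space (S0_inner \<Lambda>) f)
        = completion_embed S0_space (S0_inner \<Lambda>) (blinfun_apply T f)"
      if "T \<in> l1_algebra \<Lambda>" "f \<in> feichtinger" for T f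
      using M.completion_act_cls[OF M.Cau_const, of f "\<lambda>_. T" T] that
      by (simp add: completion_embed_def image_subset_iff)
    show "completion_ip (S0_inner \<Lambda>)
        (completion_embed S0_space (S0_inner \<Lambda>) f) (completion_embed S0_space (S0_inner \<Lambda>) g)
        = S0_inner \<Lambda> f g" if "f \<in> feichtinger" "g \<in> feichtinger" for f g
      unfolding completion_embed_def using that
      by (intro M.completion_ip_eqI M.Cau_const) simp_all
    show "(\<lambda>n. blinfun_apply (S n) (u n))
        \<in> completion_act (l1_algebra \<Lambda>) S0_space blinfun_apply (S0_inner \<Lambda>) T F"
      if "F \<in> vcarrier (ip_completion S0_space (S0_inner \<Lambda>))"
        and S: "range S \<subseteq> l1_algebra \<Lambda> \<and> S \<longlonglongrightarrow> T \<and> u \<in> F" for T F S u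
    proof -
      have u: "M.Cau u" "F = M.cls u" using M.mem_carrier[OF that(1), of u] S by auto
      show ?thesis
        using M.self_mem_cls[OF M.Cau_act[OF u(1)], of S T] M.completion_act_cls[OF u(1), of S T] S u(2)
        by simp
    qed
    show "(\<lambda>n. S0_inner \<Lambda> (u n) (v n)) \<longlonglongrightarrow> completion_ip (S0_inner \<Lambda>) F G"
      if "F \<in> vcarrier (ip_completion S0_space (S0_inner \<Lambda>))"
        "G \<in> vcarrier (ip_completion S0_space (S0_inner \<Lambda>))" "u \<in> F" "v \<in> G" for F G u v
      using M.completion_ip_tendsto M.mem_carrier[OF that(1,3)] M.mem_carrier[OF that(2,4)] by simp
  qed
qed

end
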